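(* Let $(\mathcal{E}_N)_{N=1}^\infty=(\mathbb{W}_N)_{N=1}^\infty$ or $(\mathcal{E}_N)_{N=1}^\infty=(\mathbb{W}_{N,+})_{N=1}^\infty$. Let $K\in\mathbb{N}$. For all $g\in C_c^\infty(\mathbb{R}^K)$, we have $$\sup_{\mathbf{x}^{(N)}\in\mathcal{E}_N}\left|\Lambda_K^\infty g\left(\omega(\mathbf{x}^{(N)})\right)-\Lambda_K^Ng\left(\mathbf{x}^{(N)}\right)\right|\longrightarrow0,\quad\text{as }N\to\infty.$$
   Context: Notation: $\mathbb{W}_N=\{\mathbf{x}\in\mathbb{R}^N:x_1\ge\dots\ge x_N\}$, $\mathbb{W}_{N,+}=\mathbb{W}_N\cap[0,\infty)^N$, $\mathbb{W}_{\infty,+}=\{(x_i)_{i=1}^\infty\in\mathbb{R}^{\mathbb{N}}:x_1\ge x_2\ge\cdots\ge0\}$. $C_c^\infty(\mathbb{R}^K)$ is the space of real-valued smooth compactly supported functions. For a Hermitian matrix $\mathbf{A}$ of size $N$, $\mathsf{eval}_N(\mathbf{A})\in\mathbb{W}_N$ is its vector of ordered eigenvalues. For $\mathbf{x}\in\mathbb{W}_{N+1}$, $\Lambda_N^{N+1}(\mathbf{x},\cdot)$ is the law of $\mathsf{eval}_N$ of the $N\times N$ top-left corner of $\mathbf{U}\,\mathrm{diag}(\mathbf{x})\,\mathbf{U}^\dagger$, with $\mathbf{U}$ Haar distributed on the unitary group $\mathbb{U}(N+1)$; and $\Lambda_K^N=\Lambda_{N-1}^N\Lambda_{N-2}^{N-1}\cdots\Lambda_K^{K+1}$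 for $N>K\ge1$. Let $\Omega=\{\omega=(\mathbf{x}^+,\mathbf{x}^-,\gamma,\delta)\in\mathbb{W}_{\infty,+}\times\mathbb{W}_{\infty,+}\times\mathbb{R}\times\mathbb{R}_+:\sum_i(x_i^+)^2+\sum_i(x_i^-)^2\le\delta\}$ and $\Omega_+=\{\omega=(\mathbf{x},\gamma)\in\mathbb{W}_{\infty,+}\times\mathbb{R}_+:\sum_ix_i\le\gamma\}$, with the topology of coordinate-wise convergence. For $\omega\in\Omega$ let $$\mathbf{A}_\omega^\infty=\gamma\mathbf{I}+\sqrt{\delta-\sum_{i=1}^\infty[(x_i^+)^2+(x_i^-)^2]}\;\mathbf{G}+\sum_{j=1}^\infty x_j^+(\boldsymbol{\xi}(j)\boldsymbol{\xi}(j)^\dagger-\mathbf{I})-\sum_{j=1}^\infty x_j^-(\boldsymbol{\zeta}(j)\boldsymbol{\zeta}(j)^\dagger-\mathbf{I}),$$ an infinite random Hermitian matrix, where $\mathbf{G}$ is an infinite Gaussian Hermitian matrix (independent entries up to Hermitian symmetry, $\mathbf{G}_{ii}\sim\mathcal{N}(0,1)$, $\Re\mathbf{G}_{ij},\Im\mathbf{G}_{ij}\sim\mathcal{N}(0,\frac12)$ independent for $i<j$) and $\boldsymbol{\xi}(j),\boldsymbol{\zeta}(j)$ are independent infinite vectors of i.i.d. standard complex Gaussians (real and imaginary parts independent $\mathcal{N}(0,\frac12)$), all independent. For $\omega\in\Omega_+$ let $\mathbf{A}_\omega^\infty=(\gamma-\sum_jx_j)\mathbf{I}+\sum_jx_j\boldsymbol{\xi}(j)\boldsymbol{\xi}(j)^\dagger$.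 In both cases $\Lambda_K^\infty(\omega,\cdot)$ is the law of $\mathsf{eval}_K$ of the $K\times K$ top-left corner of $\mathbf{A}_\omega^\infty$. Embeddings: for $\mathbf{x}^{(N)}\in\mathbb{W}_N$ (with $x_i^{(N)}\equiv0$ if $i\notin\{1,\dots,N\}$), $$\omega(\mathbf{x}^{(N)})=\left(\left(\tfrac{\max\{x_i^{(N)},0\}}{N}\right)_{i=1}^\infty,\left(\tfrac{\max\{-x_{N+1-i}^{(N)},0\}}{N}\right)_{i=1}^\infty,\tfrac1N\sum_{i=1}^Nx_i^{(N)},\tfrac1{N^2}\sum_{i=1}^N(x_i^{(N)})^2\right)\in\Omega,$$ while when $\mathcal{E}_N=\mathbb{W}_{N,+}$, $\omega(\mathbf{x}^{(N)})=\left((N^{-1}x_i^{(N)})_{i=1}^\infty,N^{-1}\sum_{i=1}^Nx_i^{(N)}\right)\in\Omega_+$. Convention: in the statement, $\Lambda_K^N(\mathbf{x},\mathrm{d}\mathbf{y})$ and $\Lambda_K^\infty(\omega,\mathrm{d}\mathbf{y})$ denote the symmetric extensions to $\mathbb{R}^K$ of, respectively, the probability measure $\Lambda_{N-1}^N\Lambda_{N-2}^{N-1}\cdots\Lambda_K^{K+1}(\mathbf{x},\cdot)$ on $\mathbb{W}_K$ and the law on $\mathbb{W}_K$ of $\mathsf{eval}_K$ of the $K\times K$ top-left corner of $\mathbf{A}_\omega^\infty$, not normalised, i.e. with total mass $K!$: they act on functions $g$ on $\mathbb{R}^K$ by integrating $\mathbf{y}\mapsto\sum_{\sigma\in\mathbb{S}_K}g(y_{\sigma(1)},\dots,y_{\sigma(K)})$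 (with $\mathbb{S}_K$ the symmetric group of degree $K$) against the original probability measure on $\mathbb{W}_K$. *)

theory Defs
  imports
    "HOL-Probability.Distributions"
    "HOL-Probability.Giry_Monad"
    "HOL-Combinatorics.Permutations"
    "Jordan_Normal_Form.Char_Poly"
    "Jordan_Normal_Form.Schur_Decomposition"
begin

section \<open>Weyl chambers\<close>

text \<open>
  Points of \<open>\<real>\<^sup>N\<close> are functions on \<open>nat\<close>, extensional on the index set \<open>{..<N}\<close>, so that
  the product measurable space \<open>PiM {..<N}\<close> of Borel spaces and the product topology on functions
  induce the usual structures. All coordinates are numbered from 0: the coordinate \<open>x\<^sub>i\<close> of the
  1-based notation is \<open>x (i - 1)\<close>.
\<close>

definition Rn :: "nat \<Rightarrow> (nat \<Rightarrow> real) set" where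
  "Rn N = ({..<N} \<rightarrow>\<^sub>E UNIV)"

definition weyl :: "nat \<Rightarrow> (nat \<Rightarrow> real) set" where
  "weyl N = {x \<in> Rn N. \<forall>i j. i \<le> j \<and> j < N \<longrightarrow> x j \<le> x i}"

definition weyl_pos :: "nat \<Rightarrow> (nat \<Rightarrow> real) set" where
  "weyl_pos N = {x \<in> weyl N. \<forall>i<N. 0 \<le> x i}"

definition weyl_inf_pos :: "(nat \<Rightarrow> real) set" where
  "weyl_inf_pos = {x. decseq x \<and> (\<forall>i. 0 \<le> x i)}"

definition weyl_borel :: "nat \<Rightarrow> (nat \<Rightarrow> real) measure" where
  "weyl_borel N = restrict_space (PiM {..<N} (\<lambda>_. borel)) (weyl N)"


section \<open>Hermitian matrices and the Haar measure on the unitary group\<close>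

definition hermitian_mat :: "nat \<Rightarrow> complex mat \<Rightarrow> bool" where
  "hermitian_mat N A \<longleftrightarrow> A \<in> carrier_mat N N \<and> mat_adjoint A = A"

text \<open>
  Eigenvalues are counted with multiplicity, as roots of the characteristic polynomial. The value
  on non-Hermitian matrices is a junk value; the guard matters because the infinite random matrices
  below may fail to be Hermitian on the null set where an infinite series diverges.
\<close>

definition eval_ord :: "nat \<Rightarrow> complex mat \<Rightarrow> (nat \<Rightarrow> real)" where
  "eval_ord N A =
    (if hermitian_mat N A
     then (\<lambda>i\<in>{..<N}. rev (sorted_list_of_multiset (image_mset Re (proots (char_poly A)))) ! i)
     else (\<lambda>i\<in>{..<N}. 0))"

definition corner :: "nat \<Rightarrow> complex mat \<Rightarrow> complex mat" where
  "corner N A = Matrix.mat N N (\<lambda>p. A $$ p)"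

definition mat_borel :: "nat \<Rightarrow> complex mat measure" where
  "mat_borel N = vimage_algebra (carrier_mat N N)
     (\<lambda>A. \<lambda>p\<in>{..<N} \<times> {..<N}. A $$ p) (PiM ({..<N} \<times> {..<N}) (\<lambda>_. borel))"

definition unitary_group :: "nat \<Rightarrow> complex mat set" where
  "unitary_group N =
    {U \<in> carrier_mat N N. U * mat_adjoint U = 1\<^sub>m N \<and> mat_adjoint U * U = 1\<^sub>m N}"

definition is_haar_unitary :: "nat \<Rightarrow> complex mat measure \<Rightarrow> bool" where
  "is_haar_unitary N \<mu> \<longleftrightarrow>
     prob_space \<mu> \<and>
     sets \<mu> = sets (restrict_space (mat_borel N) (unitary_group N)) \<and>
     (\<forall>V\<in>unitary_group N. distr \<mu> \<mu> (\<lambda>U. V * U) = \<mu>)"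

text \<open>The normalised Haar measure is unique, so the choice operator selects nothing arbitrary.\<close>

definition haar_unitary :: "nat \<Rightarrow> complex mat measure" where
  "haar_unitary N = (SOME \<mu>. is_haar_unitary N \<mu>)"


section \<open>The kernels on finite levels\<close>

text \<open>\<open>Lambda_step N x\<close> is the kernel from level \<open>N + 1\<close> to level \<open>N\<close>.\<close>

definition Lambda_step :: "nat \<Rightarrow> (nat \<Rightarrow> real) \<Rightarrow> (nat \<Rightarrow> real) measure" where
  "Lambda_step N x =
     distr (haar_unitary (N + 1)) (weyl_borel N)
       (\<lambda>U. eval_ord N (corner N (U * mat_diag (N + 1) (\<lambda>i. complex_of_real (x i)) * mat_adjoint U)))"

text \<open>
  \<open>Lambda_down K d\<close> is the composition of the \<open>d\<close> steps from level \<open>K + d\<close> to level \<open>K\<close>, the step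
  leaving the top level being performed first. Composition of kernels is the bind of the Giry monad.
\<close>

primrec Lambda_down :: "nat \<Rightarrow> nat \<Rightarrow> (nat \<Rightarrow> real) \<Rightarrow> (nat \<Rightarrow> real) measure" where
  "Lambda_down K 0 x = return (weyl_borel K) x"
| "Lambda_down K (Suc d) x = Giry_Monad.bind (Lambda_step (K + d) x) (Lambda_down K d)"

text \<open>Only meant for \<open>K \<le> N\<close>.\<close>

definition Lambda_fin :: "nat \<Rightarrow> nat \<Rightarrow> (nat \<Rightarrow> real) \<Rightarrow> (nat \<Rightarrow> real) measure" where
  "Lambda_fin K N x = Lambda_down K (N - K) x"


section \<open>The boundary spaces and the infinite random matrices\<close>

type_synonym omega = "(nat \<Rightarrow> real) \<times> (nat \<Rightarrow> real) \<times> real \<times> real"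
type_synonym omega_pos = "(nat \<Rightarrow> real) \<times> real"

definition Omega :: "omega set" where
  "Omega = {(xp, xm, \<gamma>, \<delta>). xp \<in> weyl_inf_pos \<and> xm \<in> weyl_inf_pos \<and> 0 \<le> \<delta> \<and>
     summable (\<lambda>i. (xp i)\<^sup>2) \<and> summable (\<lambda>i. (xm i)\<^sup>2) \<and>
     (\<Sum>i. (xp i)\<^sup>2) + (\<Sum>i. (xm i)\<^sup>2) \<le> \<delta>}"

definition Omega_pos :: "omega_pos set" where
  "Omega_pos = {(x, \<gamma>). x \<in> weyl_inf_pos \<and> 0 \<le> \<gamma> \<and> summable x \<and> (\<Sum>i. x i) \<le> \<gamma>}"

text \<open>
  All the Gaussian randomness is realised on the countable product of standard normal laws indexed
  by \<open>gauss_index\<close>; a complex Gaussian with independent real and imaginary parts of variance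
  \<open>1/2\<close> is built from two independent standard normals divided by \<open>sqrt 2\<close>.
\<close>

datatype gauss_index =
    GDiag nat | GRe nat nat | GIm nat nat
  | XiRe nat nat | XiIm nat nat | ZetaRe nat nat | ZetaIm nat nat

definition gauss_space :: "(gauss_index \<Rightarrow> real) measure" where
  "gauss_space = PiM UNIV (\<lambda>_. density lborel (\<lambda>t. ennreal (std_normal_density t)))"

definition gauss_herm :: "(gauss_index \<Rightarrow> real) \<Rightarrow> nat \<Rightarrow> nat \<Rightarrow> complex" where
  "gauss_herm w a b =
     (if a = b then complex_of_real (w (GDiag a))
      else if a < b then Complex (w (GRe a b)) (w (GIm a b)) / complex_of_real (sqrt 2)
      else cnj (Complex (w (GRe b a)) (w (GIm b a)) / complex_of_real (sqrt 2)))"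

definition gauss_xi :: "(gauss_index \<Rightarrow> real) \<Rightarrow> nat \<Rightarrow> nat \<Rightarrow> complex" where
  "gauss_xi w j a = Complex (w (XiRe j a)) (w (XiIm j a)) / complex_of_real (sqrt 2)"

definition gauss_zeta :: "(gauss_index \<Rightarrow> real) \<Rightarrow> nat \<Rightarrow> nat \<Rightarrow> complex" where
  "gauss_zeta w j a = Complex (w (ZetaRe j a)) (w (ZetaIm j a)) / complex_of_real (sqrt 2)"

definition id_entry :: "nat \<Rightarrow> nat \<Rightarrow> complex" where
  "id_entry a b = (if a = b then 1 else 0)"

text \<open>
  Infinite matrices are functions of row and column. The series over \<open>j\<close> are taken entrywise and
  pointwise in \<open>w\<close>; for parameters in \<open>Omega\<close> (\<open>Omega_pos\<close>) they converge almost surely.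
\<close>

definition A_inf :: "omega \<Rightarrow> (gauss_index \<Rightarrow> real) \<Rightarrow> nat \<Rightarrow> nat \<Rightarrow> complex" where
  "A_inf = (\<lambda>(xp, xm, \<gamma>, \<delta>) w a b.
     complex_of_real \<gamma> * id_entry a b
     + complex_of_real (sqrt (\<delta> - (\<Sum>i. (xp i)\<^sup>2 + (xm i)\<^sup>2))) * gauss_herm w a b
     + (\<Sum>j. complex_of_real (xp j) * (gauss_xi w j a * cnj (gauss_xi w j b) - id_entry a b))
     - (\<Sum>j. complex_of_real (xm j) * (gauss_zeta w j a * cnj (gauss_zeta w j b) - id_entry a b)))"

definition A_inf_pos :: "omega_pos \<Rightarrow> (gauss_index \<Rightarrow> real) \<Rightarrow> nat \<Rightarrow> nat \<Rightarrow> complex" where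
  "A_inf_pos = (\<lambda>(x, \<gamma>) w a b.
     complex_of_real (\<gamma> - (\<Sum>j. x j)) * id_entry a b
     + (\<Sum>j. complex_of_real (x j) * (gauss_xi w j a * cnj (gauss_xi w j b))))"

definition corner_inf :: "nat \<Rightarrow> (nat \<Rightarrow> nat \<Rightarrow> complex) \<Rightarrow> complex mat" where
  "corner_inf K A = Matrix.mat K K (\<lambda>(a, b). A a b)"

definition Lambda_inf :: "nat \<Rightarrow> omega \<Rightarrow> (nat \<Rightarrow> real) measure" where
  "Lambda_inf K \<omega> =
     distr gauss_space (weyl_borel K) (\<lambda>w. eval_ord K (corner_inf K (A_inf \<omega> w)))"

definition Lambda_inf_pos :: "nat \<Rightarrow> omega_pos \<Rightarrow> (nat \<Rightarrow> real) measure" where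
  "Lambda_inf_pos K \<omega> =
     distr gauss_space (weyl_borel K) (\<lambda>w. eval_ord K (corner_inf K (A_inf_pos \<omega> w)))"


section \<open>The embeddings into the boundary spaces\<close>

definition omega_of :: "nat \<Rightarrow> (nat \<Rightarrow> real) \<Rightarrow> omega" where
  "omega_of N x =
     (\<lambda>i. if i < N then max (x i) 0 / real N else 0,
      \<lambda>i. if i < N then max (- x (N - 1 - i)) 0 / real N else 0,
      (\<Sum>i<N. x i) / real N,
      (\<Sum>i<N. (x i)\<^sup>2) / (real N)\<^sup>2)"

definition omega_pos_of :: "nat \<Rightarrow> (nat \<Rightarrow> real) \<Rightarrow> omega_pos" where
  "omega_pos_of N x =
     (\<lambda>i. if i < N then x i / real N else 0, (\<Sum>i<N. x i) / real N)"


section \<open>Test functions and the symmetrised action\<close>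

definition partial_at :: "nat \<Rightarrow> ((nat \<Rightarrow> real) \<Rightarrow> real) \<Rightarrow> (nat \<Rightarrow> real) \<Rightarrow> real" where
  "partial_at i g x = deriv (\<lambda>t. g (x(i := t))) (x i)"

text \<open>\<open>Ck K m g\<close>: all iterated partial derivatives of order at most \<open>m\<close> exist and are continuous.\<close>

primrec Ck :: "nat \<Rightarrow> nat \<Rightarrow> ((nat \<Rightarrow> real) \<Rightarrow> real) \<Rightarrow> bool" where
  "Ck K 0 g \<longleftrightarrow> continuous_on (Rn K) g"
| "Ck K (Suc m) g \<longleftrightarrow> continuous_on (Rn K) g \<and>
     (\<forall>i<K. (\<forall>x\<in>Rn K. (\<lambda>t. g (x(i := t))) differentiable (at (x i))) \<and> Ck K m (partial_at i g))"

definition Cc_inf :: "nat \<Rightarrow> ((nat \<Rightarrow> real) \<Rightarrow> real) set" where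
  "Cc_inf K = {g. (\<forall>m. Ck K m g) \<and> compact (closure {x \<in> Rn K. g x \<noteq> 0})}"

text \<open>
  The action on a function \<open>g\<close> of the unnormalised symmetric extension (of total mass \<open>K!\<close>) of a
  probability measure on the Weyl chamber.
\<close>

definition sym_act :: "nat \<Rightarrow> (nat \<Rightarrow> real) measure \<Rightarrow> ((nat \<Rightarrow> real) \<Rightarrow> real) \<Rightarrow> real" where
  "sym_act K \<mu> g = (\<integral>y. (\<Sum>\<sigma> | \<sigma> permutes {..<K}. g (\<lambda>i. y (\<sigma> i))) \<partial>\<mu>)"


section \<open>Well-definedness of the encodings\<close>

lemma eval_ord_in_weyl: "eval_ord N A \<in> weyl N"
proof (cases "hermitian_mat N A")
  case False
  then show ?thesis by (auto simp: eval_ord_def weyl_def Rn_def)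
next
  case True
  then have A: "A \<in> carrier_mat N N" by (simp add: hermitian_mat_def)
  define l where "l = sorted_list_of_multiset (image_mset Re (proots (char_poly A)))"
  have "size (proots (char_poly A)) = N"
    using size_proots_complex[of "char_poly A"] degree_monic_char_poly[OF A] by simp
  then have len: "length l = N"
    unfolding l_def by (metis mset_sorted_list_of_multiset size_image_mset size_mset)
  have "rev l ! j \<le> rev l ! i" if "i \<le> j" "j < N" for i j
    using that len by (auto simp: rev_nth l_def intro!: sorted_nth_mono)
  then show ?thesis using True by (auto simp: eval_ord_def weyl_def Rn_def l_def)
qed

lemma omega_of_in_Omega:
  assumes x: "x \<in> weyl N"
  shows "omega_of N x \<in> Omega"
proof -
  have mono: "x j \<le> x i" if "i \<le> j" "j < N" for i j
    using x that by (auto simp: weyl_def)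
  define p where "p = (\<lambda>i. if i < N then max (x i) 0 / real N else 0)"
  define q where "q = (\<lambda>i. if i < N then max (- x (N - 1 - i)) 0 / real N else 0)"
  have p: "p \<in> weyl_inf_pos"
    unfolding weyl_inf_pos_def p_def decseq_def
    by (auto intro!: divide_right_mono max.mono mono)
  have q: "q \<in> weyl_inf_pos"
    unfolding weyl_inf_pos_def q_def decseq_def
    by (auto intro!: divide_right_mono max.mono mono)
  have sp: "(\<lambda>i. (p i)\<^sup>2) sums (\<Sum>i<N. (p i)\<^sup>2)"
    by (rule sums_finite) (auto simp: p_def)
  have sq: "(\<lambda>i. (q i)\<^sup>2) sums (\<Sum>i<N. (q i)\<^sup>2)"
    by (rule sums_finite) (auto simp: q_def)
  have "(\<Sum>i<N. (q i)\<^sup>2) = (\<Sum>i<N. (max (- x (N - Suc i)) 0 / real N)\<^sup>2)"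
    by (rule sum.cong) (auto simp: q_def)
  also have "\<dots> = (\<Sum>i<N. (max (- x i) 0 / real N)\<^sup>2)"
    by (rule sum.nat_diff_reindex)
  finally have "(\<Sum>i<N. (p i)\<^sup>2) + (\<Sum>i<N. (q i)\<^sup>2)
      = (\<Sum>i<N. (max (x i) 0 / real N)\<^sup>2 + (max (- x i) 0 / real N)\<^sup>2)"
    by (simp add: p_def sum.distrib)
  also have "\<dots> = (\<Sum>i<N. (x i)\<^sup>2 / (real N)\<^sup>2)"
    by (rule sum.cong) (auto simp: max_def power_divide)
  finally show ?thesis
    using p q sp sq
    unfolding Omega_def omega_of_def p_def[symmetric] q_def[symmetric]
    by (auto simp: sums_iff sum_divide_distrib intro!: divide_nonneg_nonneg sum_nonneg)
qed

lemma omega_pos_of_in_Omega_pos: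
  assumes x: "x \<in> weyl_pos N"
  shows "omega_pos_of N x \<in> Omega_pos"
proof -
  have mono: "x j \<le> x i" if "i \<le> j" "j < N" for i j
    using x that by (auto simp: weyl_pos_def weyl_def)
  have nn: "0 \<le> x i" if "i < N" for i
    using x that by (auto simp: weyl_pos_def)
  define p where "p = (\<lambda>i. if i < N then x i / real N else 0)"
  have p: "p \<in> weyl_inf_pos"
    unfolding weyl_inf_pos_def p_def decseq_def
    by (auto intro!: divide_right_mono mono nn divide_nonneg_nonneg)
  have "p sums (\<Sum>i<N. p i)"
    by (rule sums_finite) (auto simp: p_def)
  moreover have "(\<Sum>i<N. p i) = (\<Sum>i<N. x i) / real N"
    by (simp add: p_def sum_divide_distrib)
  ultimately show ?thesis
    using p unfolding Omega_pos_def omega_pos_of_def p_def[symmetric]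
    by (auto simp: sums_iff intro!: divide_nonneg_nonneg sum_nonneg nn)
qed

end

theory Submission
  imports Defs "HOL-Complex_Analysis.Great_Picard"
begin

text \<open>
  Fix \<open>K\<close>, write \<open>D = diag x\<close> for \<open>x \<in> weyl N\<close>, and let \<open>f M\<close> be the sum of \<open>g\<close> over all orderings of
  the eigenvalues of a Hermitian \<open>K \<times> K\<close> matrix \<open>M\<close>. Both measures are expressed by matrices built
  from the same \<open>D\<close>.

  \<^item> For \<open>\<omega> = \<omega>(x)\<close> the Gaussian part of \<open>A_\<omega>\<close> has coefficient zero and the multiples of the identity
    cancel. Hence, in both cases, the \<open>K \<times> K\<close> corner of \<open>A_\<omega>\<close> has the law of \<open>G D G\<^sup>\<dagger>\<close>, where \<open>G\<close> is
    a \<open>K \<times> N\<close> matrix of independent complex Gaussians of variance \<open>1/N\<close> (\<open>sym_act_Lambda_inf\<close>).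
  \<^item> The successive kernels compose to the law of the eigenvalues of the \<open>K \<times> K\<close> corner of \<open>U D U\<^sup>\<dagger>\<close>
    with \<open>U\<close> Haar distributed on the unitary group of size \<open>N\<close> (\<open>Lambda_down_eq_corner_law\<close>). This
    rests on the two-sided invariance of the Haar measure.

  The law of \<open>G\<close> does not change when \<open>G\<close> is multiplied from the right by a unitary matrix
  (\<open>gauss_invariant_unitary\<close>), so \<open>G\<close> may be replaced by \<open>G U\<close> with an independent Haar unitary \<open>U\<close>.
  By Chebyshev's inequality \<open>G G\<^sup>\<dagger>\<close> is close to the identity outside an event of probability
  \<open>O(1/N)\<close> (\<open>near_coisometry_prob\<close>), and this event has nothing to do with \<open>x\<close>. Outside of it the
  polar decomposition gives \<open>G = P T W\<close> with \<open>P\<close> close to the identity, \<open>T\<close> the \<open>K \<times> N\<close> truncation and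
  \<open>W\<close> unitary (\<open>near_coisometry_polar\<close>). Since \<open>W U\<close> is again Haar distributed, it remains to
  compare \<open>f (P H P\<^sup>\<dagger>)\<close> with \<open>f H\<close> for the corner \<open>H\<close> of \<open>U D U\<^sup>\<dagger>\<close>. The function \<open>f\<close> is continuous and
  vanishes for large \<open>H\<close>, so the difference is small uniformly in \<open>H\<close>
  (\<open>eval_ord_perturbation_uniform\<close>). Thus the whole estimate is uniform in \<open>x\<close>, although \<open>x\<close> ranges
  over an unbounded set.

  The supporting facts are the spectral theorem with ordered eigenvalues (\<open>hermitian_spectral\<close>), the
  continuity of the ordered eigenvalues (\<open>eval_ord_tendsto\<close>), the invariance of Gaussian
  matrices, which is deduced from plane rotations by elimination (\<open>unitary_elimination_induct\<close>), and the
  existence of the Haar measure, obtained by applying the Gram--Schmidt process to a Gaussian matrix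
  (\<open>is_haar_unitary_exists\<close>).
\<close>

section \<open>Adjoints, Hermitian and unitary matrices\<close>

lemma mat_adjoint_dim[simp]:
  "dim_row (mat_adjoint A) = dim_col A" "dim_col (mat_adjoint A) = dim_row A"
  by (auto simp: mat_adjoint_def)

lemma mat_adjoint_carrier[simp]: "mat_adjoint A \<in> carrier_mat n m \<longleftrightarrow> A \<in> carrier_mat m n"
  unfolding carrier_mat_def mem_Collect_eq mat_adjoint_dim by (rule conj_commute)

lemma mat_adjoint_index[simp]:
  "i < dim_col A \<Longrightarrow> j < dim_row A \<Longrightarrow> mat_adjoint (A :: complex mat) $$ (i, j) = cnj (A $$ (j, i))"
  by (simp add: mat_adjoint_def mat_of_rows_def)

lemma mat_adjoint_adjoint[simp]: "mat_adjoint (mat_adjoint (A :: complex mat)) = A"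
  by (rule eq_matI) auto

lemma mat_mult_index:
  "i < dim_row A \<Longrightarrow> j < dim_col B \<Longrightarrow> dim_col A = dim_row B \<Longrightarrow>
    (A * B) $$ (i, j) = (\<Sum>k<dim_row B. A $$ (i, k) * B $$ (k, j))"
  by (simp add: scalar_prod_def atLeast0LessThan)

lemma mat_adjoint_mult:
  "dim_col A = dim_row B \<Longrightarrow>
    mat_adjoint (A * B) = mat_adjoint B * mat_adjoint (A :: complex mat)"
  by (rule eq_matI) (auto simp: mat_mult_index mult.commute simp del: index_mult_mat(1))

lemma mat_mult_assoc:
  "dim_col A = dim_row B \<Longrightarrow> dim_col B = dim_row C \<Longrightarrow> (A :: complex mat) * B * C = A * (B * C)"
  by (rule assoc_mult_mat) auto

lemma mat_adjoint_one[simp]: "mat_adjoint (1\<^sub>m n) = (1\<^sub>m n :: complex mat)"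
  by (rule eq_matI) auto

lemma mat_diag_dims[simp]: "dim_row (mat_diag n f) = n" "dim_col (mat_diag n f) = n"
  by (auto simp: mat_diag_def)

lemma mat_diag_index[simp]: "i < n \<Longrightarrow> j < n \<Longrightarrow> mat_diag n f $$ (i, j) = (if i = j then f j else 0)"
  by (auto simp: mat_diag_def)

lemma mat_adjoint_diag: "mat_adjoint (mat_diag n f) = mat_diag n (\<lambda>i. cnj (f i))"
  by (rule eq_matI) auto

lemma hermitian_mat_iff:
  "hermitian_mat n A \<longleftrightarrow> A \<in> carrier_mat n n \<and> (\<forall>i<n. \<forall>j<n. A $$ (i, j) = cnj (A $$ (j, i)))"
proof
  assume h: "hermitian_mat n A"
  have "A $$ (i, j) = cnj (A $$ (j, i))" if "i < n" "j < n" for i j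
    using h that mat_adjoint_index[of i A j] by (auto simp: hermitian_mat_def)
  then show "A \<in> carrier_mat n n \<and> (\<forall>i<n. \<forall>j<n. A $$ (i, j) = cnj (A $$ (j, i)))"
    using h unfolding hermitian_mat_def by blast
next
  assume h: "A \<in> carrier_mat n n \<and> (\<forall>i<n. \<forall>j<n. A $$ (i, j) = cnj (A $$ (j, i)))"
  then have d: "dim_row A = n" "dim_col A = n" by blast+
  have "mat_adjoint A = A"
  proof (rule eq_matI)
    fix i j assume ij: "i < dim_row A" "j < dim_col A"
    then have "mat_adjoint A $$ (i, j) = cnj (A $$ (j, i))" using d by simp
    also have "\<dots> = A $$ (i, j)" using h ij d by metis
    finally show "mat_adjoint A $$ (i, j) = A $$ (i, j)" .
  qed (auto simp: d)
  then show "hermitian_mat n A" using h unfolding hermitian_mat_def by blast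
qed

lemma hermitian_mat_diag: "hermitian_mat n (mat_diag n (\<lambda>i. complex_of_real (x i)))"
  by (simp add: hermitian_mat_def mat_adjoint_diag)

lemma hermitian_mat_conj:
  "hermitian_mat n A \<Longrightarrow> P \<in> carrier_mat m n \<Longrightarrow> hermitian_mat m (P * A * mat_adjoint P)"
  unfolding hermitian_mat_def by (auto simp: mat_adjoint_mult mat_mult_assoc)

lemma unitary_groupI:
  assumes "U \<in> carrier_mat n n" "U * mat_adjoint U = 1\<^sub>m n"
  shows "U \<in> unitary_group n"
  using mat_mult_left_right_inverse[OF assms(1) _ assms(2)] assms
  by (auto simp: unitary_group_def)

lemma unitary_groupD:
  assumes "U \<in> unitary_group n"
  shows "U \<in> carrier_mat n n" "dim_row U = n" "dim_col U = n"
    "U * mat_adjoint U = 1\<^sub>m n" "mat_adjoint U * U = 1\<^sub>m n"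
  using assms by (auto simp: unitary_group_def)

lemma unitary_group_cancel:
  assumes "U \<in> unitary_group n" "dim_row X = n"
  shows "U * (mat_adjoint U * X) = X" "mat_adjoint U * (U * X) = X"
proof -
  have "U * (mat_adjoint U * X) = U * mat_adjoint U * X"
    using assms unitary_groupD(1-3)[OF assms(1)] by (subst mat_mult_assoc) auto
  then show "U * (mat_adjoint U * X) = X"
    using assms unitary_groupD(4)[OF assms(1)] left_mult_one_mat[of X n] by auto
  have "mat_adjoint U * (U * X) = mat_adjoint U * U * X"
    using assms unitary_groupD(1-3)[OF assms(1)] by (subst mat_mult_assoc) auto
  then show "mat_adjoint U * (U * X) = X"
    using assms unitary_groupD(5)[OF assms(1)] left_mult_one_mat[of X n] by auto
qed

lemma unitary_group_one: "1\<^sub>m n \<in> unitary_group n"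
  by (auto simp: unitary_group_def)

lemma unitary_group_adjoint: "U \<in> unitary_group n \<Longrightarrow> mat_adjoint U \<in> unitary_group n"
  by (auto simp: unitary_group_def)

lemma unitary_group_mult:
  assumes "U \<in> unitary_group n" "V \<in> unitary_group n"
  shows "U * V \<in> unitary_group n"
proof (rule unitary_groupI)
  show "U * V * mat_adjoint (U * V) = 1\<^sub>m n"
    using unitary_groupD[OF assms(1)] unitary_groupD[OF assms(2)]
    by (simp add: mat_adjoint_mult mat_mult_assoc unitary_group_cancel[OF assms(2)])
qed (use unitary_groupD[OF assms(1)] unitary_groupD[OF assms(2)] in auto)

text \<open>
  The first \<open>K\<close> rows of \<open>r\<close>, restricted to the first \<open>N\<close> columns, are orthonormal for the standard
  Hermitian inner product, which is conjugate linear in its second argument.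
\<close>

definition orthonormal_rows :: "nat \<Rightarrow> nat \<Rightarrow> (nat \<Rightarrow> nat \<Rightarrow> complex) \<Rightarrow> bool" where
  "orthonormal_rows K N r \<longleftrightarrow>
     (\<forall>i<K. \<forall>j<K. (\<Sum>l<N. r i l * cnj (r j l)) = (if i = j then 1 else 0))"

lemma unit_vector_orthogonal_to_rows:
  fixes r :: "nat \<Rightarrow> nat \<Rightarrow> complex"
  assumes "K < N"
  obtains v where "(\<Sum>l<N. v l * cnj (v l)) = 1" "\<And>i. i < K \<Longrightarrow> (\<Sum>l<N. r i l * cnj (v l)) = 0"
proof -
  \<comment> \<open>the square matrix obtained by adding zero rows is singular; the conjugate of a normalised kernel vector works\<close>
  define B where "B = Matrix.mat N N (\<lambda>(i, j). if i < K then r i j else 0)"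
  have B: "B \<in> carrier_mat N N" by (simp add: B_def)
  have u: "unit_vec N (N - 1) \<noteq> (0\<^sub>v N :: complex vec)"
    using assms by (simp add: unit_vec_nonzero)
  have "transpose_mat B *\<^sub>v unit_vec N (N - 1) = 0\<^sub>v N"
    using assms by (intro eq_vecI) (auto simp: B_def)
  then have "Determinant.det (transpose_mat B) = 0"
    using det_0_iff_vec_prod_zero[of "transpose_mat B" N] u B unit_vec_carrier[of N "N - 1"]
    by (metis transpose_carrier_mat)
  then have "Determinant.det B = 0" using det_transpose[OF B] by simp
  then obtain w where w: "w \<in> carrier_vec N" "w \<noteq> 0\<^sub>v N" "B *\<^sub>v w = 0\<^sub>v N"
    using det_0_iff_vec_prod_zero[OF B] by auto
  have w0: "(\<Sum>l<N. r i l * w $ l) = 0" if "i < K" for i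
  proof -
    have "(B *\<^sub>v w) $ i = (\<Sum>l<N. r i l * w $ l)"
      using that assms w(1) by (simp add: B_def scalar_prod_def atLeast0LessThan)
    then show ?thesis using w(3) that assms by simp
  qed
  define s where "s = (\<Sum>l<N. (cmod (w $ l))\<^sup>2)"
  obtain l0 where l0: "l0 < N" "w $ l0 \<noteq> 0"
    using w(1,2) by (metis carrier_vecD eq_vecI index_zero_vec(1) index_zero_vec(2))
  have s: "s > 0" unfolding s_def by (rule sum_pos2[of _ l0]) (use l0 in auto)
  define v where "v = (\<lambda>l. cnj (w $ l) / complex_of_real (sqrt s))"
  have "(\<Sum>l<N. v l * cnj (v l)) = (\<Sum>l<N. complex_of_real ((cmod (w $ l))\<^sup>2 / s))"
  proof (rule sum.cong)
    fix l assume "l \<in> {..<N}"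
    have "complex_of_real (sqrt s) * complex_of_real (sqrt s) = complex_of_real s"
      using s by (metis abs_of_pos of_real_mult real_sqrt_mult_self)
    then show "v l * cnj (v l) = complex_of_real ((cmod (w $ l))\<^sup>2 / s)"
      using complex_norm_square[of "w $ l"] by (simp add: v_def mult.commute)
  qed simp
  also have "\<dots> = complex_of_real (s / s)"
    unfolding s_def sum_divide_distrib by simp
  finally have 1: "(\<Sum>l<N. v l * cnj (v l)) = 1" using s by simp
  have 2: "(\<Sum>l<N. r i l * cnj (v l)) = 0" if "i < K" for i
  proof -
    have "(\<Sum>l<N. r i l * cnj (v l)) = (\<Sum>l<N. r i l * w $ l) / complex_of_real (sqrt s)"
      by (simp add: v_def sum_divide_distrib)
    then show ?thesis using w0[OF that] by simp
  qed
  show thesis by (rule that[of v]) (use 1 2 in auto)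
qed

lemma orthonormal_rows_extend:
  assumes "orthonormal_rows K N r" "K \<le> N"
  shows "\<exists>r'. orthonormal_rows N N r' \<and> (\<forall>i<K. r' i = r i)"
  using assms
proof (induction "N - K" arbitrary: K r)
  case 0
  then show ?case by auto
next
  case (Suc d)
  then have K: "K < N" by simp
  obtain v where v: "(\<Sum>l<N. v l * cnj (v l)) = 1" "\<And>i. i < K \<Longrightarrow> (\<Sum>l<N. r i l * cnj (v l)) = 0"
    using unit_vector_orthogonal_to_rows[OF K] by blast
  have v': "(\<Sum>l<N. v l * cnj (r i l)) = 0" if "i < K" for i
    using arg_cong[OF v(2)[OF that], of cnj] by (simp add: mult.commute)
  have "orthonormal_rows (Suc K) N (r(K := v))"
    using Suc.prems v v' by (auto simp: orthonormal_rows_def less_Suc_eq)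
  moreover have "d = N - Suc K" "Suc K \<le> N" using Suc.hyps(2) K by auto
  ultimately have "\<exists>r'. orthonormal_rows N N r' \<and> (\<forall>i<Suc K. r' i = (r(K := v)) i)"
    using Suc.hyps(1)[of "Suc K" "r(K := v)"] by blast
  then obtain r' where "orthonormal_rows N N r'" "\<forall>i<Suc K. r' i = (r(K := v)) i"
    by blast
  then show ?case by (intro exI[of _ r']) auto
qed

lemma mat_mult_adjoint_index:
  assumes "i < dim_row A" "j < dim_row B" "dim_col A = N" "dim_col B = N"
  shows "(A * mat_adjoint B) $$ (i, j) = (\<Sum>l<N. A $$ (i, l) * cnj (B $$ (j, l)))"
proof -
  have "(A * mat_adjoint B) $$ (i, j)
      = (\<Sum>l<dim_row (mat_adjoint B). A $$ (i, l) * mat_adjoint B $$ (l, j))"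
    using assms by (intro mat_mult_index) auto
  also have "\<dots> = (\<Sum>l<N. A $$ (i, l) * cnj (B $$ (j, l)))"
    using assms by (intro sum.cong) auto
  finally show ?thesis .
qed

lemma orthonormal_rows_mat:
  assumes "orthonormal_rows n n r"
  shows "Matrix.mat n n (\<lambda>(i, j). r i j) \<in> unitary_group n" (is "?U \<in> _")
proof (rule unitary_groupI)
  show "?U * mat_adjoint ?U = 1\<^sub>m n"
  proof (rule eq_matI)
    fix i j assume ij: "i < dim_row (1\<^sub>m n :: complex mat)" "j < dim_col (1\<^sub>m n :: complex mat)"
    then have "(?U * mat_adjoint ?U) $$ (i, j) = (\<Sum>l<n. r i l * cnj (r j l))"
      by (subst mat_mult_adjoint_index[where N=n]) auto
    also have "\<dots> = (if i = j then 1 else 0)"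
      using assms ij unfolding orthonormal_rows_def by simp
    finally show "(?U * mat_adjoint ?U) $$ (i, j) = 1\<^sub>m n $$ (i, j)"
      using ij by simp
  qed simp_all
qed simp

lemma coisometry_rows_orthonormal:
  fixes V :: "complex mat"
  assumes V: "V \<in> carrier_mat K N" "V * mat_adjoint V = 1\<^sub>m K"
  shows "orthonormal_rows K N (\<lambda>i j. V $$ (i, j))"
  unfolding orthonormal_rows_def
proof (intro allI impI)
  fix i j assume ij: "i < K" "j < K"
  have "(V * mat_adjoint V) $$ (i, j) = (\<Sum>l<N. V $$ (i, l) * cnj (V $$ (j, l)))"
    using ij V(1) by (intro mat_mult_adjoint_index) auto
  then show "(\<Sum>l<N. V $$ (i, l) * cnj (V $$ (j, l))) = (if i = j then 1 else 0)"
    using ij V(2) by simp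
qed

lemma coisometry_extend_unitary:
  fixes V :: "complex mat"
  assumes V: "V \<in> carrier_mat K N" "V * mat_adjoint V = 1\<^sub>m K" and "K \<le> N"
  obtains W where "W \<in> unitary_group N" "\<And>i j. i < K \<Longrightarrow> j < N \<Longrightarrow> W $$ (i, j) = V $$ (i, j)"
proof -
  obtain r' where r': "orthonormal_rows N N r'" "\<forall>i<K. r' i = (\<lambda>j. V $$ (i, j))"
    using orthonormal_rows_extend[OF coisometry_rows_orthonormal[OF V] \<open>K \<le> N\<close>] by blast
  show thesis
  proof (rule that[OF orthonormal_rows_mat[OF r'(1)]])
    fix i j assume "i < K" "j < N"
    then show "Matrix.mat N N (\<lambda>(i, j). r' i j) $$ (i, j) = V $$ (i, j)"
      using r'(2) \<open>K \<le> N\<close> by simp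
  qed
qed

section \<open>The spectral theorem and ordered eigenvalues\<close>

lemma char_poly_unitary_conj:
  assumes "W \<in> unitary_group n" "A \<in> carrier_mat n n"
  shows "char_poly (W * A * mat_adjoint W) = char_poly A"
proof (rule char_poly_similar)
  show "similar_mat (W * A * mat_adjoint W) A"
    unfolding similar_mat_def
    by (intro exI[of _ W] exI[of _ "mat_adjoint W"] similar_mat_witI[of _ _ n])
       (use unitary_groupD[OF assms(1)] assms(2) in auto)
qed

lemma mat_diag_Suc:
  "mat_diag (Suc m) f = four_block_mat (Matrix.mat 1 1 (\<lambda>_. f 0)) (0\<^sub>m 1 m) (0\<^sub>m m 1)
     (mat_diag m (\<lambda>i. f (Suc i)))"
  by (rule eq_matI) auto

lemma mat_adjoint_four_block:
  assumes "A \<in> carrier_mat a a" "D \<in> carrier_mat d d"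
  shows "mat_adjoint (four_block_mat A (0\<^sub>m a d) (0\<^sub>m d a) D)
    = four_block_mat (mat_adjoint A) (0\<^sub>m a d) (0\<^sub>m d a) (mat_adjoint D :: complex mat)"
  using assms by (intro eq_matI) auto

lemma unitary_group_block:
  assumes "U \<in> unitary_group a" "W \<in> unitary_group d"
  shows "four_block_mat U (0\<^sub>m a d) (0\<^sub>m d a) W \<in> unitary_group (a + d)" (is "?Z \<in> _")
proof (rule unitary_groupI)
  note U = unitary_groupD[OF assms(1)] and W = unitary_groupD[OF assms(2)]
  show "?Z * mat_adjoint ?Z = 1\<^sub>m (a + d)"
    unfolding mat_adjoint_four_block[OF U(1) W(1)]
    by (subst mult_four_block_mat[of _ a a _ d _ d _ _ a _ d]) (use U W in auto)
  show "?Z \<in> carrier_mat (a + d) (a + d)" using U W by auto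
qed

text \<open>
  The order of the eigenvalues is prescribed by the list \<open>es\<close>. The proof deflates one eigenvector at a
  time.
\<close>

lemma hermitian_diagonalization:
  assumes "hermitian_mat n A" "char_poly A = (\<Prod>e\<leftarrow>es. [:- e, 1:])"
  shows "\<exists>W\<in>unitary_group n. A = W * mat_diag n (\<lambda>i. es ! i) * mat_adjoint W"
  using assms
proof (induction es arbitrary: n A)
  case Nil
  then have A: "A \<in> carrier_mat n n" by (simp add: hermitian_mat_def)
  with degree_monic_char_poly[OF A] Nil(2) have n: "n = 0" by simp
  show ?case
    by (rule bexI[of _ "1\<^sub>m n"], rule eq_matI) (use A n unitary_group_one in auto)
next
  case (Cons e es)
  then have A: "A \<in> carrier_mat n n" by (simp add: hermitian_mat_def)
  have mon: "monic (\<Prod>e\<leftarrow>es. [:- e, 1:])" by (rule monic_prod_list, auto)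
  have "degree (char_poly A) = Suc (degree (\<Prod>e\<leftarrow>es. [:- e, 1:]))"
    unfolding Cons.prems(2) list.map prod_list.Cons
    by (subst degree_mult_eq) (use mon in auto)
  with degree_monic_char_poly[OF A] obtain m where n: "n = Suc m" by (cases n) auto
  have "eigenvalue A e"
    unfolding eigenvalue_root_char_poly[OF A] Cons.prems(2) by simp
  then obtain w where w: "w \<in> carrier_vec n" "w \<noteq> 0\<^sub>v n" "A *\<^sub>v w = e \<cdot>\<^sub>v w"
    using A unfolding eigenvalue_def eigenvector_def by auto
  define s where "s = (\<Sum>l<n. (cmod (w $ l))\<^sup>2)"
  obtain l0 where l0: "l0 < n" "w $ l0 \<noteq> 0"
    using w(1,2) by (metis carrier_vecD eq_vecI index_zero_vec(1) index_zero_vec(2))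
  have s: "s > 0" unfolding s_def by (rule sum_pos2[of _ l0]) (use l0 in auto)
  define v where "v = (\<lambda>l. w $ l / complex_of_real (sqrt s))"
  have "(\<Sum>l<n. cnj (v l) * v l) = (\<Sum>l<n. complex_of_real ((cmod (w $ l))\<^sup>2 / s))"
  proof (rule sum.cong)
    fix l
    have "complex_of_real (sqrt s) * complex_of_real (sqrt s) = complex_of_real s"
      using s by (metis abs_of_pos of_real_mult real_sqrt_mult_self)
    then show "cnj (v l) * v l = complex_of_real ((cmod (w $ l))\<^sup>2 / s)"
      using complex_norm_square[of "w $ l"] by (simp add: v_def mult.commute)
  qed simp
  also have "\<dots> = complex_of_real (s / s)"
    unfolding s_def sum_divide_distrib by simp
  finally have "orthonormal_rows 1 n (\<lambda>_ l. cnj (v l))"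
    using s by (simp add: orthonormal_rows_def)
  \<comment> \<open>the unitary matrix with these rows maps the unit eigenvector \<open>v\<close> to the first basis vector\<close>
  then obtain r where r: "orthonormal_rows n n r" "r 0 = (\<lambda>l. cnj (v l))"
    using orthonormal_rows_extend[of 1 n] n by auto
  have ev: "(\<Sum>l<n. A $$ (i, l) * v l) = e * v i" if "i < n" for i
  proof -
    have "(A *\<^sub>v w) $ i = (\<Sum>l<n. A $$ (i, l) * w $ l)"
      using that A w(1) by (simp add: scalar_prod_def atLeast0LessThan)
    then have "(\<Sum>l<n. A $$ (i, l) * w $ l) = e * w $ i" using w(1,3) that by simp
    then show ?thesis
      by (simp add: v_def sum_divide_distrib[symmetric])
  qed
  define W where "W = Matrix.mat n n (\<lambda>(i, j). r i j)"
  have W: "W \<in> unitary_group n" unfolding W_def by (rule orthonormal_rows_mat[OF r(1)])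
  note Wd = unitary_groupD[OF W]
  define A' where "A' = W * A * mat_adjoint W"
  have A': "hermitian_mat n A'" unfolding A'_def by (rule hermitian_mat_conj[OF Cons.prems(1) Wd(1)])
  then have A'c: "dim_row A' = n" "dim_col A' = n" unfolding hermitian_mat_def by auto
  have col: "A' $$ (i, 0) = (if i = 0 then e else 0)" if i: "i < n" for i
  proof -
    have "A' = W * (A * mat_adjoint W)" unfolding A'_def using A Wd by (simp add: mat_mult_assoc)
    then have "A' $$ (i, 0) = (\<Sum>k<n. W $$ (i, k) * (A * mat_adjoint W) $$ (k, 0))"
      using i A Wd n by (simp only:) (subst mat_mult_index, auto)
    also have "\<dots> = (\<Sum>k<n. r i k * (e * v k))"
    proof (rule sum.cong)
      fix k assume "k \<in> {..<n}"
      then have k: "k < n" by simp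
      have "(A * mat_adjoint W) $$ (k, 0) = (\<Sum>l<n. A $$ (k, l) * cnj (W $$ (0, l)))"
        by (rule mat_mult_adjoint_index) (use k A Wd n in auto)
      also have "\<dots> = (\<Sum>l<n. A $$ (k, l) * v l)"
        using n by (intro sum.cong) (auto simp: W_def r(2))
      also have "\<dots> = e * v k" by (rule ev[OF k])
      finally show "W $$ (i, k) * (A * mat_adjoint W) $$ (k, 0) = r i k * (e * v k)"
        using i k by (simp add: W_def)
    qed simp
    also have "\<dots> = e * (\<Sum>k<n. r i k * cnj (r 0 k))"
      by (simp add: r(2) sum_distrib_left mult_ac)
    also have "(\<Sum>k<n. r i k * cnj (r 0 k)) = (if i = 0 then 1 else 0)"
      using r(1) i n unfolding orthonormal_rows_def by simp
    finally show ?thesis by simp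
  qed
  have herm: "A' $$ (i, j) = cnj (A' $$ (j, i))" if "i < n" "j < n" for i j
    using A' that unfolding hermitian_mat_iff by blast
  define A3 where "A3 = Matrix.mat m m (\<lambda>(i, j). A' $$ (Suc i, Suc j))"
  have "e = cnj e" using herm[of 0 0] col[of 0] n by simp
  have row: "A' $$ (0, j) = (if j = 0 then e else 0)" if j: "j < n" for j
    using herm[of 0 j] col[of j] j n \<open>e = cnj e\<close> by (simp split: if_splits)
  have blk: "A' = four_block_mat (Matrix.mat 1 1 (\<lambda>_. e)) (0\<^sub>m 1 m) (0\<^sub>m m 1) A3" (is "_ = ?B")
  proof (rule eq_matI)
    fix i j assume "i < dim_row ?B" "j < dim_col ?B"
    then have ij: "i < n" "j < n" by (auto simp: A3_def n)
    show "A' $$ (i, j) = ?B $$ (i, j)"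
      using ij col[OF ij(1)] row[OF ij(2)] by (cases i; cases j) (auto simp: n A3_def)
  qed (auto simp: A'c n A3_def)
  have "hermitian_mat m A3"
    unfolding hermitian_mat_iff
  proof (intro conjI allI impI)
    fix i j assume "i < m" "j < m"
    then show "A3 $$ (i, j) = cnj (A3 $$ (j, i))"
      using herm[of "Suc i" "Suc j"] by (simp add: A3_def n)
  qed (simp add: A3_def)
  moreover have "char_poly A3 = (\<Prod>e\<leftarrow>es. [:- e, 1:])"
  proof -
    have "char_poly A' = char_poly (Matrix.mat 1 1 (\<lambda>_. e)) * char_poly A3"
      unfolding blk by (rule char_poly_four_block_zeros_col) (auto simp: A3_def)
    moreover have "char_poly (Matrix.mat 1 1 (\<lambda>_. e)) = [:- e, 1:]"
      by (simp add: char_poly_defs det_def sign_def)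
    moreover have "char_poly A' = [:- e, 1:] * (\<Prod>e\<leftarrow>es. [:- e, 1:])"
      unfolding A'_def char_poly_unitary_conj[OF W A] Cons.prems(2) by simp
    ultimately show ?thesis by (metis mult_cancel_left pCons_eq_0_iff zero_neq_one)
  qed
  ultimately obtain W3 where W3: "W3 \<in> unitary_group m"
    "A3 = W3 * mat_diag m (\<lambda>i. es ! i) * mat_adjoint W3"
    using Cons.IH by blast
  note W3d = unitary_groupD[OF W3(1)]
  define Z where "Z = four_block_mat (1\<^sub>m 1) (0\<^sub>m 1 m) (0\<^sub>m m 1) W3"
  have Z: "Z \<in> unitary_group n"
    unfolding Z_def n using unitary_group_block[OF unitary_group_one W3(1), of 1] by simp
  note Zd = unitary_groupD[OF Z]
  define D where "D = mat_diag n (\<lambda>i. (e # es) ! i)"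
  have D: "D = four_block_mat (Matrix.mat 1 1 (\<lambda>_. e)) (0\<^sub>m 1 m) (0\<^sub>m m 1) (mat_diag m (\<lambda>i. es ! i))"
    unfolding D_def n mat_diag_Suc by simp
  have ZD: "Z * D = four_block_mat (Matrix.mat 1 1 (\<lambda>_. e)) (0\<^sub>m 1 m) (0\<^sub>m m 1) (W3 * mat_diag m (\<lambda>i. es ! i))"
    unfolding Z_def D
    by (subst mult_four_block_mat[of _ 1 1 _ m _ m _ _ 1 _ m]) (use W3d in auto)
  have Zadj: "mat_adjoint Z = four_block_mat (1\<^sub>m 1) (0\<^sub>m 1 m) (0\<^sub>m m 1) (mat_adjoint W3)"
    unfolding Z_def by (subst mat_adjoint_four_block) (use W3d in auto)
  have "A' = Z * D * mat_adjoint Z"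
    unfolding blk W3(2) ZD Zadj
    by (subst mult_four_block_mat[of _ 1 1 _ m _ m _ _ 1 _ m]) (use W3d in auto)
  have Dd: "dim_row D = n" "dim_col D = n" by (auto simp: D_def)
  have "A = mat_adjoint W * A' * W"
    unfolding A'_def using A Wd(1-3) carrier_matD[OF A]
    by (simp add: mat_mult_assoc unitary_group_cancel[OF W] Wd(5))
  also have "\<dots> = (mat_adjoint W * Z) * D * mat_adjoint (mat_adjoint W * Z)"
    unfolding \<open>A' = Z * D * mat_adjoint Z\<close>
    using Wd(1-3) Zd(1-3) Dd by (simp add: mat_mult_assoc mat_adjoint_mult)
  finally show ?case
    unfolding D_def using unitary_group_mult[OF unitary_group_adjoint[OF W] Z] by blast
qed

lemma proots_prod_linear: "proots (\<Prod>e\<leftarrow>es. [:- e, 1:]) = mset (es :: complex list)"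
proof (induction es)
  case (Cons e es)
  have "monic (\<Prod>e\<leftarrow>es. [:- e, 1:])" by (rule monic_prod_list, auto)
  then have "(\<Prod>e\<leftarrow>es. [:- e, 1:]) \<noteq> 0" by auto
  then show ?case using Cons by (simp add: proots_mult del: mult_pCons_left)
qed simp

lemma eval_ord_eqI:
  assumes "hermitian_mat n A" "x \<in> weyl n"
    and "char_poly A = (\<Prod>e\<leftarrow>map (\<lambda>i. complex_of_real (x i)) [0..<n]. [:- e, 1:])"
  shows "eval_ord n A = x"
proof -
  have "image_mset Re (proots (char_poly A)) = mset (rev (map x [0..<n]))"
    unfolding assms(3) proots_prod_linear by (simp add: o_def flip: mset_map)
  moreover have "sorted (rev (map x [0..<n]))"
    using assms(2) by (auto simp: sorted_iff_nth_mono rev_nth weyl_def)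
  ultimately have "sorted_list_of_multiset (image_mset Re (proots (char_poly A)))
      = rev (map x [0..<n])"
    by (metis sorted_list_of_multiset_mset sorted_sort_id)
  then show ?thesis
    using assms(1,2) by (auto simp: eval_ord_def weyl_def Rn_def fun_eq_iff PiE_iff extensional_def)
qed

lemma char_poly_mat_diag:
  "char_poly (mat_diag n f) = (\<Prod>e\<leftarrow>map f [0..<n]. [:- e, 1:])"
proof -
  have "diag_mat (mat_diag n f) = map f [0..<n]"
    by (auto simp: diag_mat_def intro!: nth_equalityI)
  then show ?thesis
    using char_poly_upper_triangular[of "mat_diag n f" n] by (auto simp: upper_triangular_def)
qed

lemma eval_ord_mat_diag:
  "x \<in> weyl n \<Longrightarrow> eval_ord n (mat_diag n (\<lambda>i. complex_of_real (x i))) = x"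
  by (rule eval_ord_eqI) (auto simp: hermitian_mat_diag char_poly_mat_diag)

lemma eval_ord_unitary_conj:
  assumes "W \<in> unitary_group n" "hermitian_mat n A"
  shows "eval_ord n (W * A * mat_adjoint W) = eval_ord n A"
proof -
  have "A \<in> carrier_mat n n" using assms(2) by (simp add: hermitian_mat_def)
  then show ?thesis
    using hermitian_mat_conj[OF assms(2) unitary_groupD(1)[OF assms(1)]] assms
      char_poly_unitary_conj[OF assms(1)]
    by (simp add: eval_ord_def)
qed

text \<open>
  The eigenvalues appear in the decreasing order of \<open>eval_ord\<close>. A first diagonalisation shows that they
  are real; a second one, for the sorted list, puts them in order.
\<close>

lemma hermitian_spectral:
  assumes A: "hermitian_mat n A"
  obtains W where "W \<in> unitary_group n"
    "A = W * mat_diag n (\<lambda>i. complex_of_real (eval_ord n A i)) * mat_adjoint W"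
proof -
  have Ac: "A \<in> carrier_mat n n" using A by (simp add: hermitian_mat_def)
  obtain es where es: "char_poly A = (\<Prod>e\<leftarrow>es. [:- e, 1:])" "length es = n"
    using char_poly_factorized[OF Ac] by blast
  obtain W where W: "W \<in> unitary_group n" "A = W * mat_diag n (\<lambda>i. es ! i) * mat_adjoint W"
    using hermitian_diagonalization[OF A es(1)] by blast
  note Wd = unitary_groupD[OF W(1)]
  have "mat_diag n (\<lambda>i. es ! i) = mat_adjoint W * A * mat_adjoint (mat_adjoint W)"
    unfolding W(2) using Wd(1-3) by (simp add: mat_mult_assoc unitary_group_cancel[OF W(1)] Wd(5))
  then have "hermitian_mat n (mat_diag n (\<lambda>i. es ! i))"
    using hermitian_mat_conj[OF A, of "mat_adjoint W" n] Wd(1) by simp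
  then have real: "es ! i = cnj (es ! i)" if "i < n" for i
    unfolding hermitian_mat_iff using that by fastforce
  then have reals: "map (\<lambda>e. complex_of_real (Re e)) es = es"
    using es(2) by (intro nth_equalityI) (auto simp: complex_eq_iff)
  define xs where "xs = rev (sort (map Re es))"
  define x where "x = (\<lambda>i\<in>{..<n}. xs ! i)"
  have len: "length xs = n" by (simp add: xs_def es(2))
  have x: "x \<in> weyl n"
    unfolding weyl_def Rn_def x_def
    by (auto simp: xs_def rev_nth es(2) intro!: sorted_nth_mono)
  have mx: "map (\<lambda>i. complex_of_real (x i)) [0..<n] = map complex_of_real xs"
    using len by (intro nth_equalityI) (auto simp: x_def)
  have "mset (map complex_of_real xs) = mset (map (\<lambda>e. complex_of_real (Re e)) es)"
    by (simp add: xs_def multiset.map_comp o_def)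
  then have "mset (map complex_of_real xs) = mset es" unfolding reals .
  then have "mset (map (\<lambda>e. [:- e, 1:]) (map complex_of_real xs)) = mset (map (\<lambda>e. [:- e, 1:]) es)"
    by (metis mset_map)
  then have "(\<Prod>e\<leftarrow>map complex_of_real xs. [:- e, 1:]) = (\<Prod>e\<leftarrow>es. [:- e, 1:])"
    by (metis prod_mset_prod_list)
  then have cp: "char_poly A = (\<Prod>e\<leftarrow>map (\<lambda>i. complex_of_real (x i)) [0..<n]. [:- e, 1:])"
    unfolding mx es(1) by simp
  have ev: "eval_ord n A = x" by (rule eval_ord_eqI[OF A x cp])
  obtain V where V: "V \<in> unitary_group n"
    "A = V * mat_diag n (\<lambda>i. map (\<lambda>i. complex_of_real (x i)) [0..<n] ! i) * mat_adjoint V"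
    using hermitian_diagonalization[OF A cp] by blast
  have "mat_diag n (\<lambda>i. map (\<lambda>i. complex_of_real (x i)) [0..<n] ! i)
      = mat_diag n (\<lambda>i. complex_of_real (x i))"
    by (rule eq_matI) auto
  with V ev show thesis by (intro that[of V]) auto
qed

section \<open>Corners\<close>

text \<open>
  The \<open>K \<times> N\<close> matrix \<open>[1 0]\<close>: conjugation by it takes the \<open>K \<times> K\<close> top-left corner.
\<close>

definition trunc_mat :: "nat \<Rightarrow> nat \<Rightarrow> complex mat" where
  "trunc_mat K N = Matrix.mat K N (\<lambda>(i, j). if i = j then 1 else 0)"

lemma trunc_mat_dim[simp]: "dim_row (trunc_mat K N) = K" "dim_col (trunc_mat K N) = N"
  "trunc_mat K N \<in> carrier_mat K N"
  by (auto simp: trunc_mat_def)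

lemma trunc_mat_mult_index:
  assumes "i < K" "j < dim_col X" "dim_row X = N" "K \<le> N"
  shows "(trunc_mat K N * X) $$ (i, j) = X $$ (i, j)"
proof -
  have "(trunc_mat K N * X) $$ (i, j) = (\<Sum>k<N. (if i = k then X $$ (k, j) else 0))"
    using assms by (subst mat_mult_index) (auto simp: trunc_mat_def mult_delta_left mult_delta_right if_distrib[of cnj] cong: if_cong)
  then show ?thesis using assms by simp
qed

lemma mult_trunc_mat_adjoint_index:
  assumes "i < dim_row X" "j < K" "dim_col X = N" "K \<le> N"
  shows "(X * mat_adjoint (trunc_mat K N)) $$ (i, j) = X $$ (i, j)"
proof -
  have "(X * mat_adjoint (trunc_mat K N)) $$ (i, j) = (\<Sum>k<N. (if k = j then X $$ (i, k) else 0))"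
    using assms by (subst mat_mult_adjoint_index[where N=N]) (auto simp: trunc_mat_def mult_delta_left mult_delta_right if_distrib[of cnj] cong: if_cong)
  then show ?thesis using assms by simp
qed

lemma corner_eq_trunc:
  assumes "X \<in> carrier_mat N N" "K \<le> N"
  shows "corner K X = trunc_mat K N * X * mat_adjoint (trunc_mat K N)"
proof (rule eq_matI)
  fix i j assume "i < dim_row (trunc_mat K N * X * mat_adjoint (trunc_mat K N))"
    "j < dim_col (trunc_mat K N * X * mat_adjoint (trunc_mat K N))"
  then have ij: "i < K" "j < K" by auto
  have "(trunc_mat K N * X * mat_adjoint (trunc_mat K N)) $$ (i, j) = (trunc_mat K N * X) $$ (i, j)"
    using ij assms by (intro mult_trunc_mat_adjoint_index) auto
  also have "\<dots> = X $$ (i, j)" using ij assms by (intro trunc_mat_mult_index) auto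
  finally show "corner K X $$ (i, j) = (trunc_mat K N * X * mat_adjoint (trunc_mat K N)) $$ (i, j)"
    using ij by (simp add: corner_def)
qed (auto simp: corner_def)

lemma corner_corner: "K \<le> N \<Longrightarrow> corner K (corner N X) = corner K X"
  by (rule eq_matI) (auto simp: corner_def)

lemma hermitian_corner:
  "hermitian_mat N X \<Longrightarrow> K \<le> N \<Longrightarrow> hermitian_mat K (corner K X)"
  using hermitian_mat_conj[of N X "trunc_mat K N" K]
  by (simp add: corner_eq_trunc[of X N] hermitian_mat_def)

text \<open>
  The embedding of the unitary group of size \<open>N\<close> into that of size \<open>N + 1\<close> that fixes the last basis
  vector.
\<close>

definition extend_unitary :: "nat \<Rightarrow> complex mat \<Rightarrow> complex mat" where
  "extend_unitary N U = four_block_mat U (0\<^sub>m N 1) (0\<^sub>m 1 N) (1\<^sub>m 1)"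

lemma extend_unitary_in: "U \<in> unitary_group N \<Longrightarrow> extend_unitary N U \<in> unitary_group (N + 1)"
  unfolding extend_unitary_def by (rule unitary_group_block[OF _ unitary_group_one])

lemma trunc_mat_extend_unitary:
  assumes "U \<in> carrier_mat N N"
  shows "trunc_mat N (N + 1) * extend_unitary N U = U * trunc_mat N (N + 1)"
proof (rule eq_matI)
  fix i j assume "i < dim_row (U * trunc_mat N (N + 1))" "j < dim_col (U * trunc_mat N (N + 1))"
  then have ij: "i < N" "j < N + 1" using assms by auto
  have "(U * trunc_mat N (N + 1)) $$ (i, j) = (\<Sum>k<N. if k = j then U $$ (i, k) else 0)"
    using ij assms by (subst mat_mult_index) (auto simp: trunc_mat_def mult_delta_left mult_delta_right if_distrib[of cnj] cong: if_cong)
  also have "\<dots> = (if j < N then U $$ (i, j) else 0)" by simp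
  also have "\<dots> = extend_unitary N U $$ (i, j)"
    using ij assms by (auto simp: extend_unitary_def)
  also have "\<dots> = (trunc_mat N (N + 1) * extend_unitary N U) $$ (i, j)"
    using ij assms by (intro trunc_mat_mult_index[symmetric]) (auto simp: extend_unitary_def)
  finally show "(trunc_mat N (N + 1) * extend_unitary N U) $$ (i, j) = (U * trunc_mat N (N + 1)) $$ (i, j)" ..
qed (use assms in \<open>auto simp: extend_unitary_def\<close>)

lemma corner_extend_unitary_conj:
  assumes U: "U \<in> unitary_group N" and X: "X \<in> carrier_mat (N + 1) (N + 1)"
  shows "corner N (extend_unitary N U * X * mat_adjoint (extend_unitary N U))
    = U * corner N X * mat_adjoint U"
proof -
  let ?T = "trunc_mat N (N + 1)" and ?E = "extend_unitary N U"
  note Ud = unitary_groupD[OF U] and Ed = unitary_groupD[OF extend_unitary_in[OF U]]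
  have TE: "?T * ?E = U * ?T" by (rule trunc_mat_extend_unitary[OF Ud(1)])
  have "corner N (?E * X * mat_adjoint ?E) = (?T * ?E) * X * mat_adjoint (?T * ?E)"
    using X Ed(1-3) by (subst corner_eq_trunc[of _ "N + 1"]) (auto simp: mat_mult_assoc mat_adjoint_mult)
  also have "\<dots> = U * (?T * X * mat_adjoint ?T) * mat_adjoint U"
    unfolding TE using X Ud(1-3) by (auto simp: mat_mult_assoc mat_adjoint_mult)
  finally show ?thesis using X by (simp add: corner_eq_trunc[of X "N + 1"])
qed

section \<open>Continuity and measurability of the ordered eigenvalues\<close>

lemma mat_conj_index:
  fixes P A :: "complex mat"
  assumes "P \<in> carrier_mat m n" "A \<in> carrier_mat n n" "i < m" "j < m"
  shows "(P * A * mat_adjoint P) $$ (i, j)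
    = (\<Sum>l<n. (\<Sum>k<n. P $$ (i, k) * A $$ (k, l)) * cnj (P $$ (j, l)))"
proof -
  have "(P * A * mat_adjoint P) $$ (i, j) = (\<Sum>l<n. (P * A) $$ (i, l) * cnj (P $$ (j, l)))"
    using assms by (intro mat_mult_adjoint_index) auto
  also have "\<dots> = (\<Sum>l<n. (\<Sum>k<n. P $$ (i, k) * A $$ (k, l)) * cnj (P $$ (j, l)))"
    using assms by (intro sum.cong refl arg_cong2[where f="(*)"] trans[OF mat_mult_index]) auto
  finally show ?thesis .
qed

lemma mat_conj_diag_index:
  fixes P :: "complex mat"
  assumes "P \<in> carrier_mat m n" "i < m" "j < m"
  shows "(P * mat_diag n d * mat_adjoint P) $$ (i, j) = (\<Sum>l<n. d l * (P $$ (i, l) * cnj (P $$ (j, l))))"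
proof -
  have "(P * mat_diag n d * mat_adjoint P) $$ (i, j)
      = (\<Sum>l<n. (\<Sum>k<n. P $$ (i, k) * mat_diag n d $$ (k, l)) * cnj (P $$ (j, l)))"
    using assms by (intro mat_conj_index) auto
  also have "\<dots> = (\<Sum>l<n. d l * (P $$ (i, l) * cnj (P $$ (j, l))))"
    by (intro sum.cong) (auto simp: mult_delta_right mult_ac cong: if_cong)
  finally show ?thesis .
qed

lemma mat_conj_entry_bound:
  fixes P A :: "complex mat"
  assumes "P \<in> carrier_mat m n" "A \<in> carrier_mat n n" "i < m" "j < m"
    and p: "\<And>i k. i < m \<Longrightarrow> k < n \<Longrightarrow> cmod (P $$ (i, k)) \<le> p"
  shows "cmod ((P * A * mat_adjoint P) $$ (i, j)) \<le> p\<^sup>2 * (\<Sum>l<n. \<Sum>k<n. cmod (A $$ (k, l)))"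
proof -
  have "cmod ((P * A * mat_adjoint P) $$ (i, j))
      = cmod (\<Sum>l<n. \<Sum>k<n. P $$ (i, k) * A $$ (k, l) * cnj (P $$ (j, l)))"
    by (subst mat_conj_index[OF assms(1-4)]) (simp add: sum_distrib_right)
  also have "\<dots> \<le> (\<Sum>l<n. \<Sum>k<n. cmod (P $$ (i, k) * A $$ (k, l) * cnj (P $$ (j, l))))"
    by (intro order_trans[OF norm_sum] sum_mono) auto
  also have "\<dots> \<le> (\<Sum>l<n. \<Sum>k<n. p\<^sup>2 * cmod (A $$ (k, l)))"
  proof (intro sum_mono)
    fix l k assume lk: "l \<in> {..<n}" "k \<in> {..<n}"
    have "cmod (P $$ (i, k)) * cmod (P $$ (j, l)) \<le> p * p"
      using p[OF assms(3), of k] p[OF assms(4), of l] lk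
      by (intro mult_mono) (auto intro: order_trans[OF norm_ge_zero])
    then have "cmod (A $$ (k, l)) * (cmod (P $$ (i, k)) * cmod (P $$ (j, l))) \<le> cmod (A $$ (k, l)) * (p * p)"
      by (intro mult_left_mono) auto
    then show "cmod (P $$ (i, k) * A $$ (k, l) * cnj (P $$ (j, l))) \<le> p\<^sup>2 * cmod (A $$ (k, l))"
      by (simp add: norm_mult power2_eq_square mult_ac)
  qed
  finally show ?thesis by (simp add: sum_distrib_left)
qed

lemma unitary_entry_le_1:
  assumes U: "U \<in> unitary_group n" and ij: "i < n" "j < n"
  shows "cmod (U $$ (i, j)) \<le> 1"
proof -
  have "(U * mat_adjoint U) $$ (i, i) = (\<Sum>l<n. U $$ (i, l) * cnj (U $$ (i, l)))"
    using unitary_groupD[OF U] ij by (intro mat_mult_adjoint_index) auto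
  then have "1 = (\<Sum>l<n. U $$ (i, l) * cnj (U $$ (i, l)))"
    using unitary_groupD[OF U] ij by simp
  also have "\<dots> = complex_of_real (\<Sum>l<n. (cmod (U $$ (i, l)))\<^sup>2)"
    by (simp only: of_real_sum complex_norm_square)
  finally have "(\<Sum>l<n. (cmod (U $$ (i, l)))\<^sup>2) = 1"
    by (metis of_real_eq_1_iff)
  moreover have "(cmod (U $$ (i, j)))\<^sup>2 \<le> (\<Sum>l<n. (cmod (U $$ (i, l)))\<^sup>2)"
    by (rule member_le_sum) (use ij in auto)
  ultimately have "(cmod (U $$ (i, j)))\<^sup>2 \<le> 1\<^sup>2" by simp
  then show ?thesis by (rule power2_le_imp_le) simp
qed

lemma eval_ord_le_entries:
  assumes A: "hermitian_mat n A" and i: "i < n"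
  shows "\<bar>eval_ord n A i\<bar> \<le> (\<Sum>l<n. \<Sum>k<n. cmod (A $$ (k, l)))"
proof -
  obtain W where W: "W \<in> unitary_group n"
    "A = W * mat_diag n (\<lambda>i. complex_of_real (eval_ord n A i)) * mat_adjoint W"
    using hermitian_spectral[OF A] by blast
  let ?D = "mat_diag n (\<lambda>i. complex_of_real (eval_ord n A i))"
  note Wd = unitary_groupD[OF W(1)]
  have "?D = mat_adjoint W * (W * ?D * mat_adjoint W) * mat_adjoint (mat_adjoint W)"
    using Wd(1-3) by (simp add: mat_mult_assoc unitary_group_cancel[OF W(1)] Wd(5))
  then have "?D = mat_adjoint W * A * mat_adjoint (mat_adjoint W)"
    unfolding W(2)[symmetric] .
  then have "complex_of_real (eval_ord n A i) = (mat_adjoint W * A * mat_adjoint (mat_adjoint W)) $$ (i, i)"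
    using i mat_diag_index[of i n i "\<lambda>i. complex_of_real (eval_ord n A i)"] by simp
  then have "\<bar>eval_ord n A i\<bar> = cmod ((mat_adjoint W * A * mat_adjoint (mat_adjoint W)) $$ (i, i))"
    by (metis norm_of_real real_norm_def)
  also have "\<dots> \<le> 1\<^sup>2 * (\<Sum>l<n. \<Sum>k<n. cmod (A $$ (k, l)))"
    by (rule mat_conj_entry_bound[where m=n])
       (use Wd(1) A i unitary_entry_le_1[OF unitary_group_adjoint[OF W(1)]] in \<open>auto simp: hermitian_mat_def\<close>)
  finally show ?thesis by simp
qed

lemma entries_le_eval_ord:
  assumes A: "hermitian_mat n A" and ij: "i < n" "j < n"
  shows "cmod (A $$ (i, j)) \<le> (\<Sum>l<n. \<bar>eval_ord n A l\<bar>)"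
proof -
  obtain W where W: "W \<in> unitary_group n"
    "A = W * mat_diag n (\<lambda>i. complex_of_real (eval_ord n A i)) * mat_adjoint W"
    using hermitian_spectral[OF A] by blast
  let ?D = "mat_diag n (\<lambda>i. complex_of_real (eval_ord n A i))"
  note Wd = unitary_groupD[OF W(1)]
  have "cmod ((W * ?D * mat_adjoint W) $$ (i, j)) \<le> 1\<^sup>2 * (\<Sum>l<n. \<Sum>k<n. cmod (?D $$ (k, l)))"
    by (rule mat_conj_entry_bound[where m=n]) (use Wd(1) ij unitary_entry_le_1[OF W(1)] in auto)
  also have "1\<^sup>2 * (\<Sum>l<n. \<Sum>k<n. cmod (?D $$ (k, l))) = (\<Sum>l<n. \<bar>eval_ord n A l\<bar>)"
    by (auto intro!: sum.cong simp: if_distrib[of cmod] cong: if_cong)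
  finally show ?thesis unfolding W(2)[symmetric] .
qed

lemma poly_char_poly_hermitian:
  assumes A: "hermitian_mat n A"
  shows "poly (char_poly A) z = (\<Prod>i<n. (z - complex_of_real (eval_ord n A i)))"
proof -
  obtain W where W: "W \<in> unitary_group n"
    "A = W * mat_diag n (\<lambda>i. complex_of_real (eval_ord n A i)) * mat_adjoint W"
    using hermitian_spectral[OF A] by blast
  have "char_poly A = (\<Prod>e\<leftarrow>map (\<lambda>i. complex_of_real (eval_ord n A i)) [0..<n]. [:- e, 1:])"
    unfolding char_poly_mat_diag[symmetric]
    by (subst W(2), rule char_poly_unitary_conj[OF W(1)]) simp
  also have "\<dots> = (\<Prod>i<n. [:- complex_of_real (eval_ord n A i), 1:])"
    unfolding map_map o_def
    by (subst prod.distinct_set_conv_list[symmetric]) (auto simp: atLeast0LessThan)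
  finally show ?thesis by (simp add: poly_prod)
qed

lemma tendsto_subseqI:
  fixes X :: "nat \<Rightarrow> real"
  assumes "\<And>r :: nat \<Rightarrow> nat. strict_mono r \<Longrightarrow> \<exists>s :: nat \<Rightarrow> nat. strict_mono s \<and> (\<lambda>n. X (r (s n))) \<longlonglongrightarrow> L"
  shows "X \<longlonglongrightarrow> L"
proof (rule ccontr)
  assume "\<not> X \<longlonglongrightarrow> L"
  then obtain e where e: "e > 0" "\<And>N. \<exists>n\<ge>N. dist (X n) L \<ge> e"
    unfolding lim_sequentially by (auto simp: not_less)
  then have "infinite {n. dist (X n) L \<ge> e}"
    by (auto simp: infinite_nat_iff_unbounded_le)
  from infinite_enumerate[OF this]
  obtain r :: "nat \<Rightarrow> nat" where r: "strict_mono r" "\<And>n. dist (X (r n)) L \<ge> e"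
    by auto
  obtain s where "strict_mono s" "(\<lambda>n. X (r (s n))) \<longlonglongrightarrow> L" using assms[OF r(1)] by blast
  then obtain n where "dist (X (r (s n))) L < e" using e(1) unfolding lim_sequentially by blast
  with r(2)[of "s n"] show False by simp
qed

lemma tendsto_poly_char_poly:
  fixes A :: "nat \<Rightarrow> complex mat"
  assumes A: "\<And>n. A n \<in> carrier_mat K K" and B: "B \<in> carrier_mat K K"
    and lim: "\<And>i j. i < K \<Longrightarrow> j < K \<Longrightarrow> (\<lambda>n. A n $$ (i, j)) \<longlonglongrightarrow> B $$ (i, j)"
  shows "(\<lambda>n. poly (char_poly (A n)) z) \<longlonglongrightarrow> poly (char_poly B) z"
proof -
  have cm: "char_matrix X z \<in> carrier_mat K K" if "X \<in> carrier_mat K K" for X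
    using that by (auto simp: char_matrix_def)
  have id: "poly (char_poly X) z = (\<Sum>p | p permutes {0..<K}. signof p *
      (\<Prod>i = 0..<K. - (X $$ (i, p i) + (- z) * (if i = p i then 1 else 0))))"
    if X: "X \<in> carrier_mat K K" for X
    unfolding char_poly_matrix[OF X]
    using X cm[OF X]
    by (subst det_def'[of _ K]) (auto intro!: sum.cong prod.cong simp: char_matrix_def)
  show ?thesis
    unfolding id[OF A] id[OF B]
    by (intro tendsto_intros lim) auto
qed

text \<open>
  The eigenvalues stay bounded, and every limit point of them is a decreasing vector whose entries are
  the roots of the characteristic polynomial of the limit matrix; hence there is only one limit point.
\<close>

lemma eval_ord_tendsto:
  assumes A: "\<And>n. hermitian_mat K (A n)" and B: "hermitian_mat K B"
    and lim: "\<And>i j. i < K \<Longrightarrow> j < K \<Longrightarrow> (\<lambda>n. A n $$ (i, j)) \<longlonglongrightarrow> B $$ (i, j)"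
    and i: "i < K"
  shows "(\<lambda>n. eval_ord K (A n) i) \<longlonglongrightarrow> eval_ord K B i"
proof (rule tendsto_subseqI)
  fix r :: "nat \<Rightarrow> nat" assume r: "strict_mono r"
  have "(\<lambda>n. \<Sum>l<K. \<Sum>k<K. cmod (A n $$ (k, l))) \<longlonglongrightarrow> (\<Sum>l<K. \<Sum>k<K. cmod (B $$ (k, l)))"
    by (intro tendsto_intros lim) auto
  then have "Bseq (\<lambda>n. \<Sum>l<K. \<Sum>k<K. cmod (A n $$ (k, l)))"
    by (rule convergent_imp_Bseq[OF convergentI])
  then obtain M where M: "\<And>n. norm (\<Sum>l<K. \<Sum>k<K. cmod (A n $$ (k, l))) \<le> M"
    unfolding Bseq_def by blast
  have bd: "norm (eval_ord K (A n) i) \<le> M" if "i < K" for n i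
    using eval_ord_le_entries[OF A that, of n] M[of n] by simp
  obtain s where s: "strict_mono s"
    "\<And>i. i \<in> {..<K} \<Longrightarrow> \<exists>l. (\<lambda>n. eval_ord K (A (r (s n))) i) \<longlonglongrightarrow> l"
    using function_convergent_subsequence[of "{..<K}" "\<lambda>n. eval_ord K (A (r n))" M] bd by auto
  then obtain y0 where y0: "\<And>i. i < K \<Longrightarrow> (\<lambda>n. eval_ord K (A (r (s n))) i) \<longlonglongrightarrow> y0 i"
    by (metis lessThan_iff)
  define y where "y = restrict y0 {..<K}"
  have y: "(\<lambda>n. eval_ord K (A (r (s n))) i) \<longlonglongrightarrow> y i" if "i < K" for i
    using y0[OF that] that by (simp add: y_def)
  have yw: "y \<in> weyl K"
    unfolding weyl_def
  proof safe
    show "y \<in> Rn K" by (simp add: y_def Rn_def)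
    fix i j assume ij: "i \<le> j" "j < K"
    show "y j \<le> y i"
    proof (rule LIMSEQ_le[OF y y])
      show "\<exists>N. \<forall>n\<ge>N. eval_ord K (A (r (s n))) j \<le> eval_ord K (A (r (s n))) i"
        using eval_ord_in_weyl[of K] ij unfolding weyl_def by blast
    qed (use ij in auto)
  qed
  have rs: "strict_mono (r \<circ> s)" using r s(1) by (simp add: strict_mono_o)
  have "poly (char_poly B) z = (\<Prod>i<K. (z - complex_of_real (y i)))" for z
  proof (rule LIMSEQ_unique)
    have "(\<lambda>n. poly (char_poly (A n)) z) \<longlonglongrightarrow> poly (char_poly B) z"
      using A B lim by (intro tendsto_poly_char_poly) (auto simp: hermitian_mat_def)
    from LIMSEQ_subseq_LIMSEQ[OF this rs]
    show "(\<lambda>n. poly (char_poly (A (r (s n)))) z) \<longlonglongrightarrow> poly (char_poly B) z"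
      by (simp add: o_def)
    show "(\<lambda>n. poly (char_poly (A (r (s n)))) z) \<longlonglongrightarrow> (\<Prod>i<K. (z - complex_of_real (y i)))"
      unfolding poly_char_poly_hermitian[OF A] by (intro tendsto_intros y) auto
  qed
  then have "poly (char_poly B) = poly (\<Prod>e\<leftarrow>map (\<lambda>i. complex_of_real (y i)) [0..<K]. [:- e, 1:])"
    unfolding map_map o_def
    by (subst prod.distinct_set_conv_list[symmetric]) (auto simp: atLeast0LessThan poly_prod)
  then have "eval_ord K B = y"
    by (intro eval_ord_eqI[OF B yw]) (simp only: poly_eq_poly_eq_iff)
  then show "\<exists>s. strict_mono s \<and> (\<lambda>n. eval_ord K (A (r (s n))) i) \<longlonglongrightarrow> eval_ord K B i"
    using s(1) y[OF i] by blast
qed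

lemma space_mat_borel[simp]: "space (mat_borel N) = carrier_mat N N"
  by (simp add: mat_borel_def)

lemma measurable_mat_entry[measurable (raw)]:
  assumes f: "f \<in> measurable M (mat_borel N)" and ij: "i < N" "j < N"
  shows "(\<lambda>w. f w $$ (i, j)) \<in> borel_measurable M"
proof -
  have "(\<lambda>A. \<lambda>p\<in>{..<N} \<times> {..<N}. A $$ p)
      \<in> measurable (mat_borel N) (PiM ({..<N} \<times> {..<N}) (\<lambda>_. borel :: complex measure))"
    unfolding mat_borel_def by (rule measurable_vimage_algebra1) (auto simp: space_PiM)
  from measurable_compose[OF this measurable_component_singleton[of "(i, j)"]] ij
  have "(\<lambda>A. A $$ (i, j)) \<in> borel_measurable (mat_borel N)" by simp
  from measurable_compose[OF f this] show ?thesis .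
qed

lemma measurable_mat_borelI:
  assumes "\<And>w. w \<in> space M \<Longrightarrow> f w \<in> carrier_mat N N"
    and "\<And>i j. i < N \<Longrightarrow> j < N \<Longrightarrow> (\<lambda>w. f w $$ (i, j)) \<in> borel_measurable M"
  shows "f \<in> measurable M (mat_borel N)"
  unfolding mat_borel_def
proof (rule measurable_vimage_algebra2)
  show "(\<lambda>w. \<lambda>p\<in>{..<N} \<times> {..<N}. f w $$ p) \<in> measurable M (PiM ({..<N} \<times> {..<N}) (\<lambda>_. borel))"
    by (rule measurable_restrict) (use assms(2) in auto)
qed (use assms(1) in auto)

lemma measurable_mat_mult[measurable (raw)]:
  assumes f: "f \<in> measurable M (mat_borel N)" and g: "g \<in> measurable M (mat_borel N)"
  shows "(\<lambda>w. f w * g w) \<in> measurable M (mat_borel N)"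
proof (rule measurable_mat_borelI)
  have c: "f w \<in> carrier_mat N N" "g w \<in> carrier_mat N N" if "w \<in> space M" for w
    using measurable_space[OF f that] measurable_space[OF g that] by auto
  then show "f w * g w \<in> carrier_mat N N" if "w \<in> space M" for w
    using that by (meson mult_carrier_mat)
  fix i j assume ij: "i < N" "j < N"
  have "(\<lambda>w. \<Sum>k<N. f w $$ (i, k) * g w $$ (k, j)) \<in> borel_measurable M"
    by (intro borel_measurable_sum borel_measurable_times measurable_mat_entry[OF f]
        measurable_mat_entry[OF g]) (use ij in auto)
  also have "?this \<longleftrightarrow> (\<lambda>w. (f w * g w) $$ (i, j)) \<in> borel_measurable M"
  proof (rule measurable_cong)
    fix w assume "w \<in> space M"
    then show "(\<Sum>k<N. f w $$ (i, k) * g w $$ (k, j)) = (f w * g w) $$ (i, j)"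
      using c[of w] ij by (subst mat_mult_index) auto
  qed
  finally show "(\<lambda>w. (f w * g w) $$ (i, j)) \<in> borel_measurable M" .
qed

lemma measurable_mat_adjoint[measurable (raw)]:
  assumes f: "f \<in> measurable M (mat_borel N)"
  shows "(\<lambda>w. mat_adjoint (f w)) \<in> measurable M (mat_borel N)"
proof (rule measurable_mat_borelI)
  have c: "f w \<in> carrier_mat N N" if "w \<in> space M" for w
    using measurable_space[OF f that] by auto
  then show "mat_adjoint (f w) \<in> carrier_mat N N" if "w \<in> space M" for w
    using that by auto
  fix i j assume ij: "i < N" "j < N"
  have [measurable]: "cnj \<in> borel_measurable borel"
    by (intro borel_measurable_continuous_onI continuous_intros)
  have "(\<lambda>w. f w $$ (j, i)) \<in> borel_measurable M"
    by (rule measurable_mat_entry[OF f]) (use ij in auto)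
  then have "(\<lambda>w. cnj (f w $$ (j, i))) \<in> borel_measurable M" by measurable
  also have "?this \<longleftrightarrow> (\<lambda>w. mat_adjoint (f w) $$ (i, j)) \<in> borel_measurable M"
  proof (rule measurable_cong)
    fix w assume "w \<in> space M"
    then have "dim_row (f w) = N" "dim_col (f w) = N" using c[of w] by auto
    then show "cnj (f w $$ (j, i)) = mat_adjoint (f w) $$ (i, j)" using ij by simp
  qed
  finally show "(\<lambda>w. mat_adjoint (f w) $$ (i, j)) \<in> borel_measurable M" .
qed

lemma measurable_corner:
  assumes f: "f \<in> measurable M (mat_borel N)" and "K \<le> N"
  shows "(\<lambda>w. corner K (f w)) \<in> measurable M (mat_borel K)"
proof (rule measurable_mat_borelI)
  show "corner K (f w) \<in> carrier_mat K K" for w by (simp add: corner_def)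
  fix i j assume "i < K" "j < K"
  then show "(\<lambda>w. corner K (f w) $$ (i, j)) \<in> borel_measurable M"
    using measurable_mat_entry[OF f, of i j] \<open>K \<le> N\<close> by (simp add: corner_def)
qed

lemma measurable_mat_diag_of_real:
  assumes "\<And>i. i < N \<Longrightarrow> (\<lambda>w. f w i) \<in> borel_measurable M"
  shows "(\<lambda>w. mat_diag N (\<lambda>i. complex_of_real (f w i))) \<in> measurable M (mat_borel N)"
proof (rule measurable_mat_borelI)
  fix i j assume "i < N" "j < N"
  then show "(\<lambda>w. mat_diag N (\<lambda>i. complex_of_real (f w i)) $$ (i, j)) \<in> borel_measurable M"
    using assms[of j] by (cases "i = j") auto
qed simp

lemma measurable_weyl_coord:
  "i < N \<Longrightarrow> (\<lambda>x. x i) \<in> borel_measurable (weyl_borel N)"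
  unfolding weyl_borel_def
  by (intro measurable_restrict_space1 measurable_component_singleton) auto

lemma space_weyl_borel[simp]: "space (weyl_borel N) = weyl N"
  by (auto simp: weyl_borel_def space_restrict_space space_PiM weyl_def Rn_def)

lemma tendsto_fun_iff:
  fixes f :: "'c \<Rightarrow> 'a \<Rightarrow> 'b::topological_space"
  shows "(f \<longlongrightarrow> l) F \<longleftrightarrow> (\<forall>i. ((\<lambda>x. f x i) \<longlongrightarrow> l i) F)"
  using limitin_componentwise[of "\<lambda>_. euclidean" UNIV f l F]
  unfolding euclidean_product_topology by simp

text \<open>
  The entries are taken as an element of a product of copies of the complex numbers, where continuity
  on the closed set of Hermitian matrices makes sense; off this set \<open>eval_ord\<close> is constant.
\<close>

lemma borel_measurable_eval_ord_fun:
  assumes i: "i < N"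
  shows "(\<lambda>F :: nat \<times> nat \<Rightarrow> complex. eval_ord N (Matrix.mat N N F) i) \<in> borel_measurable borel"
proof -
  define H where "H = (\<Inter>i\<in>{..<N}. \<Inter>j\<in>{..<N}. {F :: nat \<times> nat \<Rightarrow> complex. F (i, j) = cnj (F (j, i))})"
  have "closed H"
    unfolding H_def by (intro closed_INT ballI closed_Collect_eq continuous_intros) auto
  have H: "F \<in> H \<longleftrightarrow> hermitian_mat N (Matrix.mat N N F)" for F
    unfolding hermitian_mat_iff H_def
    by (simp only: INT_iff mem_Collect_eq Ball_def lessThan_iff) simp
  have "continuous_on H (\<lambda>F. eval_ord N (Matrix.mat N N F) i)"
  proof (rule continuous_on_sequentiallyI)
    fix u :: "nat \<Rightarrow> nat \<times> nat \<Rightarrow> complex" and a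
    assume u: "\<forall>n. u n \<in> H" "a \<in> H" "u \<longlonglongrightarrow> a"
    show "(\<lambda>n. eval_ord N (Matrix.mat N N (u n)) i) \<longlonglongrightarrow> eval_ord N (Matrix.mat N N a) i"
    proof (rule eval_ord_tendsto[OF _ _ _ i])
      fix j k assume jk: "j < N" "k < N"
      have "(\<lambda>n. u n (j, k)) \<longlonglongrightarrow> a (j, k)"
        using u(3) unfolding tendsto_fun_iff by blast
      then show "(\<lambda>n. Matrix.mat N N (u n) $$ (j, k)) \<longlonglongrightarrow> Matrix.mat N N a $$ (j, k)"
        using jk by simp
    qed (use u H in auto)
  qed
  then have "(\<lambda>F. if F \<in> H then eval_ord N (Matrix.mat N N F) i else 0) \<in> borel_measurable borel"
    using \<open>closed H\<close> by (intro borel_measurable_continuous_on_if) auto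
  also have "(\<lambda>F. if F \<in> H then eval_ord N (Matrix.mat N N F) i else 0)
      = (\<lambda>F. eval_ord N (Matrix.mat N N F) i)"
    using i by (simp add: H eval_ord_def fun_eq_iff)
  finally show ?thesis .
qed

lemma measurable_eval_ord: "eval_ord N \<in> measurable (mat_borel N) (weyl_borel N)"
  unfolding weyl_borel_def
proof (rule measurable_restrict_space2)
  show "eval_ord N \<in> space (mat_borel N) \<rightarrow> weyl N" using eval_ord_in_weyl by blast
  show "eval_ord N \<in> measurable (mat_borel N) (PiM {..<N} (\<lambda>_. borel))"
  proof (rule measurable_PiM_single')
    fix i assume i: "i \<in> {..<N}"
    have "(\<lambda>A p. if p \<in> {..<N} \<times> {..<N} then A $$ p else 0)
        \<in> measurable (mat_borel N) (borel :: (nat \<times> nat \<Rightarrow> complex) measure)"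
    proof (rule measurable_coordinatewise_then_product)
      fix p :: "nat \<times> nat"
      obtain a b where p: "p = (a, b)" by (cases p)
      show "(\<lambda>A. if p \<in> {..<N} \<times> {..<N} then A $$ p else 0) \<in> borel_measurable (mat_borel N)"
        using measurable_mat_entry[OF measurable_ident, of a N b]
        by (cases "a < N \<and> b < N") (auto simp: p)
    qed
    from measurable_compose[OF this borel_measurable_eval_ord_fun[of i N]] i
    have "(\<lambda>A. eval_ord N (Matrix.mat N N (\<lambda>p. if p \<in> {..<N} \<times> {..<N} then A $$ p else 0)) i)
        \<in> borel_measurable (mat_borel N)" by simp
    also have "?this \<longleftrightarrow> (\<lambda>A. eval_ord N A i) \<in> borel_measurable (mat_borel N)"
    proof (rule measurable_cong)
      fix A :: "complex mat" assume "A \<in> space (mat_borel N)"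
      then have "Matrix.mat N N (\<lambda>p. if p \<in> {..<N} \<times> {..<N} then A $$ p else 0) = A"
        by (intro eq_matI) auto
      then show "eval_ord N (Matrix.mat N N (\<lambda>p. if p \<in> {..<N} \<times> {..<N} then A $$ p else 0)) i
          = eval_ord N A i" by simp
    qed
    finally show "(\<lambda>A. eval_ord N A i) \<in> borel_measurable (mat_borel N)" .
  next
    show "eval_ord N \<in> space (mat_borel N) \<rightarrow> (\<Pi>\<^sub>E i\<in>{..<N}. space borel)"
      using eval_ord_in_weyl[of N] by (auto simp: weyl_def Rn_def)
  qed
qed

section \<open>Test functions on spectra and their stability\<close>

lemma closed_Rn: "closed (Rn K)"
proof -
  have "y \<in> Rn K \<longleftrightarrow> (\<forall>i\<ge>K. y i = undefined)" for y
    unfolding Rn_def PiE_def extensional_def by (simp add: not_less)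
  then have "Rn K = (\<Inter>i\<in>{K..}. {y. y i = (undefined :: real)})" by blast
  moreover have "closed {y :: nat \<Rightarrow> real. y i = undefined}" for i
    by (rule closed_Collect_eq[OF continuous_on_product_coordinates continuous_on_const])
  ultimately show ?thesis by (simp add: closed_INT)
qed

lemma Rn_permute:
  assumes "y \<in> Rn K" "\<sigma> permutes {..<K}"
  shows "(\<lambda>i. y (\<sigma> i)) \<in> Rn K"
  using assms by (auto simp: Rn_def PiE_iff extensional_def permutes_not_in)

lemma Cc_inf_continuous: "g \<in> Cc_inf K \<Longrightarrow> continuous_on (Rn K) g"
  unfolding Cc_inf_def by (metis (mono_tags, lifting) Ck.simps(1) mem_Collect_eq)

lemma Cc_inf_bounded:
  assumes g: "g \<in> Cc_inf K"
  obtains B where "B \<ge> 0" "\<And>y. y \<in> Rn K \<Longrightarrow> \<bar>g y\<bar> \<le> B"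
proof -
  let ?S = "{x \<in> Rn K. g x \<noteq> 0}"
  have S: "closure ?S \<subseteq> Rn K" using closed_Rn by (intro closure_minimal) auto
  have "compact (closure ?S)" using g by (simp add: Cc_inf_def)
  with continuous_on_subset[OF Cc_inf_continuous[OF g] S]
  have "compact (g ` closure ?S)" by (rule compact_continuous_image)
  then have "bounded (g ` closure ?S)" by (rule compact_imp_bounded)
  then obtain B where B: "\<And>y. y \<in> closure ?S \<Longrightarrow> \<bar>g y\<bar> \<le> B"
    unfolding bounded_iff by auto
  have "\<bar>g y\<bar> \<le> max B 0" if "y \<in> Rn K" for y
    using B[of y] closure_subset[of ?S] that by (cases "g y = 0") (auto simp: max_def)
  then show thesis by (intro that[of "max B 0"]) auto
qed

lemma Cc_inf_support:
  assumes g: "g \<in> Cc_inf K"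
  obtains R where "R \<ge> 0" "\<And>y i. y \<in> Rn K \<Longrightarrow> g y \<noteq> 0 \<Longrightarrow> i < K \<Longrightarrow> \<bar>y i\<bar> \<le> R"
proof -
  let ?S = "{x \<in> Rn K. g x \<noteq> 0}"
  have c: "compact (closure ?S)" using g by (simp add: Cc_inf_def)
  have "\<exists>R. \<forall>y\<in>closure ?S. \<bar>y i\<bar> \<le> R" for i
  proof -
    have "continuous_on (closure ?S) (\<lambda>y. y i)"
      by (rule continuous_on_subset[OF continuous_on_product_coordinates]) simp
    then have "bounded ((\<lambda>y. y i) ` closure ?S)"
      using c compact_continuous_image compact_imp_bounded by blast
    then show ?thesis unfolding bounded_iff by auto
  qed
  then obtain R where R: "\<And>i y. y \<in> closure ?S \<Longrightarrow> \<bar>y i\<bar> \<le> R i" by metis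
  have "\<bar>y i\<bar> \<le> (\<Sum>i<K. \<bar>R i\<bar>)" if "y \<in> Rn K" "g y \<noteq> 0" "i < K" for y i
  proof -
    have "y \<in> closure ?S" using that closure_subset[of ?S] by auto
    then have "\<bar>y i\<bar> \<le> \<bar>R i\<bar>" using R[of y i] by simp
    also have "\<dots> \<le> (\<Sum>i<K. \<bar>R i\<bar>)" using that by (intro member_le_sum) auto
    finally show ?thesis .
  qed
  then show thesis by (intro that[of "\<Sum>i<K. \<bar>R i\<bar>"]) (auto intro: sum_nonneg)
qed

text \<open>
  The sum of a test function over all permutations of the coordinates, that is, the integrand of
  \<open>sym_act\<close>.
\<close>

definition sym_test :: "nat \<Rightarrow> ((nat \<Rightarrow> real) \<Rightarrow> real) \<Rightarrow> (nat \<Rightarrow> real) \<Rightarrow> real" where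
  "sym_test K g y = (\<Sum>\<sigma> | \<sigma> permutes {..<K}. g (\<lambda>i. y (\<sigma> i)))"

lemma continuous_on_sym_test:
  assumes g: "continuous_on (Rn K) g"
  shows "continuous_on (Rn K) (sym_test K g)"
  unfolding sym_test_def
proof (rule continuous_on_sum)
  fix \<sigma> assume "\<sigma> \<in> {\<sigma>. \<sigma> permutes {..<K}}"
  then have \<sigma>: "\<sigma> permutes {..<K}" by simp
  have "continuous_on (Rn K) (\<lambda>y i. y (\<sigma> i))"
    by (intro continuous_on_coordinatewise_then_product
        continuous_on_subset[OF continuous_on_product_coordinates]) simp
  then show "continuous_on (Rn K) (\<lambda>y. g (\<lambda>i. y (\<sigma> i)))"
    by (rule continuous_on_compose2[OF g]) (use Rn_permute[OF _ \<sigma>] in auto)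
qed

lemma sym_test_bounded:
  assumes g: "g \<in> Cc_inf K"
  obtains B where "B \<ge> 0" "\<And>y. y \<in> Rn K \<Longrightarrow> \<bar>sym_test K g y\<bar> \<le> B"
proof -
  obtain B where B: "B \<ge> 0" "\<And>y. y \<in> Rn K \<Longrightarrow> \<bar>g y\<bar> \<le> B" using Cc_inf_bounded[OF g] by blast
  have "\<bar>sym_test K g y\<bar> \<le> (\<Sum>\<sigma> | \<sigma> permutes {..<K}. B)" if "y \<in> Rn K" for y
    unfolding sym_test_def
    by (intro order_trans[OF sum_abs] sum_mono B(2) Rn_permute[OF that]) auto
  then show thesis
    using B(1) by (intro that[of "\<Sum>\<sigma> | \<sigma> permutes {..<K}. B"] sum_nonneg) auto
qed

lemma sym_test_support:
  assumes g: "g \<in> Cc_inf K"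
  obtains R where "R \<ge> 0" "\<And>y i. y \<in> Rn K \<Longrightarrow> sym_test K g y \<noteq> 0 \<Longrightarrow> i < K \<Longrightarrow> \<bar>y i\<bar> \<le> R"
proof -
  obtain R where R: "R \<ge> 0" "\<And>y i. y \<in> Rn K \<Longrightarrow> g y \<noteq> 0 \<Longrightarrow> i < K \<Longrightarrow> \<bar>y i\<bar> \<le> R"
    using Cc_inf_support[OF g] by blast
  have "\<bar>y i\<bar> \<le> R" if y: "y \<in> Rn K" "sym_test K g y \<noteq> 0" "i < K" for y i
  proof -
    obtain \<sigma> where \<sigma>: "\<sigma> permutes {..<K}" "g (\<lambda>i. y (\<sigma> i)) \<noteq> 0"
      using y(2) unfolding sym_test_def by (auto elim: sum.not_neutral_contains_not_neutral)
    have "inv_into UNIV \<sigma> i < K" using permutes_in_image[OF permutes_inv[OF \<sigma>(1)], of i] y(3) by simp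
    from R(2)[OF Rn_permute[OF y(1) \<sigma>(1)] \<sigma>(2) this]
    show ?thesis using permutes_inverses(1)[OF \<sigma>(1)] by simp
  qed
  then show thesis using R(1) that by blast
qed

lemma continuous_on_Rn_seq:
  assumes h: "continuous_on (Rn K) h" and y: "\<And>n. y n \<in> Rn K" "z \<in> Rn K"
    and lim: "\<And>i. i < K \<Longrightarrow> (\<lambda>n. y n i) \<longlonglongrightarrow> z i"
  shows "(\<lambda>n. h (y n)) \<longlonglongrightarrow> (h z :: real)"
proof (rule continuous_on_tendsto_compose[OF h])
  have "(\<lambda>n. y n i) \<longlonglongrightarrow> z i" for i
  proof (cases "i < K")
    case False
    then have "y n i = undefined" "z i = undefined" for n
      using y(1)[of n] y(2) by (auto simp: Rn_def PiE_iff extensional_def)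
    then show ?thesis by simp
  qed (use lim in auto)
  then show "y \<longlonglongrightarrow> z" unfolding tendsto_fun_iff by blast
qed (use y in auto)

lemma borel_measurable_weyl_of_continuous:
  assumes h: "continuous_on (Rn K) (h :: _ \<Rightarrow> real)"
  shows "h \<in> borel_measurable (weyl_borel K)"
proof -
  have "(\<lambda>y. y) \<in> measurable (weyl_borel K) (restrict_space borel (Rn K))"
  proof (rule measurable_restrict_space2)
    show "(\<lambda>y. y) \<in> space (weyl_borel K) \<rightarrow> Rn K" by (auto simp: weyl_def)
    show "(\<lambda>y. y) \<in> borel_measurable (weyl_borel K)"
    proof (rule measurable_coordinatewise_then_product)
      fix i
      show "(\<lambda>y. y i) \<in> borel_measurable (weyl_borel K)"
      proof (cases "i < K")
        case True
        then show ?thesis by (rule measurable_weyl_coord)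
      next
        case False
        have "(\<lambda>y. undefined :: real) \<in> borel_measurable (weyl_borel K)" by simp
        also have "?this \<longleftrightarrow> ?thesis"
          by (rule measurable_cong) (use False in \<open>auto simp: weyl_def Rn_def PiE_iff extensional_def\<close>)
        finally show ?thesis .
      qed
    qed
  qed
  from measurable_compose[OF this borel_measurable_continuous_on_restrict[OF h]]
  show ?thesis .
qed

lemma mat_conj_perturb:
  fixes P H :: "complex mat"
  assumes P: "P \<in> carrier_mat K K" and H: "H \<in> carrier_mat K K" and ij: "i < K" "j < K"
    and e: "\<And>i j. i < K \<Longrightarrow> j < K \<Longrightarrow> cmod (P $$ (i, j) - (if i = j then 1 else 0)) \<le> e" "e \<le> 1"
  shows "cmod ((P * H * mat_adjoint P) $$ (i, j) - H $$ (i, j)) \<le> 3 * e * (\<Sum>l<K. \<Sum>k<K. cmod (H $$ (k, l)))"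
proof -
  let ?d = "\<lambda>i j. if i = j then 1 else 0 :: complex"
  have H_eq: "H $$ (i, j) = (\<Sum>l<K. \<Sum>k<K. ?d i k * H $$ (k, l) * ?d j l)"
  proof -
    have "(\<Sum>k<K. ?d i k * H $$ (k, l) * ?d j l) = (if j = l then H $$ (i, l) else 0)" for l
      using ij by (cases "j = l") (simp_all add: mult_delta_left cong: if_cong)
    then show ?thesis using ij by simp
  qed
  have PH: "(P * H * mat_adjoint P) $$ (i, j) = (\<Sum>l<K. \<Sum>k<K. P $$ (i, k) * H $$ (k, l) * cnj (P $$ (j, l)))"
    by (subst mat_conj_index[OF P H ij]) (simp add: sum_distrib_right)
  have "cmod ((P * H * mat_adjoint P) $$ (i, j) - H $$ (i, j))
      = cmod (\<Sum>l<K. \<Sum>k<K. (P $$ (i, k) * cnj (P $$ (j, l)) - ?d i k * ?d j l) * H $$ (k, l))"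
    unfolding PH by (subst H_eq) (simp add: sum_subtractf[symmetric] algebra_simps)
  also have "\<dots> \<le> (\<Sum>l<K. \<Sum>k<K. cmod ((P $$ (i, k) * cnj (P $$ (j, l)) - ?d i k * ?d j l) * H $$ (k, l)))"
    by (intro order_trans[OF norm_sum] sum_mono order_refl)
  also have "\<dots> \<le> (\<Sum>l<K. \<Sum>k<K. 3 * e * cmod (H $$ (k, l)))"
  proof (intro sum_mono)
    fix l k assume lk: "l \<in> {..<K}" "k \<in> {..<K}"
    define p where "p = P $$ (i, k) - ?d i k"
    define q where "q = P $$ (j, l) - ?d j l"
    have pq: "cmod p \<le> e" "cmod q \<le> e" using e(1) ij lk by (auto simp: p_def q_def)
    then have e0: "0 \<le> e" using norm_ge_zero order_trans by blast
    have "P $$ (i, k) * cnj (P $$ (j, l)) - ?d i k * ?d j l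
        = p * cnj q + p * ?d j l + ?d i k * cnj q"
      unfolding p_def q_def by (auto simp: algebra_simps)
    also have "cmod \<dots> \<le> cmod p * cmod q + cmod p + cmod q"
      by (intro order_trans[OF norm_triangle_ineq] add_mono) (auto simp: norm_mult)
    also have "cmod p * cmod q \<le> e * 1"
      using pq e(2) e0 by (intro mult_mono) auto
    finally have "cmod (P $$ (i, k) * cnj (P $$ (j, l)) - ?d i k * ?d j l) \<le> 3 * e"
      using pq by linarith
    then show "cmod ((P $$ (i, k) * cnj (P $$ (j, l)) - ?d i k * ?d j l) * H $$ (k, l))
        \<le> 3 * e * cmod (H $$ (k, l))"
      unfolding norm_mult by (intro mult_right_mono) auto
  qed
  finally show ?thesis by (simp add: sum_distrib_left)
qed

text \<open>
  For \<open>P\<close> close to the identity, \<open>H\<close> is controlled by \<open>P H P\<^sup>\<dagger>\<close> without inverting \<open>P\<close>.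
\<close>

lemma mat_conj_perturb_sum:
  fixes P H :: "complex mat"
  assumes P: "P \<in> carrier_mat K K" and H: "H \<in> carrier_mat K K"
    and e: "\<And>i j. i < K \<Longrightarrow> j < K \<Longrightarrow> cmod (P $$ (i, j) - (if i = j then 1 else 0)) \<le> e" "e \<le> 1"
    and small: "6 * e * (real K)\<^sup>2 \<le> 1"
  shows "(\<Sum>l<K. \<Sum>k<K. cmod (H $$ (k, l))) \<le> 2 * (\<Sum>l<K. \<Sum>k<K. cmod ((P * H * mat_adjoint P) $$ (k, l)))"
proof -
  let ?m = "\<Sum>l<K. \<Sum>k<K. cmod (H $$ (k, l))"
  let ?m' = "\<Sum>l<K. \<Sum>k<K. cmod ((P * H * mat_adjoint P) $$ (k, l))"
  have "?m \<le> (\<Sum>l<K. \<Sum>k<K. cmod ((P * H * mat_adjoint P) $$ (k, l)) + 3 * e * ?m)"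
  proof (intro sum_mono)
    fix l k assume "l \<in> {..<K}" "k \<in> {..<K}"
    then have "cmod ((P * H * mat_adjoint P) $$ (k, l) - H $$ (k, l)) \<le> 3 * e * ?m"
      by (intro mat_conj_perturb[OF P H]) (use e in auto)
    then show "cmod (H $$ (k, l)) \<le> cmod ((P * H * mat_adjoint P) $$ (k, l)) + 3 * e * ?m"
      by (smt (verit) norm_triangle_sub norm_minus_commute)
  qed
  also have "\<dots> = ?m' + 3 * e * (real K)\<^sup>2 * ?m"
    by (simp add: sum.distrib power2_eq_square algebra_simps)
  also have "3 * e * (real K)\<^sup>2 * ?m \<le> 1/2 * ?m"
    using small by (intro mult_right_mono) (auto intro!: sum_nonneg)
  finally show ?thesis by simp
qed

text \<open>
  If the claim failed, there would be matrices \<open>H n\<close> and \<open>P n\<close> with \<open>P n\<close> tending to the identity along which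
  the two values of \<open>h\<close> stay apart. One of the two values is nonzero, which bounds the eigenvalues, and
  hence the entries, of \<open>H n\<close> or of \<open>P n * H n * mat_adjoint (P n)\<close>, and then of both. Along a convergent
  subsequence both spectra tend to the spectrum of the same limit, a contradiction.
\<close>

lemma eval_ord_perturbation_uniform:
  fixes h :: "(nat \<Rightarrow> real) \<Rightarrow> real"
  assumes cont: "continuous_on (Rn K) h"
    and supp: "R \<ge> 0" "\<And>y i. y \<in> Rn K \<Longrightarrow> h y \<noteq> 0 \<Longrightarrow> i < K \<Longrightarrow> \<bar>y i\<bar> \<le> R"
    and \<epsilon>: "\<epsilon> > 0"
  obtains \<eta> where "\<eta> > 0" "\<And>H P. hermitian_mat K H \<Longrightarrow> P \<in> carrier_mat K K \<Longrightarrow>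
      (\<And>i j. i < K \<Longrightarrow> j < K \<Longrightarrow> cmod (P $$ (i, j) - (if i = j then 1 else 0)) \<le> \<eta>) \<Longrightarrow>
      \<bar>h (eval_ord K (P * H * mat_adjoint P)) - h (eval_ord K H)\<bar> \<le> \<epsilon>"
proof (rule ccontr)
  assume contr: "\<not> thesis"
  \<comment> \<open>tends to zero, and is small enough for \<open>mat_conj_perturb_sum\<close> from the start\<close>
  let ?e = "\<lambda>n. 1 / (6 * (real K)\<^sup>2 + 1 + real n)"
  let ?near = "\<lambda>n P. \<forall>i<K. \<forall>j<K. cmod (P $$ (i, j) - (if i = j then 1 else 0)) \<le> ?e n"
  have Dn: "1 \<le> 6 * (real K)\<^sup>2 + 1 + real n" "6 * (real K)\<^sup>2 \<le> 6 * (real K)\<^sup>2 + 1 + real n" for n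
    by auto
  have e0: "?e n > 0" for n using Dn(1)[of n] by (intro divide_pos_pos) linarith+
  have e1: "?e n \<le> 1" for n
  proof -
    have "1 / x \<le> 1" if "1 \<le> x" for x :: real using that by simp
    from this[OF Dn(1)] show ?thesis .
  qed
  have e6: "6 * ?e n * (real K)\<^sup>2 \<le> 1" for n
  proof -
    have "6 * (1 / x) * y \<le> 1" if "1 \<le> x" "6 * y \<le> x" for x y :: real
      using that by (simp add: divide_le_eq)
    from this[OF Dn] show ?thesis .
  qed
  have "\<exists>H P. hermitian_mat K H \<and> P \<in> carrier_mat K K \<and> ?near n P \<and>
      \<bar>h (eval_ord K (P * H * mat_adjoint P)) - h (eval_ord K H)\<bar> > \<epsilon>" for n
  proof (rule ccontr)
    assume no: "\<nexists>H P. hermitian_mat K H \<and> P \<in> carrier_mat K K \<and> ?near n P \<and>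
      \<bar>h (eval_ord K (P * H * mat_adjoint P)) - h (eval_ord K H)\<bar> > \<epsilon>"
    have thesis
    proof (rule that[OF e0[of n]])
      fix H P :: "complex mat"
      assume "hermitian_mat K H" "P \<in> carrier_mat K K"
        "\<And>i j. i < K \<Longrightarrow> j < K \<Longrightarrow> cmod (P $$ (i, j) - (if i = j then 1 else 0)) \<le> ?e n"
      then have "\<not> \<bar>h (eval_ord K (P * H * mat_adjoint P)) - h (eval_ord K H)\<bar> > \<epsilon>"
        using no by blast
      then show "\<bar>h (eval_ord K (P * H * mat_adjoint P)) - h (eval_ord K H)\<bar> \<le> \<epsilon>"
        by (simp only: not_less)
    qed
    with contr show False ..
  qed
  then obtain H P where HP: "\<And>n. hermitian_mat K (H n)" "\<And>n. P n \<in> carrier_mat K K" "\<And>n. ?near n (P n)"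
    and far: "\<And>n. \<bar>h (eval_ord K (P n * H n * mat_adjoint (P n))) - h (eval_ord K (H n))\<bar> > \<epsilon>"
    by metis
  have Hc: "H n \<in> carrier_mat K K" for n using HP(1)[of n] by (simp add: hermitian_mat_def)
  let ?m = "\<lambda>A. \<Sum>l<K. \<Sum>k<K. cmod (A $$ (k, l))"
  let ?PHP = "\<lambda>n. P n * H n * mat_adjoint (P n)"
  have herm: "hermitian_mat K (?PHP n)" for n by (rule hermitian_mat_conj[OF HP(1,2)])
  have m_le: "?m A \<le> (real K)^3 * R" if A: "hermitian_mat K A" and nz: "h (eval_ord K A) \<noteq> 0" for A
  proof -
    have Rn: "eval_ord K A \<in> Rn K" using eval_ord_in_weyl[of K A] by (simp add: weyl_def)
    have "?m A \<le> (\<Sum>l<K. \<Sum>k<K. \<Sum>l<K. R)"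
    proof (intro sum_mono)
      fix l k assume "l \<in> {..<K}" "k \<in> {..<K}"
      then have "cmod (A $$ (k, l)) \<le> (\<Sum>l<K. \<bar>eval_ord K A l\<bar>)"
        by (intro entries_le_eval_ord[OF A]) auto
      also have "\<dots> \<le> (\<Sum>l<K. R)" by (intro sum_mono supp(2)[OF Rn nz]) auto
      finally show "cmod (A $$ (k, l)) \<le> (\<Sum>l<K. R)" .
    qed
    also have "\<dots> = (real K)^3 * R" by (simp add: power3_eq_cube)
    finally show ?thesis .
  qed
  define M where "M = 2 * ((real K)^3 * R)"
  have M0: "(real K)^3 * R \<ge> 0" using supp(1) by simp
  have mH: "?m (H n) \<le> M" for n
  proof -
    have "h (eval_ord K (?PHP n)) \<noteq> 0 \<or> h (eval_ord K (H n)) \<noteq> 0" using far[of n] \<epsilon> by auto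
    then show ?thesis
    proof
      assume "h (eval_ord K (?PHP n)) \<noteq> 0"
      then have "?m (?PHP n) \<le> (real K)^3 * R" using m_le[OF herm] by blast
      moreover have "?m (H n) \<le> 2 * ?m (?PHP n)"
        by (rule mat_conj_perturb_sum[OF HP(2) Hc _ e1[of n] e6[of n]]) (use HP(3)[of n] in auto)
      ultimately show ?thesis unfolding M_def by linarith
    next
      assume "h (eval_ord K (H n)) \<noteq> 0"
      then have "?m (H n) \<le> (real K)^3 * R" using m_le[OF HP(1)] by blast
      then show ?thesis unfolding M_def using M0 by linarith
    qed
  qed
  have ent: "cmod (H n $$ p) \<le> M" if p: "p \<in> {..<K} \<times> {..<K}" for n p
  proof -
    obtain k l where kl: "p = (k, l)" "k < K" "l < K" using p by auto
    have "cmod (H n $$ (k, l)) \<le> (\<Sum>k<K. cmod (H n $$ (k, l)))"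
      by (rule member_le_sum) (use kl in auto)
    also have "\<dots> \<le> ?m (H n)"
      by (rule member_le_sum[where f="\<lambda>l. \<Sum>k<K. cmod (H n $$ (k, l))"])
         (use kl in \<open>auto intro!: sum_nonneg\<close>)
    also have "\<dots> \<le> M" by (rule mH)
    finally show ?thesis by (simp add: kl)
  qed
  obtain r where r: "strict_mono (r :: nat \<Rightarrow> nat)"
    "\<And>p. p \<in> {..<K} \<times> {..<K} \<Longrightarrow> \<exists>l. (\<lambda>n. H (r n) $$ p) \<longlonglongrightarrow> l"
    using function_convergent_subsequence[of "{..<K} \<times> {..<K}" "\<lambda>n p. H n $$ p" M] ent by auto
  then obtain L0 where L0: "\<And>p. p \<in> {..<K} \<times> {..<K} \<Longrightarrow> (\<lambda>n. H (r n) $$ p) \<longlonglongrightarrow> L0 p" by metis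
  define L where "L = Matrix.mat K K L0"
  have L: "(\<lambda>n. H (r n) $$ (i, j)) \<longlonglongrightarrow> L $$ (i, j)" if "i < K" "j < K" for i j
    using L0[of "(i, j)"] that by (simp add: L_def)
  have Lh: "hermitian_mat K L"
    unfolding hermitian_mat_iff
  proof (intro conjI allI impI)
    fix i j assume ij: "i < K" "j < K"
    show "L $$ (i, j) = cnj (L $$ (j, i))"
    proof (rule LIMSEQ_unique[OF L[OF ij]])
      have "(\<lambda>n. cnj (H (r n) $$ (j, i))) \<longlonglongrightarrow> cnj (L $$ (j, i))"
        using L[OF ij(2,1)] by (intro tendsto_cnj)
      moreover have "cnj (H (r n) $$ (j, i)) = H (r n) $$ (i, j)" for n
        using HP(1)[of "r n"] ij unfolding hermitian_mat_iff by metis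
      ultimately show "(\<lambda>n. H (r n) $$ (i, j)) \<longlonglongrightarrow> cnj (L $$ (j, i))" by simp
    qed
  qed (simp add: L_def)
  have "?e \<longlonglongrightarrow> 0"
    by (intro real_tendsto_divide_at_top[OF tendsto_const]
        filterlim_tendsto_add_at_top[OF tendsto_const filterlim_real_sequentially])
  then have "(\<lambda>n. 3 * ?e n * M) \<longlonglongrightarrow> 3 * 0 * M" by (intro tendsto_intros)
  from LIMSEQ_subseq_LIMSEQ[OF this r(1)] have elim: "(\<lambda>n. 3 * ?e (r n) * M) \<longlonglongrightarrow> 0"
    by (simp add: o_def)
  have PL: "(\<lambda>n. ?PHP (r n) $$ (i, j)) \<longlonglongrightarrow> L $$ (i, j)" if ij: "i < K" "j < K" for i j
  proof -
    have "(\<lambda>n. ?PHP (r n) $$ (i, j) - H (r n) $$ (i, j)) \<longlonglongrightarrow> 0"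
    proof (rule Lim_null_comparison[OF always_eventually elim], rule allI)
      fix n
      have "cmod (?PHP (r n) $$ (i, j) - H (r n) $$ (i, j)) \<le> 3 * ?e (r n) * ?m (H (r n))"
        by (rule mat_conj_perturb[OF HP(2) Hc ij _ e1]) (use HP(3)[of "r n"] in auto)
      also have "\<dots> \<le> 3 * ?e (r n) * M"
        using e0[of "r n"] by (intro mult_left_mono mH) simp
      finally show "cmod (?PHP (r n) $$ (i, j) - H (r n) $$ (i, j)) \<le> 3 * ?e (r n) * M" .
    qed
    from tendsto_add[OF this L[OF ij]] show ?thesis by simp
  qed
  have Rn: "eval_ord K A \<in> Rn K" for A using eval_ord_in_weyl[of K A] by (simp add: weyl_def)
  have 1: "(\<lambda>n. h (eval_ord K (H (r n)))) \<longlonglongrightarrow> h (eval_ord K L)"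
    by (rule continuous_on_Rn_seq[OF cont Rn Rn]) (rule eval_ord_tendsto[OF HP(1) Lh L])
  have 2: "(\<lambda>n. h (eval_ord K (?PHP (r n)))) \<longlonglongrightarrow> h (eval_ord K L)"
    by (rule continuous_on_Rn_seq[OF cont Rn Rn]) (rule eval_ord_tendsto[OF herm Lh PL])
  have "(\<lambda>n. \<bar>h (eval_ord K (?PHP (r n))) - h (eval_ord K (H (r n)))\<bar>) \<longlonglongrightarrow> \<bar>h (eval_ord K L) - h (eval_ord K L)\<bar>"
    by (intro tendsto_intros 1 2)
  then have "(\<lambda>n. \<bar>h (eval_ord K (?PHP (r n))) - h (eval_ord K (H (r n)))\<bar>) \<longlonglongrightarrow> 0" by simp
  then have "\<epsilon> \<le> 0"
    by (rule LIMSEQ_le_const) (use far less_imp_le in blast)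
  with \<epsilon> show False by simp
qed

text \<open>
  Here \<open>P\<close> is the positive square root of \<open>G G\<^sup>\<dagger>\<close> and \<open>trunc_mat K N * W\<close> is the coisometry \<open>P\<^sup>-\<^sup>1 G\<close>.
\<close>

lemma near_coisometry_polar:
  fixes G :: "complex mat"
  assumes G: "G \<in> carrier_mat K N" and KN: "K \<le> N"
    and near: "\<And>i j. i < K \<Longrightarrow> j < K \<Longrightarrow> cmod ((G * mat_adjoint G) $$ (i, j) - (if i = j then 1 else 0)) \<le> \<theta>"
    and \<theta>: "2 * (real K)\<^sup>2 * \<theta> \<le> 1"
  obtains P W where "P \<in> carrier_mat K K" "W \<in> unitary_group N" "G = P * trunc_mat K N * W"
    "\<And>i j. i < K \<Longrightarrow> j < K \<Longrightarrow> cmod (P $$ (i, j) - (if i = j then 1 else 0)) \<le> real K * ((real K)\<^sup>2 * \<theta>)"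
proof -
  define S where "S = G * mat_adjoint G"
  have Sc: "S \<in> carrier_mat K K" using G by (auto simp: S_def)
  have "hermitian_mat K S"
    unfolding hermitian_mat_def using Sc G by (simp add: S_def mat_adjoint_mult)
  from hermitian_spectral[OF this] obtain Q s where Q: "Q \<in> unitary_group K"
    "S = Q * mat_diag K (\<lambda>i. complex_of_real (s i)) * mat_adjoint Q" by blast
  note Qd = unitary_groupD[OF Q(1)]
  let ?D = "\<lambda>f. mat_diag K (\<lambda>i. complex_of_real (f i))"
  define E where "E = S - 1\<^sub>m K"
  have Ec: "E \<in> carrier_mat K K" unfolding E_def by (intro minus_carrier_mat) simp
  have s1: "\<bar>s i - 1\<bar> \<le> (real K)\<^sup>2 * \<theta>" if i: "i < K" for i
  proof -
    have "mat_adjoint Q * E * mat_adjoint (mat_adjoint Q)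
        = (mat_adjoint Q * S - mat_adjoint Q * 1\<^sub>m K) * Q"
      unfolding E_def using Sc Qd(1)
      by (subst mult_minus_distrib_mat[of _ K K _ K]) auto
    also have "\<dots> = mat_adjoint Q * S * Q - mat_adjoint Q * 1\<^sub>m K * Q"
      using Sc Qd(1) by (subst minus_mult_distrib_mat[of _ K K _ _ K]) auto
    also have "mat_adjoint Q * S * Q = ?D s"
      unfolding Q(2) using Qd(1-3) by (simp add: mat_mult_assoc unitary_group_cancel[OF Q(1)] Qd(5))
    also have "mat_adjoint Q * 1\<^sub>m K * Q = 1\<^sub>m K"
      using Qd by simp
    finally have "(mat_adjoint Q * E * mat_adjoint (mat_adjoint Q)) $$ (i, i) = complex_of_real (s i - 1)"
      using i by simp
    then have "\<bar>s i - 1\<bar> = cmod ((mat_adjoint Q * E * mat_adjoint (mat_adjoint Q)) $$ (i, i))"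
      by (metis norm_of_real real_norm_def)
    also have "\<dots> \<le> 1\<^sup>2 * (\<Sum>l<K. \<Sum>k<K. cmod (E $$ (k, l)))"
      by (rule mat_conj_entry_bound[where m=K])
         (use Qd(1) Ec i unitary_entry_le_1[OF unitary_group_adjoint[OF Q(1)]] in auto)
    also have "\<dots> \<le> (\<Sum>l<K. \<Sum>k<K. \<theta>)"
    proof -
      have "cmod (E $$ (k, l)) \<le> \<theta>" if "k < K" "l < K" for k l
        using near[OF that] that Sc by (simp add: E_def S_def)
      then show ?thesis unfolding one_power2 mult_1 by (intro sum_mono) auto
    qed
    also have "\<dots> = (real K)\<^sup>2 * \<theta>" by (simp add: power2_eq_square)
    finally show ?thesis .
  qed
  have spos: "s i > 0" if "i < K" for i using s1[OF that] \<theta> by (simp add: abs_le_iff)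
  define P where "P = Q * ?D (\<lambda>i. sqrt (s i)) * mat_adjoint Q"
  define P' where "P' = Q * ?D (\<lambda>i. 1 / sqrt (s i)) * mat_adjoint Q"
  have Pc: "P \<in> carrier_mat K K" "P' \<in> carrier_mat K K"
    unfolding P_def P'_def using Qd(1) by (auto intro!: mult_carrier_mat)
  have diag_cong: "mat_diag K f = mat_diag K f'" if "\<And>i. i < K \<Longrightarrow> f i = f' i" for f f' :: "nat \<Rightarrow> complex"
    by (rule eq_matI) (use that in auto)
  have diag3: "?D (\<lambda>i. 1 / sqrt (s i)) * (?D s * ?D (\<lambda>i. 1 / sqrt (s i))) = 1\<^sub>m K"
  proof -
    have "?D (\<lambda>i. 1 / sqrt (s i)) * (?D s * ?D (\<lambda>i. 1 / sqrt (s i))) = mat_diag K (\<lambda>_. 1)"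
      unfolding mat_diag_diag
    proof (rule diag_cong)
      fix i assume "i < K"
      then have "1 / sqrt (s i) * (s i * (1 / sqrt (s i))) = 1"
        using spos[of i] by (simp add: field_simps)
      then show "complex_of_real (1 / sqrt (s i)) * (complex_of_real (s i) * complex_of_real (1 / sqrt (s i))) = 1"
        by (metis of_real_1 of_real_mult)
    qed
    then show ?thesis by simp
  qed
  have diag2: "?D (\<lambda>i. sqrt (s i)) * ?D (\<lambda>i. 1 / sqrt (s i)) = 1\<^sub>m K"
  proof -
    have "?D (\<lambda>i. sqrt (s i)) * ?D (\<lambda>i. 1 / sqrt (s i)) = mat_diag K (\<lambda>_. 1)"
      unfolding mat_diag_diag
    proof (rule diag_cong)
      fix i assume "i < K"
      then have "sqrt (s i) * (1 / sqrt (s i)) = 1"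
        using spos[of i] by (simp add: field_simps)
      then show "complex_of_real (sqrt (s i)) * complex_of_real (1 / sqrt (s i)) = 1"
        by (metis of_real_1 of_real_mult)
    qed
    then show ?thesis by simp
  qed
  have P'adj: "mat_adjoint P' = P'"
    unfolding P'_def using Qd(1-3) by (simp add: mat_adjoint_mult mat_mult_assoc mat_adjoint_diag)
  define V where "V = P' * G"
  have Vc: "V \<in> carrier_mat K N" unfolding V_def using Pc G by auto
  have "V * mat_adjoint V = P' * S * P'"
    unfolding V_def S_def using Pc G by (simp add: mat_adjoint_mult P'adj mat_mult_assoc)
  also have "\<dots> = Q * (?D (\<lambda>i. 1 / sqrt (s i)) * (?D s * ?D (\<lambda>i. 1 / sqrt (s i)))) * mat_adjoint Q"
    unfolding P'_def Q(2) using Qd(1-3)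
    by (simp add: mat_mult_assoc unitary_group_cancel[OF Q(1)] del: mat_diag_diag)
  also have "\<dots> = 1\<^sub>m K" unfolding diag3 using Qd by simp
  finally have VV: "V * mat_adjoint V = 1\<^sub>m K" .
  obtain W where W: "W \<in> unitary_group N" "\<And>i j. i < K \<Longrightarrow> j < N \<Longrightarrow> W $$ (i, j) = V $$ (i, j)"
    using coisometry_extend_unitary[OF Vc VV KN] by blast
  note Wd = unitary_groupD[OF W(1)]
  have TW: "trunc_mat K N * W = V"
  proof (rule eq_matI)
    fix i j assume "i < dim_row V" "j < dim_col V"
    then have ij: "i < K" "j < N" using Vc by auto
    then have "(trunc_mat K N * W) $$ (i, j) = W $$ (i, j)"
      using Wd KN by (intro trunc_mat_mult_index) auto
    then show "(trunc_mat K N * W) $$ (i, j) = V $$ (i, j)" using W(2)[OF ij] by simp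
  qed (use Wd Vc in auto)
  have "P * P' = Q * (?D (\<lambda>i. sqrt (s i)) * ?D (\<lambda>i. 1 / sqrt (s i))) * mat_adjoint Q"
    unfolding P'_def P_def using Qd(1-3)
    by (simp add: mat_mult_assoc unitary_group_cancel[OF Q(1)] del: mat_diag_diag)
  also have "\<dots> = 1\<^sub>m K" unfolding diag2 using Qd by simp
  finally have "P * P' = 1\<^sub>m K" .
  then have "P * V = G" unfolding V_def using Pc G
    by (metis assoc_mult_mat left_mult_one_mat)
  then have GP: "G = P * trunc_mat K N * W"
    using Pc Wd by (simp add: mat_mult_assoc TW)
  have "cmod (P $$ (i, j) - (if i = j then 1 else 0)) \<le> real K * ((real K)\<^sup>2 * \<theta>)" if ij: "i < K" "j < K" for i j
  proof -
    have 1: "P $$ (i, j) = (\<Sum>l<K. complex_of_real (sqrt (s l)) * (Q $$ (i, l) * cnj (Q $$ (j, l))))"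
      unfolding P_def by (rule mat_conj_diag_index[OF Qd(1) ij])
    have "(Q * mat_adjoint Q) $$ (i, j) = (\<Sum>l<K. Q $$ (i, l) * cnj (Q $$ (j, l)))"
      by (rule mat_mult_adjoint_index) (use Qd ij in auto)
    then have 2: "(if i = j then 1 else 0) = (\<Sum>l<K. Q $$ (i, l) * cnj (Q $$ (j, l)))"
      using Qd(4) ij by simp
    have "P $$ (i, j) - (if i = j then 1 else 0)
        = (\<Sum>l<K. complex_of_real (sqrt (s l) - 1) * (Q $$ (i, l) * cnj (Q $$ (j, l))))"
      unfolding 1 2 by (simp add: sum_subtractf[symmetric] left_diff_distrib)
    also have "cmod \<dots> \<le> (\<Sum>l<K. \<bar>sqrt (s l) - 1\<bar> * (1 * 1))"
      unfolding norm_mult complex_mod_cnj norm_of_real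
      by (intro order_trans[OF norm_sum] sum_mono, unfold norm_mult complex_mod_cnj norm_of_real)
         (intro mult_left_mono mult_mono unitary_entry_le_1[OF Q(1)], use ij in auto)
    also have "\<dots> \<le> (\<Sum>l<K. (real K)\<^sup>2 * \<theta>)"
    proof (intro sum_mono)
      fix l assume "l \<in> {..<K}"
      then have l: "l < K" by simp
      have "\<bar>sqrt (s l) - 1\<bar> * 1 \<le> \<bar>sqrt (s l) - 1\<bar> * (sqrt (s l) + 1)"
        using spos[OF l] by (intro mult_left_mono) auto
      also have "\<dots> = \<bar>(sqrt (s l) - 1) * (sqrt (s l) + 1)\<bar>"
        using spos[OF l] by (simp add: abs_mult)
      also have "(sqrt (s l) - 1) * (sqrt (s l) + 1) = s l - 1"
        using spos[OF l] by (simp add: algebra_simps)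
      finally show "\<bar>sqrt (s l) - 1\<bar> * (1 * 1) \<le> (real K)\<^sup>2 * \<theta>" using s1[OF l] by simp
    qed
    also have "\<dots> = real K * ((real K)\<^sup>2 * \<theta>)" by simp
    finally show ?thesis .
  qed
  with Pc(1) W(1) GP show thesis by (rule that)
qed

section \<open>Rotations of Gaussian product measures\<close>

text \<open>
  The standard normal law on the real line, written as the factors of \<open>gauss_space\<close>.
\<close>

abbreviation std_normal :: "real measure" where
  "std_normal \<equiv> density lborel (\<lambda>t. ennreal (std_normal_density t))"

lemma prob_space_std_normal: "prob_space std_normal"
  by (rule prob_space_normal_density) simp

lemma nn_integral_std_normal_pair:
  assumes f[measurable]: "f \<in> borel_measurable (borel \<Otimes>\<^sub>M borel)"
  shows "(\<integral>\<^sup>+x. \<integral>\<^sup>+y. f (x, y) \<partial>std_normal \<partial>std_normal)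
    = (\<integral>\<^sup>+x. \<integral>\<^sup>+y. ennreal (std_normal_density x * std_normal_density y) * f (x, y) \<partial>lborel \<partial>lborel)"
proof -
  have "(\<integral>\<^sup>+x. \<integral>\<^sup>+y. f (x, y) \<partial>std_normal \<partial>std_normal)
    = (\<integral>\<^sup>+x. ennreal (std_normal_density x) * (\<integral>\<^sup>+y. ennreal (std_normal_density y) * f (x, y) \<partial>lborel) \<partial>lborel)"
    by (simp add: nn_integral_density)
  also have "\<dots> = (\<integral>\<^sup>+x. \<integral>\<^sup>+y. ennreal (std_normal_density x * std_normal_density y) * f (x, y) \<partial>lborel \<partial>lborel)"
    by (simp add: nn_integral_cmult[symmetric] ennreal_mult mult.assoc)
  finally show ?thesis .
qed

text \<open>
  For \<open>c \<noteq> 0\<close> the rotation is a product of two triangular maps, each of which changes one coordinate by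
  an affine map with the other coordinate fixed; their factors \<open>1/c\<close> and \<open>c\<close> cancel.
\<close>

lemma nn_integral_lborel_rotation:
  fixes c s :: real
  assumes f[measurable]: "f \<in> borel_measurable (borel \<Otimes>\<^sub>M borel)" and cs: "c\<^sup>2 + s\<^sup>2 = 1"
  shows "(\<integral>\<^sup>+x. \<integral>\<^sup>+y. f (c * x - s * y, s * x + c * y) \<partial>lborel \<partial>lborel)
    = (\<integral>\<^sup>+x. \<integral>\<^sup>+y. f (x, y) \<partial>lborel \<partial>(lborel :: real measure))"
proof (cases "c = 0")
  case True
  then have s: "\<bar>s\<bar> = 1" "s \<noteq> 0" using cs by (auto simp: power2_eq_1_iff)
  have "(\<integral>\<^sup>+x. \<integral>\<^sup>+y. f (c * x - s * y, s * x + c * y) \<partial>lborel \<partial>lborel)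
    = (\<integral>\<^sup>+x. \<integral>\<^sup>+y. f (y, s * x) \<partial>lborel \<partial>lborel)"
  proof (rule nn_integral_cong)
    fix x :: real
    show "(\<integral>\<^sup>+y. f (c * x - s * y, s * x + c * y) \<partial>lborel) = (\<integral>\<^sup>+y. f (y, s * x) \<partial>lborel)"
      using nn_integral_real_affine[of "\<lambda>y. f (y, s * x)" "- s" 0] s True by simp
  qed
  also have "\<dots> = (\<integral>\<^sup>+y. \<integral>\<^sup>+x. f (y, s * x) \<partial>lborel \<partial>lborel)"
    by (rule lborel_pair.Fubini') simp
  also have "\<dots> = (\<integral>\<^sup>+y. \<integral>\<^sup>+x. f (y, x) \<partial>lborel \<partial>lborel)"
  proof (rule nn_integral_cong)
    fix y :: real
    show "(\<integral>\<^sup>+x. f (y, s * x) \<partial>lborel) = (\<integral>\<^sup>+x. f (y, x) \<partial>lborel)"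
      using nn_integral_real_affine[of "\<lambda>x. f (y, x)" s 0] s by simp
  qed
  finally show ?thesis .
next
  case False
  have "(\<integral>\<^sup>+x. \<integral>\<^sup>+y. f (c * x - s * y, s * x + c * y) \<partial>lborel \<partial>lborel)
    = (\<integral>\<^sup>+y. \<integral>\<^sup>+x. f (c * x - s * y, s * x + c * y) \<partial>lborel \<partial>lborel)"
    by (rule lborel_pair.Fubini') simp
  also have "\<dots> = (\<integral>\<^sup>+y. ennreal \<bar>1 / c\<bar> * (\<integral>\<^sup>+u. f (u, (s * u + y) / c) \<partial>lborel) \<partial>lborel)"
  proof (rule nn_integral_cong)
    fix y :: real
    have arg: "s * (s * y / c + 1 / c * u) + c * y = (s * u + y) / c" for u
    proof -
      have "s * (s * y / c + 1 / c * u) + c * y = (s\<^sup>2 * y + s * u + c\<^sup>2 * y) / c"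
        using False by (simp add: field_simps power2_eq_square)
      also have "s\<^sup>2 * y + s * u + c\<^sup>2 * y = (c\<^sup>2 + s\<^sup>2) * y + s * u" by (simp add: algebra_simps)
      finally show ?thesis unfolding cs by (simp add: add.commute)
    qed
    have arg2: "c * (s * y / c + 1 / c * u) - s * y = u" for u
      using False by (simp add: field_simps)
    show "(\<integral>\<^sup>+x. f (c * x - s * y, s * x + c * y) \<partial>lborel)
        = ennreal \<bar>1 / c\<bar> * (\<integral>\<^sup>+u. f (u, (s * u + y) / c) \<partial>lborel)"
      using nn_integral_real_affine[of "\<lambda>x. f (c * x - s * y, s * x + c * y)" "1 / c" "s * y / c"] False
      unfolding arg arg2 by simp
  qed
  also have "\<dots> = (\<integral>\<^sup>+y. \<integral>\<^sup>+u. ennreal \<bar>1 / c\<bar> * f (u, (s * u + y) / c) \<partial>lborel \<partial>lborel)"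
    by (simp add: nn_integral_cmult)
  also have "\<dots> = (\<integral>\<^sup>+u. \<integral>\<^sup>+y. ennreal \<bar>1 / c\<bar> * f (u, (s * u + y) / c) \<partial>lborel \<partial>lborel)"
    by (rule lborel_pair.Fubini') simp
  also have "\<dots> = (\<integral>\<^sup>+u. \<integral>\<^sup>+y. f (u, y) \<partial>lborel \<partial>lborel)"
  proof (rule nn_integral_cong)
    fix u :: real
    have "(s * u + y) / c = s * u / c + 1 / c * y" for y using False by (simp add: field_simps)
    then show "(\<integral>\<^sup>+y. ennreal \<bar>1 / c\<bar> * f (u, (s * u + y) / c) \<partial>lborel) = (\<integral>\<^sup>+y. f (u, y) \<partial>lborel)"
      using nn_integral_real_affine[of "\<lambda>y. f (u, y)" "1 / c" "s * u / c"] False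
      by (simp add: nn_integral_cmult)
  qed
  finally show ?thesis .
qed

lemma nn_integral_std_normal_rotation:
  fixes c s :: real
  assumes f[measurable]: "f \<in> borel_measurable (borel \<Otimes>\<^sub>M borel)" and cs: "c\<^sup>2 + s\<^sup>2 = 1"
  shows "(\<integral>\<^sup>+x. \<integral>\<^sup>+y. f (c * x - s * y, s * x + c * y) \<partial>std_normal \<partial>std_normal)
    = (\<integral>\<^sup>+x. \<integral>\<^sup>+y. f (x, y) \<partial>std_normal \<partial>std_normal)"
proof -
  have dens: "std_normal_density x * std_normal_density y
      = std_normal_density (c * x - s * y) * std_normal_density (s * x + c * y)" for x y
  proof -
    have "(c * x - s * y)\<^sup>2 + (s * x + c * y)\<^sup>2 = (c\<^sup>2 + s\<^sup>2) * (x\<^sup>2 + y\<^sup>2)"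
      by (simp add: power2_eq_square algebra_simps)
    then have "x\<^sup>2 + y\<^sup>2 = (c * x - s * y)\<^sup>2 + (s * x + c * y)\<^sup>2" unfolding cs by simp
    then have "exp (- x\<^sup>2 / 2) * exp (- y\<^sup>2 / 2)
        = exp (- (c * x - s * y)\<^sup>2 / 2) * exp (- (s * x + c * y)\<^sup>2 / 2)"
      unfolding exp_add[symmetric] by (intro arg_cong[where f=exp]) (simp add: field_simps)
    then show ?thesis unfolding std_normal_density_def by simp
  qed
  let ?F = "\<lambda>(x, y). ennreal (std_normal_density x * std_normal_density y) * f (x, y)"
  have [measurable]: "?F \<in> borel_measurable (borel \<Otimes>\<^sub>M borel)" by measurable
  have 1: "(\<integral>\<^sup>+x. \<integral>\<^sup>+y. f (c * x - s * y, s * x + c * y) \<partial>std_normal \<partial>std_normal)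
    = (\<integral>\<^sup>+x. \<integral>\<^sup>+y. ?F (c * x - s * y, s * x + c * y) \<partial>lborel \<partial>lborel)"
    using nn_integral_std_normal_pair[of "\<lambda>(x, y). f (c * x - s * y, s * x + c * y)"]
    by (simp add: dens[symmetric])
  have 2: "(\<integral>\<^sup>+x. \<integral>\<^sup>+y. f (x, y) \<partial>std_normal \<partial>std_normal)
    = (\<integral>\<^sup>+x. \<integral>\<^sup>+y. ?F (x, y) \<partial>lborel \<partial>lborel)"
    using nn_integral_std_normal_pair[OF f] by simp
  show ?thesis unfolding 1 2 by (rule nn_integral_lborel_rotation[OF _ cs]) measurable
qed

text \<open>
  The law of a family of independent standard normal variables, for an arbitrary index type.
\<close>

definition gauss_prod :: "('i \<Rightarrow> real) measure" where
  "gauss_prod = PiM UNIV (\<lambda>_. std_normal)"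

lemma prob_space_gauss_prod: "prob_space gauss_prod"
  unfolding gauss_prod_def by (intro prob_space_PiM prob_space_std_normal)

lemma space_gauss_prod[simp]: "space gauss_prod = UNIV"
  by (simp add: gauss_prod_def space_PiM)

lemma sets_gauss_prod: "sets gauss_prod = sets (PiM UNIV (\<lambda>_. borel))"
  unfolding gauss_prod_def by (intro sets_PiM_cong) auto

lemma measurable_gauss_prod_coord[measurable]: "(\<lambda>w. w i) \<in> borel_measurable gauss_prod"
  unfolding gauss_prod_def by (rule measurable_PiM_component_rev) auto

lemma measurable_gauss_prodI:
  assumes "\<And>i. (\<lambda>w. f w i) \<in> borel_measurable M"
  shows "f \<in> measurable M gauss_prod"
proof -
  have "f \<in> measurable M (PiM UNIV (\<lambda>_. borel))"
    by (rule measurable_PiM_single') (use assms in auto)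
  then show ?thesis using measurable_cong_sets[OF refl sets_gauss_prod] by blast
qed

text \<open>
  Two coordinates are split off from the product, and the measurability of the remaining inner integral
  is recorded.
\<close>

lemma nn_integral_gauss_prod_pair:
  fixes f :: "('i \<Rightarrow> real) \<Rightarrow> ennreal"
  assumes f: "f \<in> borel_measurable gauss_prod" and ij: "i \<noteq> j"
  defines "A \<equiv> UNIV - {i, j}"
  shows "(\<integral>\<^sup>+w. f w \<partial>gauss_prod)
    = (\<integral>\<^sup>+x. \<integral>\<^sup>+y. \<integral>\<^sup>+X. f (X(j := y, i := x)) \<partial>PiM A (\<lambda>_. std_normal) \<partial>std_normal \<partial>std_normal)"
    "(\<lambda>(x, y). \<integral>\<^sup>+X. f (X(j := y, i := x)) \<partial>PiM A (\<lambda>_. std_normal)) \<in> borel_measurable (borel \<Otimes>\<^sub>M borel)"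
proof -
  let ?M = "\<lambda>_. std_normal"
  interpret N: prob_space std_normal by (rule prob_space_std_normal)
  interpret PA: prob_space "PiM A ?M" by (intro prob_space_PiM prob_space_std_normal)
  interpret PjA: prob_space "PiM (insert j A) ?M" by (intro prob_space_PiM prob_space_std_normal)
  have U: "insert i (insert j A) = UNIV" by (auto simp: A_def)
  have [measurable]: "f \<in> borel_measurable (PiM (insert i (insert j A)) ?M)"
    using f unfolding U gauss_prod_def .
  have m2[measurable]: "(\<lambda>(x, X). X(i := x)) \<in> measurable (std_normal \<Otimes>\<^sub>M PiM (insert j A) ?M) (PiM (insert i (insert j A)) ?M)"
    unfolding case_prod_unfold by (intro measurable_fun_upd[where J="insert j A"]) auto
  have m1[measurable]: "(\<lambda>(x, X). X(j := x)) \<in> measurable (std_normal \<Otimes>\<^sub>M PiM A ?M) (PiM (insert j A) ?M)"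
    unfolding case_prod_unfold by (intro measurable_fun_upd[where J=A]) auto
  have fm: "(\<lambda>(x, X). f (X(i := x))) \<in> borel_measurable (std_normal \<Otimes>\<^sub>M PiM (insert j A) ?M)"
    using measurable_compose[OF m2 \<open>f \<in> borel_measurable (PiM (insert i (insert j A)) ?M)\<close>]
    by (simp add: case_prod_unfold)
  have "(\<integral>\<^sup>+w. f w \<partial>gauss_prod)
      = (\<integral>\<^sup>+w. f w \<partial>distr (std_normal \<Otimes>\<^sub>M PiM (insert j A) ?M) (PiM (insert i (insert j A)) ?M) (\<lambda>(x, X). X(i := x)))"
    using distr_pair_PiM_eq_PiM[of "insert j A" ?M i] prob_space_std_normal
    by (simp add: U gauss_prod_def)
  also have "\<dots> = (\<integral>\<^sup>+p. f ((\<lambda>(x, X). X(i := x)) p) \<partial>(std_normal \<Otimes>\<^sub>M PiM (insert j A) ?M))"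
    by (rule nn_integral_distr) measurable
  also have "\<dots> = (\<integral>\<^sup>+x. \<integral>\<^sup>+X. f (X(i := x)) \<partial>PiM (insert j A) ?M \<partial>std_normal)"
    by (subst PjA.nn_integral_fst[symmetric]) (use fm in \<open>auto simp: case_prod_unfold\<close>)
  also have "\<dots> = (\<integral>\<^sup>+x. \<integral>\<^sup>+y. \<integral>\<^sup>+X. f (X(j := y, i := x)) \<partial>PiM A ?M \<partial>std_normal \<partial>std_normal)"
  proof (rule nn_integral_cong)
    fix x :: real
    have fx[measurable]: "(\<lambda>X. f (X(i := x))) \<in> borel_measurable (PiM (insert j A) ?M)"
      using measurable_Pair2[OF fm, of x] by simp
    have fm1: "(\<lambda>p. f (((\<lambda>(y, X). X(j := y)) p)(i := x))) \<in> borel_measurable (std_normal \<Otimes>\<^sub>M PiM A ?M)"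
      by (rule measurable_compose[OF m1 fx])
    have "(\<integral>\<^sup>+X. f (X(i := x)) \<partial>PiM (insert j A) ?M)
      = (\<integral>\<^sup>+X. f (X(i := x)) \<partial>distr (std_normal \<Otimes>\<^sub>M PiM A ?M) (PiM (insert j A) ?M) (\<lambda>(y, X). X(j := y)))"
      using distr_pair_PiM_eq_PiM[of A ?M j] prob_space_std_normal by simp
    also have "\<dots> = (\<integral>\<^sup>+p. f (((\<lambda>(y, X). X(j := y)) p)(i := x)) \<partial>(std_normal \<Otimes>\<^sub>M PiM A ?M))"
      by (rule nn_integral_distr) measurable
    also have "\<dots> = (\<integral>\<^sup>+y. \<integral>\<^sup>+X. f (X(j := y, i := x)) \<partial>PiM A ?M \<partial>std_normal)"
      by (subst PA.nn_integral_fst[symmetric]) (use fm1 in \<open>auto simp: case_prod_unfold\<close>)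
    finally show "(\<integral>\<^sup>+X. f (X(i := x)) \<partial>PiM (insert j A) ?M)
      = (\<integral>\<^sup>+y. \<integral>\<^sup>+X. f (X(j := y, i := x)) \<partial>PiM A ?M \<partial>std_normal)" .
  qed
  finally show "(\<integral>\<^sup>+w. f w \<partial>gauss_prod)
    = (\<integral>\<^sup>+x. \<integral>\<^sup>+y. \<integral>\<^sup>+X. f (X(j := y, i := x)) \<partial>PiM A ?M \<partial>std_normal \<partial>std_normal)" .
  have m3: "(\<lambda>(p, X). X(j := snd p, i := fst p)) \<in> measurable ((borel \<Otimes>\<^sub>M borel) \<Otimes>\<^sub>M PiM A ?M) (PiM (insert i (insert j A)) ?M)"
    unfolding case_prod_unfold
    by (intro measurable_fun_upd[where J="insert j A"] measurable_fun_upd[where J=A]) auto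
  from measurable_compose[OF this \<open>f \<in> borel_measurable (PiM (insert i (insert j A)) ?M)\<close>]
  have "(\<lambda>(p, X). f (X(j := snd p, i := fst p))) \<in> borel_measurable ((borel \<Otimes>\<^sub>M borel) \<Otimes>\<^sub>M PiM A ?M)"
    by (simp add: case_prod_unfold)
  from PA.borel_measurable_nn_integral[OF this]
  show "(\<lambda>(x, y). \<integral>\<^sup>+X. f (X(j := y, i := x)) \<partial>PiM A ?M) \<in> borel_measurable (borel \<Otimes>\<^sub>M borel)"
    by (simp add: case_prod_unfold)
qed

text \<open>
  Rotation in the plane of the coordinates \<open>i\<close> and \<open>j\<close>, for \<open>c\<^sup>2 + s\<^sup>2 = 1\<close>.
\<close>

definition rotate_pair :: "'i \<Rightarrow> 'i \<Rightarrow> real \<Rightarrow> real \<Rightarrow> ('i \<Rightarrow> real) \<Rightarrow> 'i \<Rightarrow> real" where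
  "rotate_pair i j c s w = w(i := c * w i - s * w j, j := s * w i + c * w j)"

lemma measurable_rotate_pair[measurable]:
  "rotate_pair i j c s \<in> measurable gauss_prod gauss_prod"
proof (rule measurable_gauss_prodI)
  fix k
  have 1[measurable]: "(\<lambda>w. w l) \<in> borel_measurable gauss_prod" for l :: 'a by simp
  show "(\<lambda>w. rotate_pair i j c s w k) \<in> borel_measurable gauss_prod"
    unfolding rotate_pair_def by (cases "k = j"; cases "k = i") simp_all
qed

lemma nn_integral_rotate_pair:
  fixes f :: "('i \<Rightarrow> real) \<Rightarrow> ennreal"
  assumes f: "f \<in> borel_measurable gauss_prod" and ij: "i \<noteq> j" and cs: "c\<^sup>2 + s\<^sup>2 = 1"
  shows "(\<integral>\<^sup>+w. f (rotate_pair i j c s w) \<partial>gauss_prod) = (\<integral>\<^sup>+w. f w \<partial>gauss_prod)"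
proof -
  let ?P = "PiM (UNIV - {i, j}) (\<lambda>_. std_normal)"
  let ?H = "\<lambda>(x, y). \<integral>\<^sup>+X. f (X(j := y, i := x)) \<partial>?P"
  have eq: "rotate_pair i j c s (X(j := y, i := x)) = X(j := s * x + c * y, i := c * x - s * y)"
    for X :: "'i \<Rightarrow> real" and x y
    using ij by (auto simp: rotate_pair_def fun_eq_iff)
  have "(\<integral>\<^sup>+w. f (rotate_pair i j c s w) \<partial>gauss_prod)
      = (\<integral>\<^sup>+x. \<integral>\<^sup>+y. \<integral>\<^sup>+X. f (X(j := s * x + c * y, i := c * x - s * y)) \<partial>?P \<partial>std_normal \<partial>std_normal)"
    by (subst nn_integral_gauss_prod_pair(1)[OF measurable_compose[OF measurable_rotate_pair f] ij])
       (simp only: eq)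
  also have "\<dots> = (\<integral>\<^sup>+x. \<integral>\<^sup>+y. ?H (x, y) \<partial>std_normal \<partial>std_normal)"
    using nn_integral_std_normal_rotation[OF nn_integral_gauss_prod_pair(2)[OF f ij] cs] by simp
  also have "\<dots> = (\<integral>\<^sup>+w. f w \<partial>gauss_prod)"
    by (subst nn_integral_gauss_prod_pair(1)[OF f ij]) simp
  finally show ?thesis .
qed

section \<open>Unitary invariance of Gaussian matrices\<close>

text \<open>
  Multiplication of the coordinate \<open>k\<close> by a phase \<open>z\<close>.
\<close>

definition phase_mat :: "nat \<Rightarrow> nat \<Rightarrow> complex \<Rightarrow> complex mat" where
  "phase_mat N k z = mat_diag N (\<lambda>i. if i = k then z else 1)"

text \<open>
  The real rotation in the plane of the coordinates \<open>k\<close> and \<open>m\<close>, with cosine \<open>c\<close> and sine \<open>s\<close>.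
\<close>

definition givens_mat :: "nat \<Rightarrow> nat \<Rightarrow> nat \<Rightarrow> real \<Rightarrow> real \<Rightarrow> complex mat" where
  "givens_mat N k m c s = Matrix.mat N N (\<lambda>(i, j).
     if i = k \<and> j = k \<or> i = m \<and> j = m then complex_of_real c
     else if i = k \<and> j = m then complex_of_real s
     else if i = m \<and> j = k then complex_of_real (- s)
     else if i = j then 1 else 0)"

lemma phase_mat_dim[simp]: "phase_mat N k z \<in> carrier_mat N N"
  "dim_row (phase_mat N k z) = N" "dim_col (phase_mat N k z) = N"
  by (auto simp: phase_mat_def)

lemma givens_mat_dim[simp]: "givens_mat N k m c s \<in> carrier_mat N N"
  "dim_row (givens_mat N k m c s) = N" "dim_col (givens_mat N k m c s) = N"
  by (auto simp: givens_mat_def)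

lemma phase_mat_mult_index:
  assumes "U \<in> carrier_mat N N" "i < N" "j < N"
  shows "(phase_mat N k z * U) $$ (i, j) = (if i = k then z else 1) * U $$ (i, j)"
  unfolding phase_mat_def using assms by (subst mat_diag_mult_left[of U N N]) auto

lemma sum_two_deltas:
  fixes f :: "nat \<Rightarrow> complex"
  assumes "k < N" "m < N" "k \<noteq> m"
  shows "(\<Sum>l<N. (if l = k then p else if l = m then q else 0) * f l) = p * f k + q * f m"
proof -
  have "(\<Sum>l<N. (if l = k then p else if l = m then q else 0) * f l)
      = (\<Sum>l<N. (if l = k then p * f l else 0) + (if l = m then q * f l else 0))"
    by (rule sum.cong) (use assms in auto)
  also have "\<dots> = p * f k + q * f m" using assms by (simp add: sum.distrib)
  finally show ?thesis .
qed

lemma givens_mat_mult_index: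
  assumes U: "U \<in> carrier_mat N N" "i < N" "j < N" and km: "k < N" "m < N" "k \<noteq> m"
  shows "(givens_mat N k m c s * U) $$ (i, j) =
    (if i = k then complex_of_real c * U $$ (k, j) + complex_of_real s * U $$ (m, j)
     else if i = m then complex_of_real (- s) * U $$ (k, j) + complex_of_real c * U $$ (m, j)
     else U $$ (i, j))"
proof -
  have "(givens_mat N k m c s * U) $$ (i, j) = (\<Sum>l<N. givens_mat N k m c s $$ (i, l) * U $$ (l, j))"
    using U by (subst mat_mult_index) auto
  also have "\<dots> = (\<Sum>l<N. (if i = k then (if l = k then complex_of_real c else if l = m then complex_of_real s else 0)
      else if i = m then (if l = k then complex_of_real (- s) else if l = m then complex_of_real c else 0)
      else if l = i then 1 else 0) * U $$ (l, j))"
    by (rule sum.cong) (use U km in \<open>auto simp: givens_mat_def\<close>)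
  also have "\<dots> = (if i = k then complex_of_real c * U $$ (k, j) + complex_of_real s * U $$ (m, j)
     else if i = m then complex_of_real (- s) * U $$ (k, j) + complex_of_real c * U $$ (m, j)
     else U $$ (i, j))"
    using sum_two_deltas[OF km, where f="\<lambda>l. U $$ (l, j)"] U
    by (cases "i = k"; cases "i = m") (auto simp: mult_delta_left cong: if_cong)
  finally show ?thesis .
qed

lemma phase_mat_adjoint: "mat_adjoint (phase_mat N k z) = phase_mat N k (cnj z)"
  by (rule eq_matI) (auto simp: phase_mat_def)

lemma givens_mat_adjoint:
  assumes "k \<noteq> m"
  shows "mat_adjoint (givens_mat N k m c s) = givens_mat N k m c (- s)"
proof (rule eq_matI)
  fix i j assume "i < dim_row (givens_mat N k m c (- s))" "j < dim_col (givens_mat N k m c (- s))"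
  then show "mat_adjoint (givens_mat N k m c s) $$ (i, j) = givens_mat N k m c (- s) $$ (i, j)"
    using assms
    by (cases "i = k"; cases "i = m"; cases "j = k"; cases "j = m") (simp_all add: givens_mat_def)
qed simp_all

lemma phase_mat_unitary:
  assumes "cmod z = 1"
  shows "phase_mat N k z \<in> unitary_group N"
proof (rule unitary_groupI)
  have "z * cnj z = 1" using assms complex_norm_square[of z] by simp
  then show "phase_mat N k z * mat_adjoint (phase_mat N k z) = 1\<^sub>m N"
    unfolding phase_mat_adjoint
    by (intro eq_matI, subst phase_mat_mult_index[of _ N]) (auto simp: phase_mat_def)
qed simp

lemma givens_mat_unitary:
  assumes cs: "c\<^sup>2 + s\<^sup>2 = 1" and km: "k < N" "m < N" "k \<noteq> m"
  shows "givens_mat N k m c s \<in> unitary_group N"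
proof (rule unitary_groupI)
  have 1: "complex_of_real c * complex_of_real c + complex_of_real s * complex_of_real s = 1"
    using cs by (metis of_real_1 of_real_add of_real_mult power2_eq_square)
  show "givens_mat N k m c s * mat_adjoint (givens_mat N k m c s) = 1\<^sub>m N"
  proof (rule eq_matI)
    fix i j assume "i < dim_row (1\<^sub>m N :: complex mat)" "j < dim_col (1\<^sub>m N :: complex mat)"
    then have ij: "i < N" "j < N" by auto
    show "(givens_mat N k m c s * mat_adjoint (givens_mat N k m c s)) $$ (i, j) = 1\<^sub>m N $$ (i, j)"
      unfolding givens_mat_adjoint[OF km(3)]
      by (subst givens_mat_mult_index[of _ N]) (use ij km 1 in \<open>auto simp: givens_mat_def add.commute\<close>)
  qed auto
qed simp

lemma unitary_col_inner:
  assumes U: "U \<in> unitary_group N" and jk: "j < N" "k < N"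
  shows "(\<Sum>i<N. cnj (U $$ (i, j)) * U $$ (i, k)) = (if j = k then 1 else 0)"
proof -
  note Ud = unitary_groupD[OF U]
  have "(mat_adjoint U * U) $$ (j, k) = (\<Sum>i<N. mat_adjoint U $$ (j, i) * U $$ (i, k))"
    using Ud jk by (subst mat_mult_index) auto
  also have "\<dots> = (\<Sum>i<N. cnj (U $$ (i, j)) * U $$ (i, k))"
    using Ud jk by (intro sum.cong) auto
  finally show ?thesis using Ud jk by simp
qed

lemma phase_to_real:
  obtains z where "cmod z = 1" "z * a = complex_of_real (cmod a)"
proof (cases "a = 0")
  case True
  then show thesis by (intro that[of 1]) auto
next
  case False
  show thesis
  proof (rule that[of "cnj a / complex_of_real (cmod a)"])
    show "cnj a / complex_of_real (cmod a) * a = complex_of_real (cmod a)"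
      using False complex_norm_square[of a] by (simp add: field_simps power2_eq_square)
  qed (use False in \<open>simp add: norm_divide\<close>)
qed

text \<open>
  Every unitary matrix is reduced to the identity by multiplication from the left with phases and plane
  rotations: once the first \<open>k\<close> columns are those of the identity, the column \<open>k\<close> is cleared from the
  bottom up to the diagonal.
\<close>

lemma unitary_elimination_induct:
  assumes U: "U \<in> unitary_group N"
    and one: "P (1\<^sub>m N)"
    and phase: "\<And>U k z. U \<in> unitary_group N \<Longrightarrow> k < N \<Longrightarrow> cmod z = 1 \<Longrightarrow> P (phase_mat N k z * U) \<Longrightarrow> P U"
    and givens: "\<And>U k m c s. U \<in> unitary_group N \<Longrightarrow> k < N \<Longrightarrow> m < N \<Longrightarrow> k \<noteq> m \<Longrightarrow> c\<^sup>2 + s\<^sup>2 = 1 \<Longrightarrow>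
      P (givens_mat N k m c s * U) \<Longrightarrow> P U"
  shows "P U"
proof -
  define Fix where "Fix = (\<lambda>k U. \<forall>j<k. \<forall>i<N. (U :: complex mat) $$ (i, j) = (if i = j then 1 else 0))"
  have main: "\<forall>U\<in>unitary_group N. Fix k U \<longrightarrow> P U" if "k \<le> N" for k
    using that
  proof (induction k rule: inc_induct)
    case base
    show ?case
    proof (intro ballI impI)
      fix U assume U: "U \<in> unitary_group N" "Fix N U"
      have "U = 1\<^sub>m N" by (rule eq_matI) (use U unitary_groupD[OF U(1)] in \<open>auto simp: Fix_def\<close>)
      then show "P U" using one by simp
    qed
  next
    case (step k)
    have elim: "\<forall>U\<in>unitary_group N. Fix k U \<longrightarrow> (\<forall>i<N. m \<le> i \<longrightarrow> U $$ (i, k) = 0) \<longrightarrow> P U" if "Suc k \<le> m" for m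
      using that
    proof (induction m rule: nat_induct_at_least)
      case base
      show ?case
      proof (intro ballI impI)
        fix U assume U: "U \<in> unitary_group N" and F: "Fix k U" and Z: "\<forall>i<N. Suc k \<le> i \<longrightarrow> U $$ (i, k) = 0"
        note Uc = unitary_groupD(1)[OF U]
        have col: "U $$ (i, k) = 0" if i: "i < N" "i \<noteq> k" for i
        proof (cases "i < k")
          case True
          have "(\<Sum>l<N. cnj (U $$ (l, i)) * U $$ (l, k)) = (\<Sum>l<N. if l = i then U $$ (l, k) else 0)"
            by (rule sum.cong) (use F True in \<open>auto simp: Fix_def\<close>)
          then show ?thesis using unitary_col_inner[OF U i(1) step(2)] i by simp
        qed (use i Z in auto)
        have "(\<Sum>l<N. cnj (U $$ (l, k)) * U $$ (l, k)) = (\<Sum>l<N. if l = k then cnj (U $$ (l, k)) * U $$ (l, k) else 0)"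
          by (rule sum.cong) (use col in auto)
        then have kk: "cnj (U $$ (k, k)) * U $$ (k, k) = 1"
          using unitary_col_inner[OF U step(2) step(2)] step(2) by simp
        then have "complex_of_real ((cmod (U $$ (k, k)))\<^sup>2) = 1"
          unfolding complex_norm_square by (simp add: mult.commute)
        then have "(cmod (U $$ (k, k)))\<^sup>2 = 1" by (simp only: of_real_eq_1_iff)
        then have "cmod (cnj (U $$ (k, k))) = 1"
          using norm_ge_zero[of "U $$ (k, k)"] by (simp add: power2_eq_1_iff)
        then have ph: "phase_mat N k (cnj (U $$ (k, k))) \<in> unitary_group N" "cmod (cnj (U $$ (k, k))) = 1"
          using phase_mat_unitary[of "cnj (U $$ (k, k))" N k] by blast+
        let ?U = "phase_mat N k (cnj (U $$ (k, k))) * U"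
        have "Fix (Suc k) ?U"
          unfolding Fix_def
        proof (intro allI impI)
          fix j i assume ji: "j < Suc k" "i < N"
          then have "j < N" using step(2) by simp
          show "?U $$ (i, j) = (if i = j then 1 else 0)"
            unfolding phase_mat_mult_index[OF Uc ji(2) \<open>j < N\<close>]
            using ji F col kk by (cases "j = k") (auto simp: Fix_def)
        qed
        then have "P ?U" using step(3) unitary_group_mult[OF ph(1) U] by blast
        then show "P U" by (rule phase[OF U step(2) ph(2)])
      qed
    next
      case (Suc m)
      show ?case
      proof (intro ballI impI)
        fix U assume U: "U \<in> unitary_group N" and F: "Fix k U" and Z: "\<forall>i<N. Suc m \<le> i \<longrightarrow> U $$ (i, k) = 0"
        show "P U"
        proof (cases "m < N")
          case False
          then show ?thesis using Suc.IH U F by auto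
        next
          \<comment> \<open>phases make the entries in the rows \<open>k\<close> and \<open>m\<close> real, then a rotation clears the row \<open>m\<close>\<close>
          case m: True
          have km: "k < N" "k \<noteq> m" "k < m" using step(2) Suc.hyps by auto
          obtain z1 where z1: "cmod z1 = 1" "z1 * U $$ (k, k) = complex_of_real (cmod (U $$ (k, k)))"
            using phase_to_real by blast
          obtain z2 where z2: "cmod z2 = 1" "z2 * U $$ (m, k) = complex_of_real (cmod (U $$ (m, k)))"
            using phase_to_real by blast
          define a where "a = cmod (U $$ (k, k))"
          define b where "b = cmod (U $$ (m, k))"
          define U1 where "U1 = phase_mat N k z1 * U"
          define U2 where "U2 = phase_mat N m z2 * U1"
          have U1: "U1 \<in> unitary_group N" unfolding U1_def
            by (rule unitary_group_mult[OF phase_mat_unitary[OF z1(1)] U])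
          have U2: "U2 \<in> unitary_group N" unfolding U2_def
            by (rule unitary_group_mult[OF phase_mat_unitary[OF z2(1)] U1])
          note c = unitary_groupD(1)[OF U] unitary_groupD(1)[OF U1] unitary_groupD(1)[OF U2]
          have e2: "U2 $$ (i, j) = (if i = m then z2 else 1) * ((if i = k then z1 else 1) * U $$ (i, j))"
            if "i < N" "j < N" for i j
            unfolding U2_def phase_mat_mult_index[OF c(2) that]
            unfolding U1_def phase_mat_mult_index[OF c(1) that] ..
          have F2: "Fix k U2" unfolding Fix_def
          proof (intro allI impI)
            fix j i assume ji: "j < k" "i < N"
            then have "j < N" "j \<noteq> m" "j \<noteq> k" using km by auto
            then show "U2 $$ (i, j) = (if i = j then 1 else 0)"
              using e2[OF ji(2), of j] F ji by (auto simp: Fix_def)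
          qed
          have Z2: "\<forall>i<N. Suc m \<le> i \<longrightarrow> U2 $$ (i, k) = 0" using e2 Z km by auto
          have ab: "U2 $$ (k, k) = complex_of_real a" "U2 $$ (m, k) = complex_of_real b"
            using e2 z1 z2 km m by (auto simp: a_def b_def)
          have "P U2"
          proof (cases "b = 0")
            case True
            have "U2 $$ (i, k) = 0" if "i < N" "m \<le> i" for i
            proof (cases "i = m")
              case False
              then show ?thesis using Z2 that by auto
            qed (use ab True in simp)
            then show ?thesis using Suc.IH U2 F2 by blast
          next
            case False
            then have "b > 0" by (simp add: b_def)
            define r where "r = sqrt (a\<^sup>2 + b\<^sup>2)"
            have r: "r > 0" unfolding r_def using \<open>b > 0\<close> by (simp add: add_nonneg_pos)
            have r2: "r\<^sup>2 = a\<^sup>2 + b\<^sup>2" unfolding r_def by simp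
            have cs: "(a / r)\<^sup>2 + (b / r)\<^sup>2 = 1"
              unfolding power_divide add_divide_distrib[symmetric] r2[symmetric] using r by simp
            let ?R = "givens_mat N k m (a / r) (b / r)"
            have U3: "?R * U2 \<in> unitary_group N"
              by (rule unitary_group_mult[OF givens_mat_unitary[OF cs km(1) m km(2)] U2])
            note e3 = givens_mat_mult_index[OF c(3) _ _ km(1) m km(2), of _ _ "a / r" "b / r"]
            have "Fix k (?R * U2)" unfolding Fix_def
            proof (intro allI impI)
              fix j i assume ji: "j < k" "i < N"
              then have "j < N" "j \<noteq> m" "j \<noteq> k" using km by auto
              then show "(?R * U2) $$ (i, j) = (if i = j then 1 else 0)"
                using F2 ji km m by (subst e3) (auto simp: Fix_def)
            qed
            moreover have "(?R * U2) $$ (i, k) = 0" if i: "i < N" "m \<le> i" for i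
            proof (cases "i = m")
              case True
              then show ?thesis
                by (subst e3) (use i km ab in \<open>auto simp: mult.commute\<close>)
            next
              case False
              then show ?thesis
                by (subst e3) (use i km Z2 in auto)
            qed
            ultimately have "P (?R * U2)" using Suc.IH U3 by blast
            then show ?thesis by (rule givens[OF U2 km(1) m km(2) cs])
          qed
          then have "P U1" unfolding U2_def by (rule phase[OF U1 m z2(1)])
          then show "P U" unfolding U1_def by (rule phase[OF U km(1) z1(1)])
        qed
      qed
    qed
    show ?case
    proof (intro ballI impI)
      fix U assume U: "U \<in> unitary_group N" "Fix k U"
      show "P U" using elim[of "max (Suc k) N"] U by auto
    qed
  qed
  show "P U" using main[of 0] U by (auto simp: Fix_def)
qed

type_synonym gauss_coords = "nat \<times> nat \<times> bool \<Rightarrow> real"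

text \<open>
  The coordinates \<open>(a, j, False)\<close> and \<open>(a, j, True)\<close> are the real and imaginary part of the entry \<open>(a, j)\<close>
  of an infinite complex matrix. Its entries have variance 2 under \<open>gauss_prod\<close>.
\<close>

definition gauss_cplx :: "gauss_coords \<Rightarrow> nat \<Rightarrow> nat \<Rightarrow> complex" where
  "gauss_cplx w a j = Complex (w (a, j, False)) (w (a, j, True))"

text \<open>
  Multiplication from the right of the top-left \<open>K \<times> N\<close> block by \<open>U\<close>; all other entries are kept.
\<close>

definition unitary_act :: "nat \<Rightarrow> nat \<Rightarrow> complex mat \<Rightarrow> gauss_coords \<Rightarrow> gauss_coords" where
  "unitary_act K N U w = (\<lambda>(a, j, b).
     if a < K \<and> j < N
     then (if b then Im else Re) (\<Sum>l<N. gauss_cplx w a l * U $$ (l, j))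
     else w (a, j, b))"

lemma gauss_cplx_unitary_act:
  "gauss_cplx (unitary_act K N U w) a j =
    (if a < K \<and> j < N then \<Sum>l<N. gauss_cplx w a l * U $$ (l, j) else gauss_cplx w a j)"
  unfolding gauss_cplx_def[of "unitary_act K N U w"]
  by (auto simp: unitary_act_def gauss_cplx_def[of w a j] complex_eq_iff)

lemma gauss_cplx_eqI:
  assumes "\<And>a j. gauss_cplx w a j = gauss_cplx w' a j"
  shows "w = w'"
proof
  fix p :: "nat \<times> nat \<times> bool"
  obtain a j b where p: "p = (a, j, b)" by (cases p)
  show "w p = w' p" using assms[of a j] by (cases b) (auto simp: p gauss_cplx_def)
qed

lemma unitary_act_mult:
  assumes "U \<in> carrier_mat N N" "V \<in> carrier_mat N N"
  shows "unitary_act K N (U * V) w = unitary_act K N V (unitary_act K N U w)"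
proof (rule gauss_cplx_eqI)
  fix a j
  show "gauss_cplx (unitary_act K N (U * V) w) a j = gauss_cplx (unitary_act K N V (unitary_act K N U w)) a j"
  proof (cases "a < K \<and> j < N")
    case False
    then show ?thesis unfolding gauss_cplx_unitary_act by auto
  next
    case True
    have "(\<Sum>l<N. gauss_cplx w a l * (U * V) $$ (l, j))
        = (\<Sum>l<N. \<Sum>m<N. gauss_cplx w a l * (U $$ (l, m) * V $$ (m, j)))"
      unfolding sum_distrib_left[symmetric]
      by (intro sum.cong refl arg_cong2[where f="(*)"] trans[OF mat_mult_index]) (use assms True in auto)
    also have "\<dots> = (\<Sum>m<N. \<Sum>l<N. gauss_cplx w a l * (U $$ (l, m) * V $$ (m, j)))"
      by (rule sum.swap)
    also have "\<dots> = (\<Sum>m<N. gauss_cplx (unitary_act K N U w) a m * V $$ (m, j))"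
      by (rule sum.cong) (use True in \<open>auto simp: gauss_cplx_unitary_act sum_distrib_right mult.assoc\<close>)
    finally show ?thesis using True by (simp add: gauss_cplx_unitary_act[of K N _ _ a j])
  qed
qed

lemma measurable_gauss_cplx[measurable]:
  "(\<lambda>w. gauss_cplx w a j) \<in> borel_measurable gauss_prod"
  unfolding gauss_cplx_def Complex_eq by measurable

lemma measurable_unitary_act[measurable]: "unitary_act K N U \<in> measurable gauss_prod gauss_prod"
proof (rule measurable_gauss_prodI)
  fix p :: "nat \<times> nat \<times> bool"
  obtain a j b where p: "p = (a, j, b)" by (cases p)
  show "(\<lambda>w. unitary_act K N U w p) \<in> borel_measurable gauss_prod"
    unfolding p unitary_act_def by (cases "a < K \<and> j < N"; cases b) simp_all
qed

text \<open>
  Multiplication by \<open>U\<close> preserves the law of the block. Stating this for the measure-preserving map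
  \<open>unitary_act\<close> makes it stable under products.
\<close>

definition gauss_invariant :: "nat \<Rightarrow> nat \<Rightarrow> complex mat \<Rightarrow> bool" where
  "gauss_invariant K N U \<longleftrightarrow> (\<forall>f\<in>borel_measurable gauss_prod.
     (\<integral>\<^sup>+w. f (unitary_act K N U w) \<partial>gauss_prod) = (\<integral>\<^sup>+w. f w \<partial>gauss_prod))"

lemma gauss_invariantD:
  "gauss_invariant K N U \<Longrightarrow> f \<in> borel_measurable gauss_prod \<Longrightarrow>
    (\<integral>\<^sup>+w. f (unitary_act K N U w) \<partial>gauss_prod) = (\<integral>\<^sup>+w. f w \<partial>gauss_prod)"
  unfolding gauss_invariant_def by blast

lemma gauss_invariant_mult:
  assumes "gauss_invariant K N U" "gauss_invariant K N V" "U \<in> carrier_mat N N" "V \<in> carrier_mat N N"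
  shows "gauss_invariant K N (U * V)"
  unfolding gauss_invariant_def
proof
  fix f :: "gauss_coords \<Rightarrow> ennreal" assume f: "f \<in> borel_measurable gauss_prod"
  have "(\<lambda>w. f (unitary_act K N V w)) \<in> borel_measurable gauss_prod"
    by (rule measurable_compose[OF measurable_unitary_act f])
  then have "(\<integral>\<^sup>+w. f (unitary_act K N V (unitary_act K N U w)) \<partial>gauss_prod)
      = (\<integral>\<^sup>+w. f (unitary_act K N V w) \<partial>gauss_prod)"
    by (rule gauss_invariantD[OF assms(1)])
  then show "(\<integral>\<^sup>+w. f (unitary_act K N (U * V) w) \<partial>gauss_prod) = (\<integral>\<^sup>+w. f w \<partial>gauss_prod)"
    unfolding unitary_act_mult[OF assms(3,4)] using assms(2) f by (simp add: gauss_invariant_def)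
qed

text \<open>
  The action on \<open>K\<close> rows is built up one row at a time.
\<close>

lemma gauss_invariant_rowwise:
  assumes step: "\<And>a. T a \<in> measurable gauss_prod gauss_prod"
    and inv: "\<And>a f. f \<in> borel_measurable gauss_prod \<Longrightarrow>
      (\<integral>\<^sup>+w. f (T a w) \<partial>gauss_prod) = (\<integral>\<^sup>+w. f w \<partial>gauss_prod)"
    and row: "\<And>a w. unitary_act (Suc a) N U w = T a (unitary_act a N U w)"
  shows "gauss_invariant K N U"
proof (induction K)
  case 0
  have "unitary_act 0 N U w = w" for w by (auto simp: unitary_act_def)
  then show ?case by (simp add: gauss_invariant_def)
next
  case (Suc K)
  show ?case unfolding gauss_invariant_def row
  proof
    fix f :: "gauss_coords \<Rightarrow> ennreal" assume f: "f \<in> borel_measurable gauss_prod"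
    have "(\<lambda>w. f (T K w)) \<in> borel_measurable gauss_prod" by (rule measurable_compose[OF step f])
    from gauss_invariantD[OF Suc this]
    show "(\<integral>\<^sup>+w. f (T K (unitary_act K N U w)) \<partial>gauss_prod) = (\<integral>\<^sup>+w. f w \<partial>gauss_prod)"
      using inv[OF f] by simp
  qed
qed

lemma gauss_invariant_phase:
  assumes z: "cmod z = 1" and k: "k < N"
  shows "gauss_invariant K N (phase_mat N k z)"
proof (rule gauss_invariant_rowwise)
  let ?T = "\<lambda>a. rotate_pair (a, k, False) (a, k, True) (Re z) (Im z)"
  show "?T a \<in> measurable gauss_prod gauss_prod" for a by simp
  have "(Re z)\<^sup>2 + (Im z)\<^sup>2 = 1" using z cmod_power2[of z] by simp
  then show "(\<integral>\<^sup>+w. f (?T a w) \<partial>gauss_prod) = (\<integral>\<^sup>+w. f w \<partial>gauss_prod)"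
    if "f \<in> borel_measurable gauss_prod" for a f
    using that by (intro nn_integral_rotate_pair) auto
  fix a w
  have s: "(\<Sum>l<N. gauss_cplx w a l * phase_mat N k z $$ (l, j)) = gauss_cplx w a j * (if j = k then z else 1)"
    if "j < N" for a j
    using that by (simp add: phase_mat_def mult_delta_right cong: if_cong)
  show "unitary_act (Suc a) N (phase_mat N k z) w = ?T a (unitary_act a N (phase_mat N k z) w)"
  proof (rule gauss_cplx_eqI)
    fix a' j
    have R: "gauss_cplx (?T a v) a' j = (if a' = a \<and> j = k then gauss_cplx v a' j * z else gauss_cplx v a' j)" for v
      by (auto simp: rotate_pair_def gauss_cplx_def complex_eq_iff mult.commute)
    show "gauss_cplx (unitary_act (Suc a) N (phase_mat N k z) w) a' j
        = gauss_cplx (?T a (unitary_act a N (phase_mat N k z) w)) a' j"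
      unfolding R gauss_cplx_unitary_act using s k by (auto simp: less_Suc_eq)
  qed
qed

lemma gauss_invariant_givens:
  assumes cs: "c\<^sup>2 + s\<^sup>2 = 1" and km: "k < N" "m < N" "k \<noteq> m"
  shows "gauss_invariant K N (givens_mat N k m c s)"
proof (rule gauss_invariant_rowwise)
  let ?R = "\<lambda>b a. rotate_pair (a, k, b) (a, m, b) c s"
  let ?T = "\<lambda>a w. ?R True a (?R False a w)"
  show "?T a \<in> measurable gauss_prod gauss_prod" for a
    by (rule measurable_compose[OF measurable_rotate_pair measurable_rotate_pair])
  show "(\<integral>\<^sup>+w. f (?T a w) \<partial>gauss_prod) = (\<integral>\<^sup>+w. f w \<partial>gauss_prod)"
    if f: "f \<in> borel_measurable gauss_prod" for a f
  proof -
    have "(\<integral>\<^sup>+w. f (?T a w) \<partial>gauss_prod) = (\<integral>\<^sup>+w. f (?R True a w) \<partial>gauss_prod)"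
      by (rule nn_integral_rotate_pair[OF measurable_compose[OF measurable_rotate_pair f] _ cs])
         (use km in auto)
    also have "\<dots> = (\<integral>\<^sup>+w. f w \<partial>gauss_prod)"
      by (rule nn_integral_rotate_pair[OF f _ cs]) (use km in auto)
    finally show ?thesis .
  qed
  fix a w
  have s: "(\<Sum>l<N. gauss_cplx w a l * givens_mat N k m c s $$ (l, j)) =
      (if j = k then of_real c * gauss_cplx w a k - of_real s * gauss_cplx w a m
       else if j = m then of_real s * gauss_cplx w a k + of_real c * gauss_cplx w a m
       else gauss_cplx w a j)"
    if j: "j < N" for a j
  proof -
    have "(\<Sum>l<N. gauss_cplx w a l * givens_mat N k m c s $$ (l, j))
      = (\<Sum>l<N. (if j = k then (if l = k then complex_of_real c else if l = m then complex_of_real (- s) else 0)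
      else if j = m then (if l = k then complex_of_real s else if l = m then complex_of_real c else 0)
      else if l = j then 1 else 0) * gauss_cplx w a l)"
      by (rule sum.cong) (use j km in \<open>auto simp: givens_mat_def\<close>)
    also have "\<dots> = (if j = k then of_real c * gauss_cplx w a k - of_real s * gauss_cplx w a m
       else if j = m then of_real s * gauss_cplx w a k + of_real c * gauss_cplx w a m
       else gauss_cplx w a j)"
      using sum_two_deltas[OF km, where f="gauss_cplx w a"] j
      by (cases "j = k"; cases "j = m") (auto simp: mult_delta_left cong: if_cong)
    finally show ?thesis .
  qed
  show "unitary_act (Suc a) N (givens_mat N k m c s) w = ?T a (unitary_act a N (givens_mat N k m c s) w)"
  proof (rule gauss_cplx_eqI)
    fix a' j
    have R: "gauss_cplx (?T a v) a' j =
       (if a' = a \<and> j = k then of_real c * gauss_cplx v a k - of_real s * gauss_cplx v a m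
       else if a' = a \<and> j = m then of_real s * gauss_cplx v a k + of_real c * gauss_cplx v a m
       else gauss_cplx v a' j)" for v
      using km by (auto simp: rotate_pair_def gauss_cplx_def complex_eq_iff)
    show "gauss_cplx (unitary_act (Suc a) N (givens_mat N k m c s) w) a' j
        = gauss_cplx (?T a (unitary_act a N (givens_mat N k m c s) w)) a' j"
      unfolding R gauss_cplx_unitary_act using s km by (auto simp: less_Suc_eq)
  qed
qed

lemma gauss_invariant_unitary:
  assumes "U \<in> unitary_group N"
  shows "gauss_invariant K N U"
proof (rule unitary_elimination_induct[OF assms, where P="gauss_invariant K N"])
  show "gauss_invariant K N (1\<^sub>m N)"
  proof -
    have "unitary_act K N (1\<^sub>m N) w = w" for w
    proof (rule gauss_cplx_eqI)
      fix a j
      have "(\<Sum>l<N. gauss_cplx w a l * 1\<^sub>m N $$ (l, j)) = (\<Sum>l<N. if l = j then gauss_cplx w a l else 0)" if "j < N"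
        by (rule sum.cong) (use that in auto)
      then show "gauss_cplx (unitary_act K N (1\<^sub>m N) w) a j = gauss_cplx w a j"
        unfolding gauss_cplx_unitary_act by simp
    qed
    then show ?thesis by (simp add: gauss_invariant_def)
  qed
next
  fix U k z assume a: "U \<in> unitary_group N" "k < N" "cmod z = 1" "gauss_invariant K N (phase_mat N k z * U)"
  let ?R = "phase_mat N k z"
  have R: "?R \<in> unitary_group N" by (rule phase_mat_unitary[OF a(3)])
  have "gauss_invariant K N (mat_adjoint ?R)"
    unfolding phase_mat_adjoint by (rule gauss_invariant_phase) (use a in auto)
  then have "gauss_invariant K N (mat_adjoint ?R * (?R * U))"
    by (rule gauss_invariant_mult[OF _ a(4)]) (use unitary_groupD(1)[OF a(1)] in auto)
  then show "gauss_invariant K N U"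
    using unitary_group_cancel(2)[OF R] unitary_groupD(2)[OF a(1)] by simp
next
  fix U k m c s assume a: "U \<in> unitary_group N" "k < N" "m < N" "k \<noteq> m" "c\<^sup>2 + s\<^sup>2 = 1"
    "gauss_invariant K N (givens_mat N k m c s * U)"
  let ?R = "givens_mat N k m c s"
  have R: "?R \<in> unitary_group N" by (rule givens_mat_unitary[OF a(5,2,3,4)])
  have "gauss_invariant K N (mat_adjoint ?R)"
    unfolding givens_mat_adjoint[OF a(4)] by (rule gauss_invariant_givens) (use a in auto)
  then have "gauss_invariant K N (mat_adjoint ?R * (?R * U))"
    by (rule gauss_invariant_mult[OF _ a(6)]) (use unitary_groupD(1)[OF a(1)] in auto)
  then show "gauss_invariant K N U"
    using unitary_group_cancel(2)[OF R] unitary_groupD(2)[OF a(1)] by simp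
qed

section \<open>Invariance of the Haar measure\<close>

text \<open>
  The Borel space of the unitary group, as in the definition of \<open>is_haar_unitary\<close>.
\<close>

definition unitary_borel :: "nat \<Rightarrow> complex mat measure" where
  "unitary_borel N = restrict_space (mat_borel N) (unitary_group N)"

lemma space_unitary_borel[simp]: "space (unitary_borel N) = unitary_group N"
  by (auto simp: unitary_borel_def space_restrict_space unitary_group_def)

lemma measurable_unitary_borelI:
  assumes "f \<in> measurable M (mat_borel N)" "\<And>w. w \<in> space M \<Longrightarrow> f w \<in> unitary_group N"
  shows "f \<in> measurable M (unitary_borel N)"
  unfolding unitary_borel_def by (rule measurable_restrict_space2) (use assms in auto)

lemma measurable_unitary_borelD:
  assumes "f \<in> measurable M (unitary_borel N)"
  shows "f \<in> measurable M (mat_borel N)"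
proof -
  have "(\<lambda>x. x) \<in> measurable (unitary_borel N) (mat_borel N)"
    unfolding unitary_borel_def by (rule measurable_restrict_space1) simp
  from measurable_compose[OF assms this] show ?thesis .
qed

lemma measurable_unitary_mult:
  assumes f: "f \<in> measurable M (unitary_borel N)" and g: "g \<in> measurable M (unitary_borel N)"
  shows "(\<lambda>w. f w * g w) \<in> measurable M (unitary_borel N)"
proof (rule measurable_unitary_borelI)
  show "(\<lambda>w. f w * g w) \<in> measurable M (mat_borel N)"
    by (rule measurable_mat_mult[OF f[THEN measurable_unitary_borelD] g[THEN measurable_unitary_borelD]])
  show "f w * g w \<in> unitary_group N" if "w \<in> space M" for w
    using measurable_space[OF f that] measurable_space[OF g that]
    by (simp add: unitary_group_mult)
qed

lemma measurable_unitary_adjoint: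
  assumes f: "f \<in> measurable M (unitary_borel N)"
  shows "(\<lambda>w. mat_adjoint (f w)) \<in> measurable M (unitary_borel N)"
proof (rule measurable_unitary_borelI)
  show "(\<lambda>w. mat_adjoint (f w)) \<in> measurable M (mat_borel N)"
    by (rule measurable_mat_adjoint[OF f[THEN measurable_unitary_borelD]])
  show "mat_adjoint (f w) \<in> unitary_group N" if "w \<in> space M" for w
    using measurable_space[OF f that] by (simp add: unitary_group_adjoint)
qed

lemma is_haar_unitaryD:
  assumes "is_haar_unitary N \<mu>"
  shows "prob_space \<mu>" "sets \<mu> = sets (unitary_borel N)" "space \<mu> = unitary_group N"
    "\<And>V f. V \<in> unitary_group N \<Longrightarrow> f \<in> borel_measurable (unitary_borel N) \<Longrightarrow>
      (\<integral>\<^sup>+U. f (V * U) \<partial>\<mu>) = (\<integral>\<^sup>+U. f U \<partial>\<mu>)"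
proof -
  show "prob_space \<mu>" and s: "sets \<mu> = sets (unitary_borel N)"
    using assms by (auto simp: is_haar_unitary_def unitary_borel_def)
  show sp: "space \<mu> = unitary_group N" using sets_eq_imp_space_eq[OF s] by simp
  fix V and f :: "complex mat \<Rightarrow> ennreal"
  assume V: "V \<in> unitary_group N" and f: "f \<in> borel_measurable (unitary_borel N)"
  have m: "measurable \<mu> \<mu> = measurable (unitary_borel N) (unitary_borel N)"
    by (rule measurable_cong_sets[OF s s])
  have fm: "f \<in> borel_measurable \<mu>" using f measurable_cong_sets[OF s refl] by blast
  have "(\<lambda>U. V * U) \<in> measurable \<mu> \<mu>"
    unfolding m by (rule measurable_unitary_mult) (use V in auto)
  then have "(\<integral>\<^sup>+U. f (V * U) \<partial>\<mu>) = (\<integral>\<^sup>+U. f U \<partial>distr \<mu> \<mu> (\<lambda>U. V * U))"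
    using fm by (simp add: nn_integral_distr)
  also have "distr \<mu> \<mu> (\<lambda>U. V * U) = \<mu>" using assms V by (simp add: is_haar_unitary_def)
  finally show "(\<integral>\<^sup>+U. f (V * U) \<partial>\<mu>) = (\<integral>\<^sup>+U. f U \<partial>\<mu>)" .
qed

text \<open>
  Integrate \<open>f (U\<^sup>\<dagger> W)\<close> over both variables. The integral over \<open>W\<close> first gives the integral of \<open>f\<close>; the
  integral over \<open>U\<close> first, with \<open>U\<^sup>\<dagger> W = (W\<^sup>\<dagger> U)\<^sup>\<dagger>\<close>, gives the integral of \<open>f\<close> at the adjoint.
\<close>

lemma is_haar_unitary_adjoint:
  assumes h: "is_haar_unitary N \<mu>" and f: "f \<in> borel_measurable (unitary_borel N)"
  shows "(\<integral>\<^sup>+U. f (mat_adjoint U) \<partial>\<mu>) = (\<integral>\<^sup>+U. f U \<partial>\<mu>)"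
proof -
  note hd = is_haar_unitaryD[OF h]
  interpret prob_space \<mu> by (rule hd(1))
  interpret P: pair_sigma_finite \<mu> \<mu> ..
  have sp: "sets (\<mu> \<Otimes>\<^sub>M \<mu>) = sets (unitary_borel N \<Otimes>\<^sub>M unitary_borel N)"
    by (intro sets_pair_measure_cong hd(2))
  have fst: "fst \<in> measurable (unitary_borel N \<Otimes>\<^sub>M unitary_borel N) (unitary_borel N)"
    and snd: "snd \<in> measurable (unitary_borel N \<Otimes>\<^sub>M unitary_borel N) (unitary_borel N)"
    by auto
  have "(\<lambda>p. mat_adjoint (fst p) * snd p) \<in> measurable (unitary_borel N \<Otimes>\<^sub>M unitary_borel N) (unitary_borel N)"
    by (intro measurable_unitary_mult measurable_unitary_adjoint fst snd)
  from measurable_compose[OF this f]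
  have m: "(\<lambda>p. f (mat_adjoint (fst p) * snd p)) \<in> borel_measurable (\<mu> \<Otimes>\<^sub>M \<mu>)"
    using measurable_cong_sets[OF sp refl] by blast
  have "(\<integral>\<^sup>+U. f U \<partial>\<mu>) = (\<integral>\<^sup>+U. \<integral>\<^sup>+W. f (mat_adjoint U * W) \<partial>\<mu> \<partial>\<mu>)"
  proof -
    have "(\<integral>\<^sup>+U. \<integral>\<^sup>+W. f (mat_adjoint U * W) \<partial>\<mu> \<partial>\<mu>) = (\<integral>\<^sup>+U. (\<integral>\<^sup>+W. f W \<partial>\<mu>) \<partial>\<mu>)"
      by (rule nn_integral_cong) (use hd(3,4) f unitary_group_adjoint in auto)
    then show ?thesis by (simp add: emeasure_space_1)
  qed
  also have "\<dots> = (\<integral>\<^sup>+W. \<integral>\<^sup>+U. f (mat_adjoint U * W) \<partial>\<mu> \<partial>\<mu>)"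
    using P.Fubini'[of "\<lambda>U W. f (mat_adjoint U * W)"] m by (simp add: case_prod_unfold)
  also have "\<dots> = (\<integral>\<^sup>+W. (\<integral>\<^sup>+U. f (mat_adjoint U) \<partial>\<mu>) \<partial>\<mu>)"
  proof (rule nn_integral_cong)
    fix W assume "W \<in> space \<mu>"
    then have W: "W \<in> unitary_group N" using hd(3) by simp
    have "(\<lambda>U. f (mat_adjoint U)) \<in> borel_measurable (unitary_borel N)"
      by (intro measurable_compose[OF measurable_unitary_adjoint f]) auto
    from hd(4)[OF unitary_group_adjoint[OF W] this]
    have "(\<integral>\<^sup>+U. f (mat_adjoint (mat_adjoint W * U)) \<partial>\<mu>) = (\<integral>\<^sup>+U. f (mat_adjoint U) \<partial>\<mu>)" .
    also have "(\<integral>\<^sup>+U. f (mat_adjoint (mat_adjoint W * U)) \<partial>\<mu>) = (\<integral>\<^sup>+U. f (mat_adjoint U * W) \<partial>\<mu>)"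
      by (rule nn_integral_cong) (use hd(3) W in \<open>auto simp: mat_adjoint_mult unitary_groupD(2)\<close>)
    finally show "(\<integral>\<^sup>+U. f (mat_adjoint U * W) \<partial>\<mu>) = (\<integral>\<^sup>+U. f (mat_adjoint U) \<partial>\<mu>)" .
  qed
  finally show ?thesis by (simp add: emeasure_space_1)
qed

lemma is_haar_unitary_right:
  assumes h: "is_haar_unitary N \<mu>" and f: "f \<in> borel_measurable (unitary_borel N)"
    and V: "V \<in> unitary_group N"
  shows "(\<integral>\<^sup>+U. f (U * V) \<partial>\<mu>) = (\<integral>\<^sup>+U. f U \<partial>\<mu>)"
proof -
  note hd = is_haar_unitaryD[OF h]
  have fV: "(\<lambda>U. f (U * V)) \<in> borel_measurable (unitary_borel N)"
    by (intro measurable_compose[OF measurable_unitary_mult f]) (use V in auto)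
  have fa: "(\<lambda>U. f (mat_adjoint U)) \<in> borel_measurable (unitary_borel N)"
    by (intro measurable_compose[OF measurable_unitary_adjoint f]) auto
  have "(\<integral>\<^sup>+U. f (U * V) \<partial>\<mu>) = (\<integral>\<^sup>+U. f (mat_adjoint U * V) \<partial>\<mu>)"
    using is_haar_unitary_adjoint[OF h fV] by simp
  also have "\<dots> = (\<integral>\<^sup>+U. f (mat_adjoint (mat_adjoint V * U)) \<partial>\<mu>)"
    by (rule nn_integral_cong) (use hd(3) V in \<open>auto simp: mat_adjoint_mult unitary_groupD(2)\<close>)
  also have "\<dots> = (\<integral>\<^sup>+U. f (mat_adjoint U) \<partial>\<mu>)"
    by (rule hd(4)[OF unitary_group_adjoint[OF V] fa])
  also have "\<dots> = (\<integral>\<^sup>+U. f U \<partial>\<mu>)" by (rule is_haar_unitary_adjoint[OF h f])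
  finally show ?thesis .
qed

section \<open>The Gram--Schmidt process and the existence of the Haar measure\<close>

text \<open>
  The rows produced by the Gram--Schmidt process from the rows of \<open>g\<close>, in dimension \<open>N\<close>. A vanishing
  residual produces a zero row.
\<close>

fun gs_row :: "nat \<Rightarrow> (nat \<Rightarrow> nat \<Rightarrow> complex) \<Rightarrow> nat \<Rightarrow> nat \<Rightarrow> complex" where
  "gs_row N g k = (let r = (\<lambda>i. g k i - (\<Sum>j<k. (\<Sum>l<N. g k l * cnj (gs_row N g j l)) * gs_row N g j i))
     in (\<lambda>i. r i / complex_of_real (sqrt (\<Sum>l<N. (cmod (r l))\<^sup>2))))"

declare gs_row.simps[simp del]

text \<open>
  The residual of the row \<open>k\<close>, before normalisation.
\<close>

definition gs_res :: "nat \<Rightarrow> (nat \<Rightarrow> nat \<Rightarrow> complex) \<Rightarrow> nat \<Rightarrow> nat \<Rightarrow> complex" where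
  "gs_res N g k i = g k i - (\<Sum>j<k. (\<Sum>l<N. g k l * cnj (gs_row N g j l)) * gs_row N g j i)"

text \<open>
  The Euclidean norm of the residual, by which \<open>gs_row\<close> divides.
\<close>

definition gs_norm :: "nat \<Rightarrow> (nat \<Rightarrow> nat \<Rightarrow> complex) \<Rightarrow> nat \<Rightarrow> real" where
  "gs_norm N g k = sqrt (\<Sum>l<N. (cmod (gs_res N g k l))\<^sup>2)"

lemma gs_row_eq: "gs_row N g k i = gs_res N g k i / complex_of_real (gs_norm N g k)"
  by (subst gs_row.simps) (simp add: Let_def gs_res_def gs_norm_def)

lemma gs_row_orthonormal:
  assumes "\<And>k. k < K \<Longrightarrow> gs_norm N g k \<noteq> 0"
  shows "orthonormal_rows K N (gs_row N g)"
  using assms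
proof (induction K)
  case 0
  then show ?case by (simp add: orthonormal_rows_def)
next
  case (Suc K)
  let ?u = "gs_row N g"
  have IH: "orthonormal_rows K N ?u" using Suc by simp
  have nz: "gs_norm N g K \<noteq> 0" using Suc.prems by simp
  have orth: "(\<Sum>l<N. gs_res N g K l * cnj (?u j l)) = 0" if j: "j < K" for j
  proof -
    have "(\<Sum>l<N. gs_res N g K l * cnj (?u j l))
      = (\<Sum>l<N. g K l * cnj (?u j l)) - (\<Sum>l<N. \<Sum>m<K. (\<Sum>l<N. g K l * cnj (?u m l)) * (?u m l * cnj (?u j l)))"
      by (simp add: gs_res_def left_diff_distrib sum_subtractf sum_distrib_right mult.assoc)
    also have "(\<Sum>l<N. \<Sum>m<K. (\<Sum>l<N. g K l * cnj (?u m l)) * (?u m l * cnj (?u j l)))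
      = (\<Sum>m<K. (\<Sum>l<N. g K l * cnj (?u m l)) * (\<Sum>l<N. ?u m l * cnj (?u j l)))"
      by (subst sum.swap) (simp add: sum_distrib_left)
    also have "\<dots> = (\<Sum>m<K. if m = j then (\<Sum>l<N. g K l * cnj (?u m l)) else 0)"
      by (rule sum.cong) (use IH j in \<open>auto simp: orthonormal_rows_def\<close>)
    finally show ?thesis using j by simp
  qed
  have new: "(\<Sum>l<N. ?u K l * cnj (?u j l)) = 0" if "j < K" for j
    unfolding gs_row_eq[of N g K] using orth[OF that]
    by (simp add: sum_divide_distrib[symmetric])
  have new': "(\<Sum>l<N. ?u j l * cnj (?u K l)) = 0" if "j < K" for j
    using arg_cong[OF new[OF that], of cnj] by (simp add: mult.commute)
  have "(\<Sum>l<N. ?u K l * cnj (?u K l)) = complex_of_real (\<Sum>l<N. (cmod (gs_res N g K l))\<^sup>2 / (gs_norm N g K)\<^sup>2)"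
    unfolding of_real_sum
  proof (rule sum.cong)
    fix l
    show "?u K l * cnj (?u K l) = complex_of_real ((cmod (gs_res N g K l))\<^sup>2 / (gs_norm N g K)\<^sup>2)"
      unfolding gs_row_eq[of N g K] of_real_divide complex_norm_square by (simp add: power2_eq_square)
  qed simp
  also have "(\<Sum>l<N. (cmod (gs_res N g K l))\<^sup>2 / (gs_norm N g K)\<^sup>2) = 1"
  proof -
    have eq: "(\<Sum>l<N. (cmod (gs_res N g K l))\<^sup>2) = (gs_norm N g K)\<^sup>2"
      unfolding gs_norm_def by (simp add: sum_nonneg)
    show ?thesis unfolding sum_divide_distrib[symmetric] eq using nz by simp
  qed
  finally have "(\<Sum>l<N. ?u K l * cnj (?u K l)) = 1" by simp
  then show ?case using IH new new' by (auto simp: orthonormal_rows_def less_Suc_eq)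
qed

text \<open>
  Multiplication of a row vector by a matrix from the right.
\<close>

definition row_act :: "nat \<Rightarrow> complex mat \<Rightarrow> (nat \<Rightarrow> complex) \<Rightarrow> nat \<Rightarrow> complex" where
  "row_act N U x i = (\<Sum>l<N. x l * U $$ (l, i))"

lemma row_act_inner:
  assumes U: "U \<in> unitary_group N"
  shows "(\<Sum>i<N. row_act N U x i * cnj (row_act N U y i)) = (\<Sum>l<N. x l * cnj (y l))"
proof -
  note Ud = unitary_groupD[OF U]
  have "(\<Sum>i<N. row_act N U x i * cnj (row_act N U y i))
      = (\<Sum>i<N. \<Sum>l<N. \<Sum>m<N. x l * cnj (y m) * (U $$ (l, i) * cnj (U $$ (m, i))))"
    by (simp add: row_act_def sum_product mult_ac)
  also have "\<dots> = (\<Sum>l<N. \<Sum>i<N. \<Sum>m<N. x l * cnj (y m) * (U $$ (l, i) * cnj (U $$ (m, i))))"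
    by (rule sum.swap)
  also have "\<dots> = (\<Sum>l<N. \<Sum>m<N. \<Sum>i<N. x l * cnj (y m) * (U $$ (l, i) * cnj (U $$ (m, i))))"
    by (intro sum.cong refl sum.swap)
  also have "\<dots> = (\<Sum>l<N. \<Sum>m<N. x l * cnj (y m) * (\<Sum>i<N. U $$ (l, i) * cnj (U $$ (m, i))))"
    by (simp add: sum_distrib_left)
  also have "\<dots> = (\<Sum>l<N. \<Sum>m<N. if m = l then x l * cnj (y m) else 0)"
  proof (intro sum.cong refl)
    fix l m assume lm: "l \<in> {..<N}" "m \<in> {..<N}"
    have "(U * mat_adjoint U) $$ (l, m) = (\<Sum>i<N. U $$ (l, i) * cnj (U $$ (m, i)))"
      by (rule mat_mult_adjoint_index) (use Ud lm in auto)
    then have "(\<Sum>i<N. U $$ (l, i) * cnj (U $$ (m, i))) = (if l = m then 1 else 0)"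
      using Ud lm by simp
    then show "x l * cnj (y m) * (\<Sum>i<N. U $$ (l, i) * cnj (U $$ (m, i))) = (if m = l then x l * cnj (y m) else 0)"
      by simp
  qed
  also have "\<dots> = (\<Sum>l<N. x l * cnj (y l))" by simp
  finally show ?thesis .
qed

text \<open>
  No linear independence is needed: a vanishing residual is mapped to a vanishing residual, and division
  by its norm gives the zero row on both sides.
\<close>

lemma gs_row_equivariant:
  assumes U: "U \<in> unitary_group N" and g': "\<And>k i. k < K \<Longrightarrow> i < N \<Longrightarrow> g' k i = row_act N U (g k) i"
  shows "k < K \<Longrightarrow> i < N \<Longrightarrow> gs_row N g' k i = row_act N U (gs_row N g k) i"
proof (induction k arbitrary: i rule: less_induct)
  case (less k)
  have IH: "gs_row N g' j i = row_act N U (gs_row N g j) i" if "j < k" "i < N" for j i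
    using less that by simp
  have res: "gs_res N g' k i = row_act N U (gs_res N g k) i" if i: "i < N" for i
  proof -
    have inner: "(\<Sum>l<N. g' k l * cnj (gs_row N g' j l)) = (\<Sum>l<N. g k l * cnj (gs_row N g j l))" if "j < k" for j
    proof -
      have "(\<Sum>l<N. g' k l * cnj (gs_row N g' j l))
          = (\<Sum>l<N. row_act N U (g k) l * cnj (row_act N U (gs_row N g j) l))"
        by (intro sum.cong refl) (simp add: IH[OF that] g'[OF less.prems(1)])
      then show ?thesis unfolding row_act_inner[OF U] .
    qed
    have "gs_res N g' k i = row_act N U (g k) i
        - (\<Sum>j<k. (\<Sum>l<N. g k l * cnj (gs_row N g j l)) * row_act N U (gs_row N g j) i)"
      unfolding gs_res_def g'[OF less.prems(1) i]
      by (intro arg_cong2[where f="(-)"] sum.cong refl, simp only: lessThan_iff inner,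
          simp only: IH[OF _ i])
    also have "\<dots> = row_act N U (gs_res N g k) i"
    proof -
      have "(\<Sum>j<k. (\<Sum>l<N. g k l * cnj (gs_row N g j l)) * row_act N U (gs_row N g j) i)
        = (\<Sum>j<k. \<Sum>m<N. (\<Sum>l<N. g k l * cnj (gs_row N g j l)) * gs_row N g j m * U $$ (m, i))"
        by (simp add: row_act_def sum_distrib_left mult.assoc)
      also have "\<dots> = (\<Sum>m<N. (\<Sum>j<k. (\<Sum>l<N. g k l * cnj (gs_row N g j l)) * gs_row N g j m) * U $$ (m, i))"
        by (subst sum.swap) (simp only: sum_distrib_right)
      finally show ?thesis
        by (simp add: row_act_def gs_res_def left_diff_distrib sum_subtractf)
    qed
    finally show ?thesis .
  qed
  have "complex_of_real (\<Sum>l<N. (cmod (gs_res N g' k l))\<^sup>2) = (\<Sum>l<N. row_act N U (gs_res N g k) l * cnj (row_act N U (gs_res N g k) l))"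
    unfolding of_real_sum complex_norm_square by (rule sum.cong) (use res in auto)
  also have "\<dots> = complex_of_real (\<Sum>l<N. (cmod (gs_res N g k l))\<^sup>2)"
    unfolding row_act_inner[OF U] of_real_sum complex_norm_square ..
  finally have "gs_norm N g' k = gs_norm N g k"
    unfolding gs_norm_def of_real_eq_iff by simp
  then show ?case
    unfolding gs_row_eq res[OF less.prems(2)] by (simp add: row_act_def gs_row_eq sum_divide_distrib)
qed

text \<open>
  The Gram--Schmidt process applied to the rows of the \<open>N \<times> N\<close> Gaussian matrix.
\<close>

definition gs_mat :: "nat \<Rightarrow> gauss_coords \<Rightarrow> complex mat" where
  "gs_mat N w = Matrix.mat N N (\<lambda>(k, i). gs_row N (gauss_cplx w) k i)"

lemma gs_mat_dim[simp]: "gs_mat N w \<in> carrier_mat N N" "dim_row (gs_mat N w) = N" "dim_col (gs_mat N w) = N"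
  by (auto simp: gs_mat_def)

lemma gs_mat_unitary_act:
  assumes U: "U \<in> unitary_group N"
  shows "gs_mat N (unitary_act N N U w) = gs_mat N w * U"
proof (rule eq_matI)
  note Ud = unitary_groupD[OF U]
  fix k i assume "k < dim_row (gs_mat N w * U)" "i < dim_col (gs_mat N w * U)"
  then have ki: "k < N" "i < N" using Ud by auto
  have "gs_mat N (unitary_act N N U w) $$ (k, i) = row_act N U (gs_row N (gauss_cplx w) k) i"
    using gs_row_equivariant[OF U, of N "gauss_cplx (unitary_act N N U w)" "gauss_cplx w" k i] ki
    by (simp add: gs_mat_def gauss_cplx_unitary_act row_act_def)
  also have "\<dots> = (gs_mat N w * U) $$ (k, i)"
    using ki Ud by (subst mat_mult_index) (auto simp: row_act_def gs_mat_def)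
  finally show "gs_mat N (unitary_act N N U w) $$ (k, i) = (gs_mat N w * U) $$ (k, i)" .
qed (use unitary_groupD[OF U] in auto)

lemma measurable_gs_row: "(\<lambda>w. gs_row N (gauss_cplx w) k i) \<in> borel_measurable gauss_prod"
proof (induction k arbitrary: i rule: less_induct)
  case (less k)
  have cnj: "cnj \<in> borel_measurable borel"
    by (intro borel_measurable_continuous_onI continuous_intros)
  have IH: "(\<lambda>w. gs_row N (gauss_cplx w) j i) \<in> borel_measurable gauss_prod" if "j \<in> {..<k}" for j i
    using less that by auto
  have cIH: "(\<lambda>w. cnj (gs_row N (gauss_cplx w) j i)) \<in> borel_measurable gauss_prod" if "j \<in> {..<k}" for j i
    by (rule measurable_compose[OF IH[OF that] cnj])
  have res[measurable]: "(\<lambda>w. gs_res N (gauss_cplx w) k i) \<in> borel_measurable gauss_prod" for i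
    unfolding gs_res_def
    by (intro borel_measurable_diff borel_measurable_sum borel_measurable_times IH cIH measurable_gauss_cplx)
  show ?case unfolding gs_row_eq gs_norm_def by measurable
qed

lemma measurable_gs_mat: "gs_mat N \<in> measurable gauss_prod (mat_borel N)"
  by (rule measurable_mat_borelI) (auto simp: gs_mat_def measurable_gs_row)

text \<open>
  The Gram--Schmidt process is continuous at the identity matrix.
\<close>

lemma tendsto_gs_row:
  fixes g :: "nat \<Rightarrow> nat \<Rightarrow> nat \<Rightarrow> complex"
  assumes "\<And>k i. k < N \<Longrightarrow> i < N \<Longrightarrow> (\<lambda>n. g n k i) \<longlonglongrightarrow> (if k = i then 1 else 0)"
  shows "k < N \<Longrightarrow> (\<lambda>n. gs_norm N (g n) k) \<longlonglongrightarrow> 1 \<and> (\<forall>i<N. (\<lambda>n. gs_row N (g n) k i) \<longlonglongrightarrow> (if k = i then 1 else 0))"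
proof (induction k rule: less_induct)
  case (less k)
  let ?d = "\<lambda>k i. if k = i then 1 else 0 :: complex"
  have IH: "(\<lambda>n. gs_row N (g n) j i) \<longlonglongrightarrow> ?d j i" if "j < k" "i < N" for j i
    using less that by simp
  have res: "(\<lambda>n. gs_res N (g n) k i) \<longlonglongrightarrow> ?d k i" if i: "i < N" for i
  proof -
    have "(\<lambda>n. gs_res N (g n) k i) \<longlonglongrightarrow> ?d k i - (\<Sum>j<k. (\<Sum>l<N. ?d k l * cnj (?d j l)) * ?d j i)"
      unfolding gs_res_def
      by (intro tendsto_diff tendsto_sum tendsto_mult tendsto_cnj assms IH) (use less.prems i in auto)
    moreover have "(\<Sum>l<N. ?d k l * cnj (?d j l)) = 0" if "j < k" for j
      by (rule sum.neutral) (use that in auto)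
    ultimately show ?thesis by simp
  qed
  have "(\<lambda>n. gs_norm N (g n) k) \<longlonglongrightarrow> sqrt (\<Sum>l<N. (cmod (?d k l))\<^sup>2)"
    unfolding gs_norm_def by (intro tendsto_intros res) auto
  also have "(\<Sum>l<N. (cmod (?d k l))\<^sup>2) = (\<Sum>l<N. if l = k then 1 else 0)"
    by (rule sum.cong) auto
  finally have norm: "(\<lambda>n. gs_norm N (g n) k) \<longlonglongrightarrow> 1" using less.prems by simp
  have "(\<lambda>n. gs_row N (g n) k i) \<longlonglongrightarrow> ?d k i / complex_of_real 1" if "i < N" for i
    unfolding gs_row_eq by (intro tendsto_divide tendsto_of_real norm res[OF that]) simp
  then show ?case using norm by simp
qed

lemma std_normal_interval_pos:
  assumes "a < b"
  shows "emeasure std_normal {a<..<b} > 0"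
proof (rule ccontr)
  assume "\<not> emeasure std_normal {a<..<b} > 0"
  then have "emeasure std_normal {a<..<b} = 0" by simp
  then have "(\<integral>\<^sup>+t. ennreal (std_normal_density t) * indicator {a<..<b} t \<partial>lborel) = 0"
    by (simp add: emeasure_density)
  then have "AE t in lborel. ennreal (std_normal_density t) * indicator {a<..<b} t = 0"
    by (subst (asm) nn_integral_0_iff_AE) auto
  then have "AE t in lborel. t \<notin> {a<..<b}"
  proof (rule AE_mp[OF _ AE_I2], intro impI)
    fix t :: real assume "ennreal (std_normal_density t) * indicator {a<..<b} t = 0"
    moreover have "std_normal_density t > 0" by (rule normal_density_pos) simp
    ultimately show "t \<notin> {a<..<b}" by (auto simp: indicator_def split: if_splits)
  qed
  then have "emeasure lborel {a<..<b} = 0"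
    by (subst (asm) AE_iff_measurable[where N="{a<..<b}"]) auto
  then show False using assms by simp
qed

text \<open>
  The event that the Gram--Schmidt process succeeds.
\<close>

definition gs_good :: "nat \<Rightarrow> gauss_coords set" where
  "gs_good N = {w. gs_mat N w \<in> unitary_group N}"

lemma gs_good_sets: "gs_good N \<in> sets gauss_prod"
proof -
  have "gs_good N = {w \<in> space gauss_prod. \<forall>i\<in>{..<N}. \<forall>j\<in>{..<N}.
      (gs_mat N w * mat_adjoint (gs_mat N w)) $$ (i, j) = (1\<^sub>m N :: complex mat) $$ (i, j)}"
  proof -
    have "gs_mat N w \<in> unitary_group N \<longleftrightarrow> gs_mat N w * mat_adjoint (gs_mat N w) = 1\<^sub>m N" for w
      using unitary_groupI[of "gs_mat N w" N] unitary_groupD(4)[of "gs_mat N w" N] by auto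
    moreover have "gs_mat N w * mat_adjoint (gs_mat N w) = 1\<^sub>m N \<longleftrightarrow>
      (\<forall>i\<in>{..<N}. \<forall>j\<in>{..<N}. (gs_mat N w * mat_adjoint (gs_mat N w)) $$ (i, j) = (1\<^sub>m N :: complex mat) $$ (i, j))" for w
      by (auto simp del: index_mult_mat(1) intro!: eq_matI)
    ultimately show ?thesis by (simp add: gs_good_def del: index_mult_mat(1))
  qed
  also have "\<dots> \<in> sets gauss_prod"
  proof (intro sets.sets_Collect_finite_All)
    fix i j assume "i \<in> {..<N}" "j \<in> {..<N}"
    then have [measurable]: "(\<lambda>w. (gs_mat N w * mat_adjoint (gs_mat N w)) $$ (i, j)) \<in> borel_measurable gauss_prod"
      by (intro measurable_mat_entry[where N=N] measurable_mat_mult measurable_mat_adjoint measurable_gs_mat) auto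
    show "{w \<in> space gauss_prod. (gs_mat N w * mat_adjoint (gs_mat N w)) $$ (i, j) = (1\<^sub>m N :: complex mat) $$ (i, j)} \<in> sets gauss_prod"
      by measurable
  qed auto
  finally show ?thesis .
qed

text \<open>
  By continuity the process succeeds on a small box around the identity matrix, and boxes have
  positive probability. Almost sure success is not needed, since the Haar measure is obtained by
  conditioning on \<open>gs_good\<close>.
\<close>

lemma gs_good_pos: "emeasure gauss_prod (gs_good N) > 0"
proof -
  define \<delta> :: "gauss_coords" where "\<delta> = (\<lambda>(k, i, b). if k = i \<and> \<not> b then 1 else 0)"
  define J where "J = {..<N} \<times> {..<N} \<times> (UNIV :: bool set)"
  define box where "box = (\<lambda>n. {w. \<forall>p\<in>J. w p \<in> {\<delta> p - 1 / real (Suc n)<..<\<delta> p + 1 / real (Suc n)}})"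
  have "\<exists>n. box n \<subseteq> gs_good N"
  proof (rule ccontr)
    \<comment> \<open>otherwise the boxes contain a sequence of failures that tends to the identity\<close>
    assume "\<nexists>n. box n \<subseteq> gs_good N"
    then have "\<forall>n. \<exists>w. w \<in> box n \<and> w \<notin> gs_good N" by blast
    then obtain w where w: "\<And>n. w n \<in> box n" "\<And>n. w n \<notin> gs_good N" by metis
    have coord: "(\<lambda>n. w n p) \<longlonglongrightarrow> \<delta> p" if "p \<in> J" for p
    proof -
      have "(\<lambda>n. w n p - \<delta> p) \<longlonglongrightarrow> 0"
      proof (rule Lim_null_comparison[OF always_eventually LIMSEQ_inverse_real_of_nat], rule allI)
        fix n
        have "w n p \<in> {\<delta> p - 1 / real (Suc n)<..<\<delta> p + 1 / real (Suc n)}"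
          using w(1)[of n] that unfolding box_def by blast
        then show "norm (w n p - \<delta> p) \<le> inverse (real (Suc n))"
          by (auto simp: abs_le_iff inverse_eq_divide)
      qed
      then show ?thesis by (simp add: LIM_zero_iff)
    qed
    have "(\<lambda>n. gauss_cplx (w n) k i) \<longlonglongrightarrow> (if k = i then 1 else 0)" if "k < N" "i < N" for k i
    proof -
      have "(\<lambda>n. gauss_cplx (w n) k i) \<longlonglongrightarrow> Complex (\<delta> (k, i, False)) (\<delta> (k, i, True))"
        unfolding gauss_cplx_def by (intro tendsto_Complex coord) (use that in \<open>auto simp: J_def\<close>)
      then show ?thesis by (auto simp: \<delta>_def complex_eq_iff one_complex.code zero_complex.code)
    qed
    note lim = tendsto_gs_row[OF this]
    have "\<forall>\<^sub>F n in sequentially. gs_norm N (gauss_cplx (w n)) k \<noteq> 0" if "k < N" for k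
    proof -
      have "(\<lambda>n. gs_norm N (gauss_cplx (w n)) k) \<longlonglongrightarrow> 1" using lim[OF _ _ that] by blast
      then show ?thesis by (rule tendsto_imp_eventually_ne) simp
    qed
    then have "\<forall>\<^sub>F n in sequentially. \<forall>k\<in>{..<N}. gs_norm N (gauss_cplx (w n)) k \<noteq> 0"
      by (intro eventually_ball_finite) auto
    from eventually_happens'[OF sequentially_bot this]
    obtain n where "\<forall>k\<in>{..<N}. gs_norm N (gauss_cplx (w n)) k \<noteq> 0" ..
    then have "orthonormal_rows N N (gs_row N (gauss_cplx (w n)))" by (intro gs_row_orthonormal) auto
    from orthonormal_rows_mat[OF this] have "w n \<in> gs_good N" by (simp add: gs_good_def gs_mat_def)
    with w(2) show False by blast
  qed
  then obtain n where n: "box n \<subseteq> gs_good N" ..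
  interpret product_prob_space "\<lambda>_ :: nat \<times> nat \<times> bool. std_normal" UNIV
    by (intro product_prob_spaceI prob_space_std_normal)
  have "emeasure gauss_prod (box n)
      = (\<Prod>p\<in>J. emeasure std_normal {\<delta> p - 1 / real (Suc n)<..<\<delta> p + 1 / real (Suc n)})"
    using emeasure_PiM_Collect[of J "\<lambda>p. {\<delta> p - 1 / real (Suc n)<..<\<delta> p + 1 / real (Suc n)}"]
    by (simp add: J_def box_def gauss_prod_def space_PiM)
  moreover have "emeasure std_normal {\<delta> p - 1 / real (Suc n)<..<\<delta> p + 1 / real (Suc n)} \<noteq> 0" for p
    using std_normal_interval_pos[of "\<delta> p - 1 / real (Suc n)" "\<delta> p + 1 / real (Suc n)"]
    by (simp add: less_le)
  ultimately have "emeasure gauss_prod (box n) \<noteq> 0"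
    by (simp add: prod_zero_iff J_def)
  moreover have "emeasure gauss_prod (box n) \<le> emeasure gauss_prod (gs_good N)"
    by (rule emeasure_mono[OF n gs_good_sets])
  ultimately show ?thesis by (metis less_le_trans not_gr_zero)
qed

text \<open>
  The Gram--Schmidt process on rows commutes with multiplication from the right; passing to the adjoint
  turns this into invariance under multiplication from the left. The event \<open>gs_good\<close> is invariant, so
  that the conditional law is invariant as well.
\<close>

lemma is_haar_unitary_exists: "\<exists>\<mu>. is_haar_unitary N \<mu>"
proof -
  interpret G: prob_space "gauss_prod :: gauss_coords measure"
    by (rule prob_space_gauss_prod)
  let ?E = "gs_good N"
  let ?u = "uniform_measure gauss_prod ?E"
  define \<phi> where "\<phi> = (\<lambda>w. if w \<in> ?E then mat_adjoint (gs_mat N w) else 1\<^sub>m N)"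
  define \<mu> where "\<mu> = distr ?u (unitary_borel N) \<phi>"
  have E: "emeasure gauss_prod ?E \<noteq> 0" "emeasure gauss_prod ?E \<noteq> \<infinity>"
    using gs_good_pos[of N] by (auto simp: G.emeasure_eq_measure)
  interpret u: prob_space ?u by (rule prob_space_uniform_measure[OF E])
  have \<phi>_in: "\<phi> w \<in> unitary_group N" for w
    by (auto simp: \<phi>_def gs_good_def intro: unitary_group_adjoint unitary_group_one)
  have \<phi>m: "\<phi> \<in> measurable gauss_prod (unitary_borel N)"
  proof (rule measurable_unitary_borelI)
    show "\<phi> \<in> measurable gauss_prod (mat_borel N)"
      unfolding \<phi>_def
      by (intro measurable_If_set measurable_mat_adjoint measurable_gs_mat measurable_const)
         (use gs_good_sets in auto)
  qed (use \<phi>_in in auto)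
  then have \<phi>u: "\<phi> \<in> measurable ?u (unitary_borel N)" by simp
  have "prob_space \<mu>" unfolding \<mu>_def by (rule u.prob_space_distr[OF \<phi>u])
  moreover have s: "sets \<mu> = sets (unitary_borel N)" by (simp add: \<mu>_def)
  moreover have "distr \<mu> \<mu> (\<lambda>U. V * U) = \<mu>" if V: "V \<in> unitary_group N" for V
  proof (rule measure_eqI)
    fix A assume "A \<in> sets (distr \<mu> \<mu> (\<lambda>U. V * U))"
    then have A: "A \<in> sets (unitary_borel N)" by (simp add: s)
    have mV: "(\<lambda>U. V * U) \<in> measurable (unitary_borel N) (unitary_borel N)"
      by (rule measurable_unitary_mult) (use V in auto)
    then have mV': "(\<lambda>U. V * U) \<in> measurable \<mu> \<mu>" using measurable_cong_sets[OF s s] by blast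
    let ?F = "\<lambda>w. indicator A (\<phi> w) * indicator ?E w :: ennreal"
    have Fm: "?F \<in> borel_measurable gauss_prod"
      by (intro borel_measurable_times_ennreal measurable_compose[OF \<phi>m] borel_measurable_indicator A gs_good_sets)
    have act: "indicator A (V * \<phi> w) * indicator ?E w = ?F (unitary_act N N (mat_adjoint V) w)" for w
    proof -
      have g: "gs_mat N (unitary_act N N (mat_adjoint V) w) = gs_mat N w * mat_adjoint V"
        by (rule gs_mat_unitary_act[OF unitary_group_adjoint[OF V]])
      have iff: "unitary_act N N (mat_adjoint V) w \<in> ?E \<longleftrightarrow> w \<in> ?E"
      proof
        assume "w \<in> ?E"
        then show "unitary_act N N (mat_adjoint V) w \<in> ?E"
          using unitary_group_mult[OF _ unitary_group_adjoint[OF V]] by (simp add: gs_good_def g)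
      next
        assume "unitary_act N N (mat_adjoint V) w \<in> ?E"
        then have "gs_mat N w * mat_adjoint V * V \<in> unitary_group N"
          using unitary_group_mult[OF _ V] by (simp add: gs_good_def g)
        moreover have "gs_mat N w * mat_adjoint V * V = gs_mat N w"
          using unitary_groupD[OF V] right_mult_one_mat[of "gs_mat N w" N N]
          by (simp add: mat_mult_assoc)
        ultimately show "w \<in> ?E" by (simp add: gs_good_def)
      qed
      show ?thesis
      proof (cases "w \<in> ?E")
        case True
        then have "\<phi> (unitary_act N N (mat_adjoint V) w) = V * \<phi> w"
          unfolding \<phi>_def using iff unitary_groupD[OF V] by (simp add: g mat_adjoint_mult)
        then show ?thesis using iff True by simp
      next
        case False
        then show ?thesis using iff by simp
      qed
    qed
    have em: "emeasure (distr ?u (unitary_borel N) h) A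
        = (\<integral>\<^sup>+w. indicator A (h w) * indicator ?E w \<partial>gauss_prod) / emeasure gauss_prod ?E"
      if h: "h \<in> measurable gauss_prod (unitary_borel N)" for h
    proof -
      have hu: "h \<in> measurable ?u (unitary_borel N)" using h by simp
      have "emeasure (distr ?u (unitary_borel N) h) A
          = (\<integral>\<^sup>+U. indicator A U \<partial>distr ?u (unitary_borel N) h)"
        using A by simp
      also have "\<dots> = (\<integral>\<^sup>+w. indicator A (h w) \<partial>?u)"
        by (rule nn_integral_distr[OF hu]) (use A in simp)
      also have "\<dots> = (\<integral>\<^sup>+w. indicator A (h w) * indicator ?E w \<partial>gauss_prod) / emeasure gauss_prod ?E"
        by (rule nn_integral_uniform_measure)
           (auto intro!: measurable_compose[OF h] borel_measurable_indicator A gs_good_sets)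
      finally show ?thesis .
    qed
    have "distr \<mu> \<mu> (\<lambda>U. V * U) = distr ?u (unitary_borel N) (\<lambda>w. V * \<phi> w)"
      unfolding \<mu>_def
      using distr_distr[OF mV \<phi>u] by (simp add: o_def cong: distr_cong)
    then have "emeasure (distr \<mu> \<mu> (\<lambda>U. V * U)) A
        = (\<integral>\<^sup>+w. ?F (unitary_act N N (mat_adjoint V) w) \<partial>gauss_prod) / emeasure gauss_prod ?E"
      using em[OF measurable_compose[OF \<phi>m mV]] by (simp only: act)
    also have "\<dots> = (\<integral>\<^sup>+w. ?F w \<partial>gauss_prod) / emeasure gauss_prod ?E"
      using gauss_invariantD[OF gauss_invariant_unitary[OF unitary_group_adjoint[OF V], of N] Fm] by simp
    also have "\<dots> = emeasure \<mu> A"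
      unfolding \<mu>_def using em[OF \<phi>m] by simp
    finally show "emeasure (distr \<mu> \<mu> (\<lambda>U. V * U)) A = emeasure \<mu> A" .
  qed simp
  ultimately show ?thesis
    unfolding is_haar_unitary_def unitary_borel_def[symmetric] by blast
qed

lemma haar_unitary_is_haar: "is_haar_unitary N (haar_unitary N)"
  unfolding haar_unitary_def by (rule someI_ex[OF is_haar_unitary_exists])

section \<open>The finite kernels as laws of corners\<close>

lemma haar_unitary_measure_space:
  "prob_space (haar_unitary N)" "sets (haar_unitary N) = sets (unitary_borel N)"
  "space (haar_unitary N) = unitary_group N"
  using is_haar_unitaryD(1-3)[OF haar_unitary_is_haar] by auto

lemma measurable_haar_iff:
  "f \<in> measurable (haar_unitary N) M \<longleftrightarrow> f \<in> measurable (unitary_borel N) M"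
  using measurable_cong_sets[OF haar_unitary_measure_space(2) refl] by blast

text \<open>
  The matrix \<open>U diag(x) U\<^sup>\<dagger>\<close>, also for rectangular \<open>U\<close> with \<open>N\<close> columns.
\<close>

definition conj_diag :: "nat \<Rightarrow> (nat \<Rightarrow> real) \<Rightarrow> complex mat \<Rightarrow> complex mat" where
  "conj_diag N x U = U * mat_diag N (\<lambda>i. complex_of_real (x i)) * mat_adjoint U"

lemma conj_diag_carrier: "U \<in> carrier_mat K N \<Longrightarrow> conj_diag N x U \<in> carrier_mat K K"
  unfolding conj_diag_def by auto

lemma conj_diag_hermitian: "U \<in> carrier_mat K N \<Longrightarrow> hermitian_mat K (conj_diag N x U)"
  unfolding conj_diag_def by (rule hermitian_mat_conj[OF hermitian_mat_diag])

lemma conj_diag_mult: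
  assumes "A \<in> carrier_mat K N" "U \<in> carrier_mat N N"
  shows "conj_diag N x (A * U) = A * conj_diag N x U * mat_adjoint A"
  unfolding conj_diag_def using assms by (auto simp: mat_adjoint_mult mat_mult_assoc)

lemma measurable_conj_diag:
  assumes "f \<in> measurable M (mat_borel N)" "\<And>i. i < N \<Longrightarrow> (\<lambda>w. x w i) \<in> borel_measurable M"
  shows "(\<lambda>w. conj_diag N (x w) (f w)) \<in> measurable M (mat_borel N)"
  unfolding conj_diag_def
  by (intro measurable_mat_mult measurable_mat_adjoint measurable_mat_diag_of_real assms)

text \<open>
  The ordered eigenvalues of the \<open>K \<times> K\<close> corner of \<open>U diag(x) U\<^sup>\<dagger>\<close>.
\<close>

definition corner_eval :: "nat \<Rightarrow> nat \<Rightarrow> (nat \<Rightarrow> real) \<Rightarrow> complex mat \<Rightarrow> (nat \<Rightarrow> real)" where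
  "corner_eval K N x U = eval_ord K (corner K (conj_diag N x U))"

lemma measurable_corner_eval:
  assumes "f \<in> measurable M (mat_borel N)" "\<And>i. i < N \<Longrightarrow> (\<lambda>w. x w i) \<in> borel_measurable M" "K \<le> N"
  shows "(\<lambda>w. corner_eval K N (x w) (f w)) \<in> measurable M (weyl_borel K)"
  unfolding corner_eval_def
  by (rule measurable_compose[OF measurable_corner[OF measurable_conj_diag[OF assms(1,2)] assms(3)]
        measurable_eval_ord])

lemma measurable_corner_eval_fixed:
  assumes "K \<le> N"
  shows "corner_eval K N x \<in> measurable (unitary_borel N) (weyl_borel K)"
  using measurable_corner_eval[of "\<lambda>U. U" "unitary_borel N" N "\<lambda>_. x" K] assms
    measurable_unitary_borelD[of "\<lambda>U. U" "unitary_borel N" N] by simp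

text \<open>
  The law of \<open>corner_eval\<close> for a Haar distributed \<open>U\<close> of size \<open>N\<close>.
\<close>

definition corner_law :: "nat \<Rightarrow> nat \<Rightarrow> (nat \<Rightarrow> real) \<Rightarrow> (nat \<Rightarrow> real) measure" where
  "corner_law K N x = distr (haar_unitary N) (weyl_borel K) (corner_eval K N x)"

lemma measurable_corner_law:
  assumes "K \<le> N"
  shows "corner_law K N \<in> measurable (weyl_borel N) (subprob_algebra (weyl_borel K))"
  unfolding corner_law_def
proof (rule measurable_distr2[where M="haar_unitary N"])
  have s: "sets (weyl_borel N \<Otimes>\<^sub>M haar_unitary N) = sets (weyl_borel N \<Otimes>\<^sub>M unitary_borel N)"
    by (intro sets_pair_measure_cong refl haar_unitary_measure_space(2))
  have "(\<lambda>p. corner_eval K N (fst p) (snd p)) \<in> measurable (weyl_borel N \<Otimes>\<^sub>M unitary_borel N) (weyl_borel K)"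
    by (intro measurable_corner_eval assms measurable_unitary_borelD measurable_snd
        measurable_compose[OF measurable_fst measurable_weyl_coord])
  then show "case_prod (corner_eval K N) \<in> measurable (weyl_borel N \<Otimes>\<^sub>M haar_unitary N) (weyl_borel K)"
    unfolding case_prod_unfold using measurable_cong_sets[OF s refl] by blast
  show "(\<lambda>x. haar_unitary N) \<in> measurable (weyl_borel N) (subprob_algebra (haar_unitary N))"
    by (rule measurable_const)
       (simp add: space_subprob_algebra prob_space_imp_subprob_space[OF haar_unitary_measure_space(1)])
qed

lemma Lambda_step_eq: "Lambda_step N x = corner_law N (N + 1) x"
  unfolding Lambda_step_def corner_law_def corner_eval_def conj_diag_def ..

lemma measurable_extend_unitary:
  "extend_unitary N \<in> measurable (unitary_borel N) (unitary_borel (N + 1))"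
proof (rule measurable_unitary_borelI)
  show "extend_unitary N \<in> measurable (unitary_borel N) (mat_borel (N + 1))"
  proof (rule measurable_mat_borelI)
    fix U assume "U \<in> space (unitary_borel N)"
    then show "extend_unitary N U \<in> carrier_mat (N + 1) (N + 1)"
      using unitary_groupD(1)[OF extend_unitary_in] by simp
  next
    fix i j assume ij: "i < N + 1" "j < N + 1"
    have id: "(\<lambda>U. U) \<in> measurable (unitary_borel N) (mat_borel N)"
      by (rule measurable_unitary_borelD) simp
    have "(\<lambda>U. if i < N \<and> j < N then U $$ (i, j) else if i = j then 1 else 0) \<in> borel_measurable (unitary_borel N)"
      using measurable_mat_entry[OF id, of i j] by (cases "i < N \<and> j < N") auto
    also have "?this \<longleftrightarrow> (\<lambda>U. extend_unitary N U $$ (i, j)) \<in> borel_measurable (unitary_borel N)"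
    proof (rule measurable_cong)
      fix U assume "U \<in> space (unitary_borel N)"
      then have "dim_row U = N" "dim_col U = N" using unitary_groupD by auto
      then show "(if i < N \<and> j < N then U $$ (i, j) else if i = j then 1 else 0) = extend_unitary N U $$ (i, j)"
        using ij by (auto simp: extend_unitary_def)
    qed
    finally show "(\<lambda>U. extend_unitary N U $$ (i, j)) \<in> borel_measurable (unitary_borel N)" .
  qed
qed (use extend_unitary_in in auto)

lemma emeasure_corner_law:
  assumes "K \<le> N" "A \<in> sets (weyl_borel K)"
  shows "emeasure (corner_law K N x) A = (\<integral>\<^sup>+U. indicator A (corner_eval K N x U) \<partial>haar_unitary N)"
proof -
  have m: "corner_eval K N x \<in> measurable (haar_unitary N) (weyl_borel K)"
    unfolding measurable_haar_iff by (rule measurable_corner_eval_fixed[OF assms(1)])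
  have "emeasure (corner_law K N x) A = (\<integral>\<^sup>+y. indicator A y \<partial>corner_law K N x)"
    using assms(2) by (simp add: corner_law_def)
  also have "\<dots> = (\<integral>\<^sup>+U. indicator A (corner_eval K N x U) \<partial>haar_unitary N)"
    unfolding corner_law_def by (rule nn_integral_distr[OF m]) (use assms(2) in simp)
  finally show ?thesis .
qed

text \<open>
  The diagonal matrix of the eigenvalues of \<open>B\<close> may be replaced by \<open>B\<close> itself: a diagonalising unitary
  matrix is absorbed by the invariance of the Haar measure under multiplication from the right.
\<close>

lemma nn_integral_corner_eval_of_corner:
  assumes K: "K \<le> N" and A: "A \<in> sets (weyl_borel K)" and B: "hermitian_mat N B"
  shows "(\<integral>\<^sup>+V. indicator A (corner_eval K N (eval_ord N B) V) \<partial>haar_unitary N)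
    = (\<integral>\<^sup>+V. indicator A (eval_ord K (corner K (V * B * mat_adjoint V))) \<partial>haar_unitary N)"
proof -
  obtain W where W: "W \<in> unitary_group N" "B = conj_diag N (eval_ord N B) W"
    using hermitian_spectral[OF B] unfolding conj_diag_def by blast
  note Wd = unitary_groupD[OF W(1)]
  have m: "(\<lambda>V. indicator A (corner_eval K N (eval_ord N B) V) :: ennreal) \<in> borel_measurable (unitary_borel N)"
    by (intro measurable_compose[OF measurable_corner_eval_fixed[OF K]] borel_measurable_indicator A)
  have "(\<integral>\<^sup>+V. indicator A (corner_eval K N (eval_ord N B) V) \<partial>haar_unitary N)
      = (\<integral>\<^sup>+V. indicator A (corner_eval K N (eval_ord N B) (V * W)) \<partial>haar_unitary N)"
    using is_haar_unitary_right[OF haar_unitary_is_haar m W(1)] by simp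
  also have "\<dots> = (\<integral>\<^sup>+V. indicator A (eval_ord K (corner K (V * B * mat_adjoint V))) \<partial>haar_unitary N)"
  proof (rule nn_integral_cong)
    fix V assume "V \<in> space (haar_unitary N)"
    then have V: "V \<in> carrier_mat N N" using haar_unitary_measure_space(3) unitary_groupD(1) by blast
    show "indicator A (corner_eval K N (eval_ord N B) (V * W))
        = (indicator A (eval_ord K (corner K (V * B * mat_adjoint V))) :: ennreal)"
      unfolding corner_eval_def conj_diag_mult[OF V Wd(1)] W(2)[symmetric] ..
  qed
  finally show ?thesis .
qed

text \<open>
  Conjugating the corner of size \<open>N\<close> by \<open>V\<close> amounts to multiplying \<open>U\<close> by the extension of \<open>V\<close>, which
  is absorbed by the invariance of the Haar measure under multiplication from the left.
\<close>

lemma corner_law_step: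
  assumes K: "K \<le> N" and A: "A \<in> sets (weyl_borel K)"
  shows "(\<integral>\<^sup>+U. emeasure (corner_law K N (corner_eval N (N + 1) x U)) A \<partial>haar_unitary (N + 1))
    = emeasure (corner_law K (N + 1) x) A"
proof -
  interpret H: prob_space "haar_unitary N" by (rule haar_unitary_measure_space(1))
  interpret H1: prob_space "haar_unitary (N + 1)" by (rule haar_unitary_measure_space(1))
  interpret P: pair_sigma_finite "haar_unitary N" "haar_unitary (N + 1)" ..
  let ?F = "\<lambda>U. indicator A (corner_eval K (N + 1) x U) :: ennreal"
  have K1: "K \<le> N + 1" using K by simp
  have Fm: "?F \<in> borel_measurable (unitary_borel (N + 1))"
    by (intro measurable_compose[OF measurable_corner_eval_fixed[OF K1]] borel_measurable_indicator A)
  have "(\<integral>\<^sup>+U. emeasure (corner_law K N (corner_eval N (N + 1) x U)) A \<partial>haar_unitary (N + 1))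
      = (\<integral>\<^sup>+U. \<integral>\<^sup>+V. ?F (extend_unitary N V * U) \<partial>haar_unitary N \<partial>haar_unitary (N + 1))"
  proof (rule nn_integral_cong)
    fix U assume "U \<in> space (haar_unitary (N + 1))"
    then have U: "U \<in> unitary_group (N + 1)" by (simp add: haar_unitary_measure_space(3))
    note Ud = unitary_groupD[OF U]
    define X where "X = conj_diag (N + 1) x U"
    have X: "hermitian_mat (N + 1) X" "X \<in> carrier_mat (N + 1) (N + 1)"
      unfolding X_def by (intro conj_diag_hermitian conj_diag_carrier Ud)+
    have B: "hermitian_mat N (corner N X)" by (rule hermitian_corner[OF X(1)]) simp
    have "emeasure (corner_law K N (corner_eval N (N + 1) x U)) A
        = (\<integral>\<^sup>+V. indicator A (eval_ord K (corner K (V * corner N X * mat_adjoint V))) \<partial>haar_unitary N)"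
      unfolding emeasure_corner_law[OF K A] corner_eval_def[of N] X_def[symmetric]
      by (rule nn_integral_corner_eval_of_corner[OF K A B])
    also have "\<dots> = (\<integral>\<^sup>+V. ?F (extend_unitary N V * U) \<partial>haar_unitary N)"
    proof (rule nn_integral_cong)
      fix V assume "V \<in> space (haar_unitary N)"
      then have V: "V \<in> unitary_group N" by (simp add: haar_unitary_measure_space(3))
      let ?E = "extend_unitary N V"
      have "corner K (V * corner N X * mat_adjoint V) = corner K (?E * X * mat_adjoint ?E)"
        unfolding corner_extend_unitary_conj[OF V X(2), symmetric] using K by (rule corner_corner)
      also have "?E * X * mat_adjoint ?E = conj_diag (N + 1) x (?E * U)"
        unfolding X_def by (rule conj_diag_mult[symmetric, OF unitary_groupD(1)[OF extend_unitary_in[OF V]] Ud(1)])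
      finally show "indicator A (eval_ord K (corner K (V * corner N X * mat_adjoint V))) = ?F (?E * U)"
        by (simp add: corner_eval_def)
    qed
    finally show "emeasure (corner_law K N (corner_eval N (N + 1) x U)) A
        = (\<integral>\<^sup>+V. ?F (extend_unitary N V * U) \<partial>haar_unitary N)" .
  qed
  also have "\<dots> = (\<integral>\<^sup>+V. \<integral>\<^sup>+U. ?F (extend_unitary N V * U) \<partial>haar_unitary (N + 1) \<partial>haar_unitary N)"
  proof (rule P.Fubini')
    have s: "sets (haar_unitary N \<Otimes>\<^sub>M haar_unitary (N + 1)) = sets (unitary_borel N \<Otimes>\<^sub>M unitary_borel (N + 1))"
      by (intro sets_pair_measure_cong haar_unitary_measure_space(2))
    have "(\<lambda>p. ?F (extend_unitary N (fst p) * snd p)) \<in> borel_measurable (unitary_borel N \<Otimes>\<^sub>M unitary_borel (N + 1))"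
      by (intro measurable_compose[OF measurable_unitary_mult Fm] measurable_snd
          measurable_compose[OF measurable_fst measurable_extend_unitary])
    then show "case_prod (\<lambda>V U. ?F (extend_unitary N V * U)) \<in> borel_measurable (haar_unitary N \<Otimes>\<^sub>M haar_unitary (N + 1))"
      unfolding case_prod_unfold using measurable_cong_sets[OF s refl] by blast
  qed
  also have "\<dots> = (\<integral>\<^sup>+V. emeasure (corner_law K (N + 1) x) A \<partial>haar_unitary N)"
  proof (rule nn_integral_cong)
    fix V assume "V \<in> space (haar_unitary N)"
    then have V: "extend_unitary N V \<in> unitary_group (N + 1)"
      by (intro extend_unitary_in) (simp add: haar_unitary_measure_space(3))
    show "(\<integral>\<^sup>+U. ?F (extend_unitary N V * U) \<partial>haar_unitary (N + 1)) = emeasure (corner_law K (N + 1) x) A"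
      unfolding emeasure_corner_law[OF K1 A]
      by (rule is_haar_unitaryD(4)[OF haar_unitary_is_haar V Fm])
  qed
  also have "\<dots> = emeasure (corner_law K (N + 1) x) A" by (simp add: H.emeasure_space_1)
  finally show ?thesis .
qed

lemma Lambda_down_eq_corner_law:
  "x \<in> weyl (K + d) \<Longrightarrow> Lambda_down K d x = corner_law K (K + d) x"
proof (induction d arbitrary: x)
  case 0
  interpret H: prob_space "haar_unitary K" by (rule haar_unitary_measure_space(1))
  have "corner_law K K x = distr (haar_unitary K) (weyl_borel K) (\<lambda>_. x)"
    unfolding corner_law_def
  proof (rule distr_cong[OF refl refl])
    fix U assume "U \<in> space (haar_unitary K)"
    then have U: "U \<in> unitary_group K" by (simp add: haar_unitary_measure_space(3))
    have "corner K (conj_diag K x U) = conj_diag K x U"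
      using conj_diag_carrier[OF unitary_groupD(1)[OF U], of x] by (intro eq_matI) (auto simp: corner_def)
    then show "corner_eval K K x U = x"
      unfolding corner_eval_def conj_diag_def
      using eval_ord_unitary_conj[OF U hermitian_mat_diag] eval_ord_mat_diag[of x K] 0 by simp
  qed
  also have "\<dots> = return (weyl_borel K) x" using 0 by (intro H.distr_const) simp
  finally show ?case by simp
next
  case (Suc d)
  let ?N = "K + d"
  have K: "K \<le> ?N" by simp
  interpret H: prob_space "haar_unitary (?N + 1)" by (rule haar_unitary_measure_space(1))
  have kernel: "Lambda_down K d \<in> measurable (weyl_borel ?N) (subprob_algebra (weyl_borel K))"
    by (subst measurable_cong[where g="corner_law K ?N"])
       (use Suc.IH measurable_corner_law[OF K] in auto)
  have step: "sets (Lambda_step ?N x) = sets (weyl_borel ?N)" by (simp add: Lambda_step_def)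
  then have kernel': "Lambda_down K d \<in> measurable (Lambda_step ?N x) (subprob_algebra (weyl_borel K))"
    using kernel measurable_cong_sets[OF step refl] by blast
  have ne: "space (Lambda_step ?N x) \<noteq> {}"
    using eval_ord_in_weyl[of ?N] sets_eq_imp_space_eq[OF step] by auto
  have m: "corner_eval ?N (?N + 1) x \<in> measurable (haar_unitary (?N + 1)) (weyl_borel ?N)"
    unfolding measurable_haar_iff by (rule measurable_corner_eval_fixed) simp
  show ?case
  proof (rule measure_eqI)
    show s: "sets (Lambda_down K (Suc d) x) = sets (corner_law K (K + Suc d) x)"
      using sets_bind[OF sets_kernel[OF kernel'] ne] by (simp add: corner_law_def)
    fix A assume "A \<in> sets (Lambda_down K (Suc d) x)"
    then have A: "A \<in> sets (weyl_borel K)" unfolding s by (simp add: corner_law_def)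
    have "emeasure (Lambda_down K (Suc d) x) A = (\<integral>\<^sup>+y. emeasure (Lambda_down K d y) A \<partial>Lambda_step ?N x)"
      unfolding Lambda_down.simps by (rule emeasure_bind[OF ne kernel' A])
    also have "\<dots> = (\<integral>\<^sup>+U. emeasure (Lambda_down K d (corner_eval ?N (?N + 1) x U)) A \<partial>haar_unitary (?N + 1))"
      unfolding Lambda_step_eq corner_law_def
      by (rule nn_integral_distr[OF m])
         (use measurable_compose[OF kernel measurable_emeasure_subprob_algebra[OF A]] in simp)
    also have "\<dots> = (\<integral>\<^sup>+U. emeasure (corner_law K ?N (corner_eval ?N (?N + 1) x U)) A \<partial>haar_unitary (?N + 1))"
      by (rule nn_integral_cong) (use Suc.IH eval_ord_in_weyl in \<open>auto simp: corner_eval_def[of ?N]\<close>)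
    also have "\<dots> = emeasure (corner_law K (K + Suc d) x) A"
      using corner_law_step[OF K A, of x] by simp
    finally show "emeasure (Lambda_down K (Suc d) x) A = emeasure (corner_law K (K + Suc d) x) A" .
  qed
qed

lemma sym_act_Lambda_fin:
  assumes "K \<le> N" "x \<in> weyl N" "g \<in> Cc_inf K"
  shows "sym_act K (Lambda_fin K N x) g = (\<integral>U. sym_test K g (corner_eval K N x U) \<partial>haar_unitary N)"
proof -
  have "Lambda_fin K N x = corner_law K N x"
    using Lambda_down_eq_corner_law[of x K "N - K"] assms by (simp add: Lambda_fin_def)
  moreover have "corner_eval K N x \<in> measurable (haar_unitary N) (weyl_borel K)"
    unfolding measurable_haar_iff by (rule measurable_corner_eval_fixed[OF assms(1)])
  ultimately show ?thesis
    unfolding sym_act_def sym_test_def[symmetric] corner_law_def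
    by (simp add: integral_distr borel_measurable_weyl_of_continuous continuous_on_sym_test
        Cc_inf_continuous[OF assms(3)])
qed

section \<open>The boundary kernels as laws of Gaussian matrices\<close>

text \<open>
  The ordered eigenvalues of \<open>G diag(x) G\<^sup>\<dagger>\<close> for a \<open>K \<times> N\<close> matrix \<open>G\<close>.
\<close>

definition wishart_eval :: "nat \<Rightarrow> nat \<Rightarrow> (nat \<Rightarrow> real) \<Rightarrow> complex mat \<Rightarrow> (nat \<Rightarrow> real)" where
  "wishart_eval K N x G = eval_ord K (conj_diag N x G)"

lemma measurable_wishart_eval:
  assumes "\<And>a j. a < K \<Longrightarrow> j < N \<Longrightarrow> (\<lambda>w. G w $$ (a, j)) \<in> borel_measurable M"
    and "\<And>w. G w \<in> carrier_mat K N"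
  shows "(\<lambda>w. wishart_eval K N x (G w)) \<in> measurable M (weyl_borel K)"
  unfolding wishart_eval_def
proof (rule measurable_compose[OF _ measurable_eval_ord], rule measurable_mat_borelI)
  show "conj_diag N x (G w) \<in> carrier_mat K K" for w by (rule conj_diag_carrier[OF assms(2)])
  have cnj: "cnj \<in> borel_measurable borel"
    by (intro borel_measurable_continuous_onI continuous_intros)
  fix a b assume ab: "a < K" "b < K"
  show "(\<lambda>w. conj_diag N x (G w) $$ (a, b)) \<in> borel_measurable M"
    unfolding conj_diag_def mat_conj_diag_index[OF assms(2) ab]
    by (intro borel_measurable_sum borel_measurable_times borel_measurable_const
        measurable_compose[OF _ cnj] assms(1)) (use ab in auto)
qed

text \<open>
  The \<open>K \<times> N\<close> matrix of independent complex Gaussians of variance \<open>1/N\<close>.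
\<close>

definition scaled_ginibre :: "nat \<Rightarrow> nat \<Rightarrow> gauss_coords \<Rightarrow> complex mat" where
  "scaled_ginibre K N w = Matrix.mat K N (\<lambda>(a, j). gauss_cplx w a j / complex_of_real (sqrt (2 * real N)))"

lemma scaled_ginibre_dim[simp]: "scaled_ginibre K N w \<in> carrier_mat K N"
  "dim_row (scaled_ginibre K N w) = K" "dim_col (scaled_ginibre K N w) = N"
  by (auto simp: scaled_ginibre_def)

lemma scaled_ginibre_unitary_act:
  assumes "U \<in> carrier_mat N N"
  shows "scaled_ginibre K N (unitary_act K N U w) = scaled_ginibre K N w * U"
proof (rule eq_matI)
  fix a j assume "a < dim_row (scaled_ginibre K N w * U)" "j < dim_col (scaled_ginibre K N w * U)"
  then have aj: "a < K" "j < N" using assms by auto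
  have "(scaled_ginibre K N w * U) $$ (a, j) = (\<Sum>l<N. scaled_ginibre K N w $$ (a, l) * U $$ (l, j))"
    using aj assms by (subst mat_mult_index) auto
  also have "\<dots> = (\<Sum>l<N. gauss_cplx w a l * U $$ (l, j)) / complex_of_real (sqrt (2 * real N))"
    using aj by (simp add: scaled_ginibre_def sum_divide_distrib)
  finally show "scaled_ginibre K N (unitary_act K N U w) $$ (a, j) = (scaled_ginibre K N w * U) $$ (a, j)"
    using aj by (simp add: scaled_ginibre_def gauss_cplx_unitary_act)
qed (use assms in auto)

lemma measurable_scaled_ginibre:
  "a < K \<Longrightarrow> j < N \<Longrightarrow> (\<lambda>w. scaled_ginibre K N w $$ (a, j)) \<in> borel_measurable gauss_prod"
  by (simp add: scaled_ginibre_def)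

lemma distr_gauss_prod_reindex:
  assumes "inj h"
  shows "distr gauss_prod gauss_prod (\<lambda>w i. w (h i)) = gauss_prod"
  using distr_PiM_reindex[of UNIV "\<lambda>_. std_normal" h UNIV] assms prob_space_std_normal
  by (simp add: gauss_prod_def restrict_def)

lemma gauss_space_eq: "gauss_space = gauss_prod"
  by (simp add: gauss_space_def gauss_prod_def)

text \<open>
  An injection of the indices selects independent standard normal variables, so a corner that is a
  function of the selected variables has the same law as that function under \<open>gauss_prod\<close>.
\<close>

lemma sym_act_of_reindex:
  assumes h: "inj h" and g: "g \<in> Cc_inf K"
    and A: "\<And>w. corner_inf K (A w) = conj_diag N x (scaled_ginibre K N (\<lambda>i. w (h i)))"
  shows "sym_act K (distr gauss_space (weyl_borel K) (\<lambda>w. eval_ord K (corner_inf K (A w)))) g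
    = (\<integral>w. sym_test K g (wishart_eval K N x (scaled_ginibre K N w)) \<partial>gauss_prod)"
proof -
  have m: "(\<lambda>w. wishart_eval K N x (scaled_ginibre K N w)) \<in> measurable gauss_prod (weyl_borel K)"
    by (intro measurable_wishart_eval measurable_scaled_ginibre) auto
  have hm: "(\<lambda>w i. w (h i)) \<in> measurable gauss_prod gauss_prod"
    by (rule measurable_gauss_prodI) simp
  have tm: "sym_test K g \<in> borel_measurable (weyl_borel K)"
    by (intro borel_measurable_weyl_of_continuous continuous_on_sym_test Cc_inf_continuous g)
  have "distr gauss_space (weyl_borel K) (\<lambda>w. eval_ord K (corner_inf K (A w)))
      = distr gauss_prod (weyl_borel K) (\<lambda>w. wishart_eval K N x (scaled_ginibre K N (\<lambda>i. w (h i))))"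
    by (simp add: A wishart_eval_def gauss_space_eq)
  also have "\<dots> = distr (distr gauss_prod gauss_prod (\<lambda>w i. w (h i))) (weyl_borel K)
      (\<lambda>w. wishart_eval K N x (scaled_ginibre K N w))"
    by (subst distr_distr[OF m hm]) (simp add: o_def)
  also have "\<dots> = distr gauss_prod (weyl_borel K) (\<lambda>w. wishart_eval K N x (scaled_ginibre K N w))"
    unfolding distr_gauss_prod_reindex[OF h] ..
  finally show ?thesis
    unfolding sym_act_def sym_test_def[symmetric] by (simp add: integral_distr[OF m tm])
qed

text \<open>
  The indices of the vectors \<open>\<xi>(j)\<close>, which carry all the randomness for the point \<open>omega_pos_of N x\<close>.
\<close>

definition xi_index :: "nat \<times> nat \<times> bool \<Rightarrow> gauss_index" where
  "xi_index = (\<lambda>(a, j, b). if b then XiIm j a else XiRe j a)"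

text \<open>
  For the point \<open>omega_of N x\<close>, a negative \<open>x j\<close> belongs to the vector \<open>\<zeta>(N - 1 - j)\<close>, because the negative
  coordinates enter \<open>omega_of\<close> in reversed order; the other coordinates belong to \<open>\<xi>(j)\<close>.
\<close>

definition signed_index :: "nat \<Rightarrow> (nat \<Rightarrow> real) \<Rightarrow> nat \<times> nat \<times> bool \<Rightarrow> gauss_index" where
  "signed_index N x = (\<lambda>(a, j, b).
     if j < N \<and> x j < 0 then (if b then ZetaIm (N - 1 - j) a else ZetaRe (N - 1 - j) a)
     else (if b then XiIm j a else XiRe j a))"

lemma inj_xi_index: "inj xi_index"
  unfolding xi_index_def inj_def by (auto split: if_splits)

lemma inj_signed_index: "inj (signed_index N x)"
  unfolding signed_index_def inj_def by (auto split: if_splits)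

lemma conj_diag_scaled_ginibre_index:
  assumes N: "N > 0" and ab: "a < K" "b < K"
  shows "conj_diag N x (scaled_ginibre K N w) $$ (a, b) = (\<Sum>j<N. complex_of_real (x j / real N) *
    (gauss_cplx w a j / complex_of_real (sqrt 2) * cnj (gauss_cplx w b j / complex_of_real (sqrt 2))))"
proof -
  have s: "z / complex_of_real (sqrt (2 * real N)) * cnj (z' / complex_of_real (sqrt (2 * real N)))
    = z / complex_of_real (sqrt 2) * cnj (z' / complex_of_real (sqrt 2)) / complex_of_real (real N)" for z z'
  proof -
    have "complex_of_real (sqrt (2 * real N)) * complex_of_real (sqrt (2 * real N))
      = complex_of_real (sqrt 2) * complex_of_real (sqrt 2) * complex_of_real (real N)"
      unfolding of_real_mult[symmetric] using real_sqrt_mult_self by simp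
    then show ?thesis by (simp add: divide_divide_eq_left)
  qed
  have "conj_diag N x (scaled_ginibre K N w) $$ (a, b)
    = (\<Sum>j<N. complex_of_real (x j) * (scaled_ginibre K N w $$ (a, j) * cnj (scaled_ginibre K N w $$ (b, j))))"
    unfolding conj_diag_def by (rule mat_conj_diag_index) (use ab in auto)
  also have "\<dots> = (\<Sum>j<N. complex_of_real (x j / real N) *
    (gauss_cplx w a j / complex_of_real (sqrt 2) * cnj (gauss_cplx w b j / complex_of_real (sqrt 2))))"
  proof (rule sum.cong)
    fix j assume "j \<in> {..<N}"
    then show "complex_of_real (x j) * (scaled_ginibre K N w $$ (a, j) * cnj (scaled_ginibre K N w $$ (b, j)))
      = complex_of_real (x j / real N) *
    (gauss_cplx w a j / complex_of_real (sqrt 2) * cnj (gauss_cplx w b j / complex_of_real (sqrt 2)))"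
      using ab s[of "gauss_cplx w a j" "gauss_cplx w b j"] by (auto simp: scaled_ginibre_def mult_ac)
  qed simp
  finally show ?thesis .
qed

lemma corner_A_inf_pos:
  assumes N: "N > 0"
  shows "corner_inf K (A_inf_pos (omega_pos_of N x) w)
    = conj_diag N x (scaled_ginibre K N (\<lambda>i. w (xi_index i)))"
proof (rule eq_matI)
  fix a b assume "a < dim_row (conj_diag N x (scaled_ginibre K N (\<lambda>i. w (xi_index i))))"
    "b < dim_col (conj_diag N x (scaled_ginibre K N (\<lambda>i. w (xi_index i))))"
  then have ab: "a < K" "b < K" by (auto simp: conj_diag_def)
  have g: "gauss_cplx (\<lambda>i. w (xi_index i)) a j / complex_of_real (sqrt 2) = gauss_xi w j a" for a j
    by (simp add: gauss_cplx_def xi_index_def gauss_xi_def)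
  have 1: "(\<Sum>j. if j < N then x j / real N else 0) = (\<Sum>i<N. x i) / real N"
    by (subst suminf_finite[of "{..<N}"]) (auto simp: sum_divide_distrib)
  have 2: "(\<Sum>j. complex_of_real (if j < N then x j / real N else 0) * (gauss_xi w j a * cnj (gauss_xi w j b)))
    = (\<Sum>j<N. complex_of_real (x j / real N) * (gauss_xi w j a * cnj (gauss_xi w j b)))"
    by (subst suminf_finite[of "{..<N}"]) auto
  show "corner_inf K (A_inf_pos (omega_pos_of N x) w) $$ (a, b)
    = conj_diag N x (scaled_ginibre K N (\<lambda>i. w (xi_index i))) $$ (a, b)"
    unfolding conj_diag_scaled_ginibre_index[OF N ab] g
    using ab by (simp add: corner_inf_def A_inf_pos_def omega_pos_of_def 1 2[simplified])
qed (auto simp: corner_inf_def conj_diag_def)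

lemma corner_A_inf:
  assumes N: "N > 0"
  shows "corner_inf K (A_inf (omega_of N x) w)
    = conj_diag N x (scaled_ginibre K N (\<lambda>i. w (signed_index N x i)))"
proof (rule eq_matI)
  fix a b assume "a < dim_row (conj_diag N x (scaled_ginibre K N (\<lambda>i. w (signed_index N x i))))"
    "b < dim_col (conj_diag N x (scaled_ginibre K N (\<lambda>i. w (signed_index N x i))))"
  then have ab: "a < K" "b < K" by (auto simp: conj_diag_def)
  define p where "p = (\<lambda>i. if i < N then max (x i) 0 / real N else 0)"
  define q where "q = (\<lambda>i. if i < N then max (- x (N - 1 - i)) 0 / real N else 0)"
  define \<xi> where "\<xi> = (\<lambda>j. gauss_xi w j a * cnj (gauss_xi w j b))"
  define \<zeta> where "\<zeta> = (\<lambda>j. gauss_zeta w j a * cnj (gauss_zeta w j b))"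
  define I where "I = id_entry a b"
  have g: "gauss_cplx (\<lambda>i. w (signed_index N x i)) a j / complex_of_real (sqrt 2)
      = (if x j < 0 then gauss_zeta w (N - 1 - j) a else gauss_xi w j a)" if "j < N" for a j
    using that by (simp add: gauss_cplx_def signed_index_def gauss_xi_def gauss_zeta_def)
  have rev: "(\<Sum>j<N. f (N - 1 - j)) = (\<Sum>j<N. f j)" for f :: "nat \<Rightarrow> 'z :: comm_monoid_add"
    using sum.nat_diff_reindex[of f N] by simp
  have q_rev: "q (N - 1 - j) = max (- x j) 0 / real N" if "j < N" for j
    using that by (simp add: q_def)
  have sq: "(\<Sum>i. (p i)\<^sup>2 + (q i)\<^sup>2) = (\<Sum>i<N. (x i)\<^sup>2) / (real N)\<^sup>2"
  proof -
    have "(\<Sum>i. (p i)\<^sup>2 + (q i)\<^sup>2) = (\<Sum>i<N. (p i)\<^sup>2 + (q i)\<^sup>2)"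
      by (rule suminf_finite) (auto simp: p_def q_def)
    also have "\<dots> = (\<Sum>i<N. (p i)\<^sup>2) + (\<Sum>i<N. (q (N - 1 - i))\<^sup>2)"
      using rev[of "\<lambda>i. (q i)\<^sup>2"] by (simp add: sum.distrib)
    also have "\<dots> = (\<Sum>i<N. (p i)\<^sup>2 + (q (N - 1 - i))\<^sup>2)" by (simp add: sum.distrib)
    also have "\<dots> = (\<Sum>i<N. (x i)\<^sup>2 / (real N)\<^sup>2)"
    proof (rule sum.cong)
      fix i assume "i \<in> {..<N}"
      then have "i < N" by simp
      then show "(p i)\<^sup>2 + (q (N - 1 - i))\<^sup>2 = (x i)\<^sup>2 / (real N)\<^sup>2"
        unfolding q_rev[OF \<open>i < N\<close>] by (auto simp: p_def max_def power_divide)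
    qed simp
    finally show ?thesis by (simp add: sum_divide_distrib)
  qed
  have sp: "(\<Sum>j. complex_of_real (p j) * (\<xi> j - I)) = (\<Sum>j<N. complex_of_real (p j) * (\<xi> j - I))"
    by (rule suminf_finite) (auto simp: p_def)
  have "(\<Sum>j. complex_of_real (q j) * (\<zeta> j - I)) = (\<Sum>j<N. complex_of_real (q j) * (\<zeta> j - I))"
    by (rule suminf_finite) (auto simp: q_def)
  also have "\<dots> = (\<Sum>j<N. complex_of_real (q (N - 1 - j)) * (\<zeta> (N - 1 - j) - I))"
    using rev[of "\<lambda>j. complex_of_real (q j) * (\<zeta> j - I)"] by simp
  finally have sqq: "(\<Sum>j. complex_of_real (q j) * (\<zeta> j - I))
    = (\<Sum>j<N. complex_of_real (q (N - 1 - j)) * (\<zeta> (N - 1 - j) - I))" .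
  have "corner_inf K (A_inf (omega_of N x) w) $$ (a, b)
    = complex_of_real ((\<Sum>i<N. x i) / real N) * I + (\<Sum>j. complex_of_real (p j) * (\<xi> j - I))
      - (\<Sum>j. complex_of_real (q j) * (\<zeta> j - I))"
    using ab sq unfolding corner_inf_def A_inf_def omega_of_def p_def[symmetric] q_def[symmetric]
    by (simp add: \<xi>_def \<zeta>_def I_def)
  also have "\<dots> = (\<Sum>j<N. complex_of_real (x j / real N) * I + complex_of_real (p j) * (\<xi> j - I)
      - complex_of_real (q (N - 1 - j)) * (\<zeta> (N - 1 - j) - I))"
    unfolding sp sqq by (simp add: sum.distrib sum_subtractf sum_distrib_right[symmetric] sum_divide_distrib[symmetric])
  also have "\<dots> = (\<Sum>j<N. complex_of_real (x j / real N) * (if x j < 0 then \<zeta> (N - 1 - j) else \<xi> j))"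
  proof (rule sum.cong)
    fix j assume "j \<in> {..<N}"
    then have j: "j < N" by simp
    show "complex_of_real (x j / real N) * I + complex_of_real (p j) * (\<xi> j - I)
      - complex_of_real (q (N - 1 - j)) * (\<zeta> (N - 1 - j) - I)
      = complex_of_real (x j / real N) * (if x j < 0 then \<zeta> (N - 1 - j) else \<xi> j)"
      unfolding q_rev[OF j] using j by (simp add: p_def max_def algebra_simps diff_divide_distrib)
  qed simp
  also have "\<dots> = conj_diag N x (scaled_ginibre K N (\<lambda>i. w (signed_index N x i))) $$ (a, b)"
    unfolding conj_diag_scaled_ginibre_index[OF N ab]
    by (rule sum.cong) (auto simp: g \<xi>_def \<zeta>_def)
  finally show "corner_inf K (A_inf (omega_of N x) w) $$ (a, b)
    = conj_diag N x (scaled_ginibre K N (\<lambda>i. w (signed_index N x i))) $$ (a, b)" .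
qed (auto simp: corner_inf_def conj_diag_def)

lemma sym_act_Lambda_inf:
  assumes "N > 0" "g \<in> Cc_inf K"
  shows "sym_act K (Lambda_inf K (omega_of N x)) g
      = (\<integral>w. sym_test K g (wishart_eval K N x (scaled_ginibre K N w)) \<partial>gauss_prod)"
    "sym_act K (Lambda_inf_pos K (omega_pos_of N x)) g
      = (\<integral>w. sym_test K g (wishart_eval K N x (scaled_ginibre K N w)) \<partial>gauss_prod)"
  unfolding Lambda_inf_def Lambda_inf_pos_def
  by (rule sym_act_of_reindex[OF inj_signed_index assms(2) corner_A_inf[OF assms(1)]],
      rule sym_act_of_reindex[OF inj_xi_index assms(2) corner_A_inf_pos[OF assms(1)]])

section \<open>A law of large numbers for the Gram matrix\<close>

lemma std_normal_moments:
  "integrable std_normal (\<lambda>t. t ^ k)"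
  "(\<integral>t. t \<partial>std_normal) = 0" "(\<integral>t. t\<^sup>2 \<partial>std_normal) = 1" "(\<integral>t. t ^ 4 \<partial>std_normal) = 3"
proof -
  show "integrable std_normal (\<lambda>t. t ^ k)"
    using integrable_std_normal_moment[of k] by (subst integrable_density) auto
  have m: "(\<integral>t. t ^ k \<partial>std_normal) = (\<integral>t. std_normal_density t * t ^ k \<partial>lborel)" for k
    by (subst integral_density) auto
  show "(\<integral>t. t \<partial>std_normal) = 0" using m[of 1] integral_std_normal_moment_odd[of 0] by simp
  show "(\<integral>t. t\<^sup>2 \<partial>std_normal) = 1" using m[of 2] integral_std_normal_moment_even[of 1] by simp
  show "(\<integral>t. t ^ 4 \<partial>std_normal) = 3"
    using m[of 4] integral_std_normal_moment_even[of 2] by (simp add: fact_numeral)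
qed

lemma gauss_prod_integral_prod:
  assumes I: "finite I" and f: "\<And>i. i \<in> I \<Longrightarrow> integrable std_normal (f i)"
  shows "integrable gauss_prod (\<lambda>w. \<Prod>i\<in>I. f i (w i) :: real)"
    "(\<integral>w. (\<Prod>i\<in>I. f i (w i)) \<partial>gauss_prod) = (\<Prod>i\<in>I. \<integral>t. f i t \<partial>std_normal)"
proof -
  interpret N: prob_space std_normal by (rule prob_space_std_normal)
  interpret S: product_sigma_finite "\<lambda>_ :: 'a. std_normal" ..
  have d: "distr gauss_prod (PiM I (\<lambda>_. std_normal)) (\<lambda>w. \<lambda>n\<in>I. w n) = PiM I (\<lambda>_. std_normal)"
    using distr_PiM_reindex[of UNIV "\<lambda>_. std_normal" "\<lambda>i. i" I] prob_space_std_normal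
    by (simp add: gauss_prod_def)
  have m: "(\<lambda>w. \<lambda>n\<in>I. w n) \<in> measurable gauss_prod (PiM I (\<lambda>_. std_normal))"
    unfolding gauss_prod_def by (rule measurable_restrict) (rule measurable_component_singleton, simp)
  have int: "integrable (PiM I (\<lambda>_. std_normal)) (\<lambda>w. \<Prod>i\<in>I. f i (w i))"
    by (rule S.product_integrable_prod[OF I f])
  then have fm: "(\<lambda>w. \<Prod>i\<in>I. f i (w i)) \<in> borel_measurable (PiM I (\<lambda>_. std_normal))" by simp
  have eq: "(\<Prod>i\<in>I. f i ((\<lambda>n\<in>I. w n) i)) = (\<Prod>i\<in>I. f i (w i))" for w
    by (rule prod.cong) auto
  show "integrable gauss_prod (\<lambda>w. \<Prod>i\<in>I. f i (w i))"
    using int integrable_distr_eq[OF m fm] unfolding d eq by simp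
  show "(\<integral>w. (\<Prod>i\<in>I. f i (w i)) \<partial>gauss_prod) = (\<Prod>i\<in>I. \<integral>t. f i t \<partial>std_normal)"
    using integral_distr[OF m fm] S.product_integral_prod[OF I f] unfolding d eq by simp
qed

lemma (in prob_space) uncorrelated_sum_tail:
  fixes Y :: "nat \<Rightarrow> 'a \<Rightarrow> real"
  assumes Y: "\<And>j k. j < N \<Longrightarrow> k < N \<Longrightarrow> integrable M (\<lambda>w. Y j w * Y k w)"
    and off: "\<And>j k. j < N \<Longrightarrow> k < N \<Longrightarrow> j \<noteq> k \<Longrightarrow> (\<integral>w. Y j w * Y k w \<partial>M) = 0"
    and diag: "\<And>j. j < N \<Longrightarrow> (\<integral>w. Y j w * Y j w \<partial>M) \<le> C"
    and c: "c > 0"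
  shows "measure M {w \<in> space M. c \<le> \<bar>\<Sum>j<N. Y j w\<bar>} \<le> real N * C / c\<^sup>2"
proof -
  let ?u = "\<lambda>w. (\<Sum>j<N. Y j w)\<^sup>2"
  have u: "?u w = (\<Sum>j<N. \<Sum>k<N. Y j w * Y k w)" for w
    by (simp add: power2_eq_square sum_product)
  have int: "integrable M ?u" unfolding u by (intro Bochner_Integration.integrable_sum Y) auto
  have "{w \<in> space M. c \<le> \<bar>\<Sum>j<N. Y j w\<bar>} = {w \<in> space M. c\<^sup>2 \<le> ?u w}"
    using c by (auto simp: abs_le_square_iff[symmetric])
  also have "measure M \<dots> \<le> (\<integral>w. ?u w \<partial>M) / c\<^sup>2"
    using c by (intro integral_Markov_inequality_measure[OF int sets.top]) auto
  also have "(\<integral>w. ?u w \<partial>M) = (\<Sum>j<N. \<integral>w. (\<Sum>k<N. Y j w * Y k w) \<partial>M)"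
    unfolding u by (intro Bochner_Integration.integral_sum Bochner_Integration.integrable_sum Y) auto
  also have "\<dots> = (\<Sum>j<N. \<Sum>k<N. \<integral>w. Y j w * Y k w \<partial>M)"
    by (intro sum.cong refl Bochner_Integration.integral_sum Y) auto
  also have "\<dots> = (\<Sum>j<N. \<Sum>k<N. if k = j then \<integral>w. Y j w * Y j w \<partial>M else 0)"
    by (intro sum.cong) (use off in auto)
  also have "\<dots> \<le> (\<Sum>j<N. C)" using diag by (intro sum_mono) simp
  finally show ?thesis using c by (simp add: divide_right_mono)
qed

text \<open>
  The summands are uncorrelated with variance at most 2; the value 2 is attained by the squares.
\<close>

lemma gauss_prod_cross_tail:
  fixes a b :: nat and s t :: bool
  assumes c: "c > 0"
  shows "measure gauss_prod {w. c \<le> \<bar>\<Sum>j<N. w (a, j, s) * w (b, j, t) - (if a = b \<and> s = t then 1 else 0)\<bar>}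
    \<le> real N * 2 / c\<^sup>2"
proof -
  interpret G: prob_space "gauss_prod :: gauss_coords measure"
    by (rule prob_space_gauss_prod)
  have "measure gauss_prod {w \<in> space gauss_prod. c \<le> \<bar>\<Sum>j<N. w (a, j, s) * w (b, j, t) - (if a = b \<and> s = t then 1 else 0)\<bar>}
    \<le> real N * 2 / c\<^sup>2"
  proof (cases "a = b \<and> s = t")
    case True
    define Y where "Y = (\<lambda>j (w :: gauss_coords). w (a, j, s) * w (b, j, t) - (if a = b \<and> s = t then 1 else 0))"
    have Y: "Y j w = (w (a, j, s))\<^sup>2 - 1" for j w
      unfolding Y_def by (simp add: power2_eq_square True[THEN conjunct1] True[THEN conjunct2])
    interpret N: prob_space std_normal by (rule prob_space_std_normal)
    have i1: "integrable std_normal (\<lambda>t. t\<^sup>2 - 1 :: real)"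
      by (intro Bochner_Integration.integrable_diff std_normal_moments N.integrable_const)
    have v1: "(\<integral>t. t\<^sup>2 - 1 \<partial>std_normal) = 0"
      using std_normal_moments(1)[of 2] std_normal_moments(3) N.prob_space by simp
    have e2: "(t\<^sup>2 - 1) * (t\<^sup>2 - 1) = t ^ 4 - 2 * t\<^sup>2 + 1" for t :: real
      by (simp add: power2_eq_square power4_eq_xxxx algebra_simps)
    have i2: "integrable std_normal (\<lambda>t. (t\<^sup>2 - 1) * (t\<^sup>2 - 1) :: real)"
      unfolding e2 by (intro Bochner_Integration.integrable_diff Bochner_Integration.integrable_add
          integrable_mult_right std_normal_moments N.integrable_const)
    have v2: "(\<integral>t. (t\<^sup>2 - 1) * (t\<^sup>2 - 1) \<partial>std_normal) = 2"
      unfolding e2 using std_normal_moments(1)[of 2] std_normal_moments(1)[of 4] std_normal_moments(3,4) N.prob_space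
      by (simp add: Bochner_Integration.integral_diff Bochner_Integration.integral_add)
    have pair: "integrable gauss_prod (\<lambda>w. Y j w * Y k w)"
      "(\<integral>w. Y j w * Y k w \<partial>gauss_prod) = (if j = k then 2 else 0)" for j k
    proof -
      have "integrable gauss_prod (\<lambda>w. Y j w * Y k w) \<and>
        (\<integral>w. Y j w * Y k w \<partial>gauss_prod) = (if j = k then 2 else 0)"
      proof (cases "j = k")
        case True
        then show ?thesis
          using gauss_prod_integral_prod[of "{(a, j, s)}" "\<lambda>_ t. (t\<^sup>2 - 1) * (t\<^sup>2 - 1)"] i2 v2
          unfolding Y by simp
      next
        case False
        then show ?thesis
          using gauss_prod_integral_prod[of "{(a, j, s), (a, k, s)}" "\<lambda>_ t. t\<^sup>2 - 1"] i1 v1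
          unfolding Y by simp
      qed
      then show "integrable gauss_prod (\<lambda>w. Y j w * Y k w)"
        "(\<integral>w. Y j w * Y k w \<partial>gauss_prod) = (if j = k then 2 else 0)" by auto
    qed
    have "measure gauss_prod {w \<in> space gauss_prod. c \<le> \<bar>\<Sum>j<N. Y j w\<bar>} \<le> real N * 2 / c\<^sup>2"
      by (rule G.uncorrelated_sum_tail[OF _ _ _ c]) (auto simp: pair)
    then show ?thesis unfolding Y_def .
  next
    case False
    define Y where "Y = (\<lambda>j (w :: gauss_coords). w (a, j, s) * w (b, j, t) - (if a = b \<and> s = t then 1 else 0))"
    have Y: "Y j w = w (a, j, s) * w (b, j, t)" for j w
      unfolding Y_def using False by simp
    have i1: "integrable std_normal (\<lambda>t. t :: real)" using std_normal_moments(1)[of 1] by simp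
    have i2: "integrable std_normal (\<lambda>t. t * t :: real)"
      using std_normal_moments(1)[of 2] by (simp add: power2_eq_square)
    have v2: "(\<integral>t. t * t \<partial>std_normal) = 1" using std_normal_moments(3) by (simp add: power2_eq_square)
    have pair: "integrable gauss_prod (\<lambda>w. Y j w * Y k w)"
      "(\<integral>w. Y j w * Y k w \<partial>gauss_prod) = (if j = k then 1 else 0)" for j k
    proof -
      have "integrable gauss_prod (\<lambda>w. Y j w * Y k w) \<and>
        (\<integral>w. Y j w * Y k w \<partial>gauss_prod) = (if j = k then 1 else 0)"
      proof (cases "j = k")
        case True
        then show ?thesis
          using gauss_prod_integral_prod[of "{(a, j, s), (b, j, t)}" "\<lambda>_ t. t * t"] i2 v2 False
          unfolding Y by (auto simp: mult_ac)
      next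
        case jk: False
        then show ?thesis
          using gauss_prod_integral_prod[of "{(a, j, s), (b, j, t), (a, k, s), (b, k, t)}" "\<lambda>_ t. t"]
            i1 std_normal_moments(2) False
          unfolding Y by (auto simp: mult_ac)
      qed
      then show "integrable gauss_prod (\<lambda>w. Y j w * Y k w)"
        "(\<integral>w. Y j w * Y k w \<partial>gauss_prod) = (if j = k then 1 else 0)" by auto
    qed
    have "measure gauss_prod {w \<in> space gauss_prod. c \<le> \<bar>\<Sum>j<N. Y j w\<bar>} \<le> real N * 2 / c\<^sup>2"
      by (rule G.uncorrelated_sum_tail[OF _ _ _ c]) (auto simp: pair)
    then show ?thesis unfolding Y_def .
  qed
  then show ?thesis by simp
qed

text \<open>
  The event that all real and imaginary inner products of the first \<open>K\<close> rows, of length \<open>N\<close>, are within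
  \<open>c * N\<close> of their expectations. For small \<open>c\<close>, \<open>scaled_ginibre K N\<close> is
  nearly a coisometry on it.
\<close>

definition near_coisometry :: "nat \<Rightarrow> nat \<Rightarrow> real \<Rightarrow> gauss_coords set" where
  "near_coisometry K N c = {w. \<forall>a<K. \<forall>b<K. \<forall>s t.
     \<bar>\<Sum>j<N. w (a, j, s) * w (b, j, t) - (if a = b \<and> s = t then 1 else 0)\<bar> < c * real N}"

lemma measurable_cross_sum:
  "(\<lambda>w. \<bar>\<Sum>j<N. w (a, j, s) * w (b, j, t) - d\<bar>) \<in> borel_measurable (gauss_prod :: gauss_coords measure)"
  by (intro borel_measurable_abs borel_measurable_sum borel_measurable_diff borel_measurable_times
      measurable_gauss_prod_coord borel_measurable_const)

lemma near_coisometry_sets: "near_coisometry K N c \<in> sets gauss_prod"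
proof -
  have "near_coisometry K N c = {w \<in> space gauss_prod. \<forall>a\<in>{..<K}. \<forall>b\<in>{..<K}. \<forall>s\<in>UNIV. \<forall>t\<in>UNIV.
     \<bar>\<Sum>j<N. w (a, j, s) * w (b, j, t) - (if a = b \<and> s = t then 1 else 0)\<bar> < c * real N}"
    by (auto simp: near_coisometry_def)
  also have "\<dots> \<in> sets gauss_prod"
  proof (intro sets.sets_Collect_finite_All)
    fix a b :: nat and s t :: bool
    have "(\<lambda>w. \<bar>\<Sum>j<N. w (a, j, s) * w (b, j, t) - (if a = b \<and> s = t then 1 else 0)\<bar>)
      \<in> borel_measurable (gauss_prod :: gauss_coords measure)"
      by (rule measurable_cross_sum)
    then show "{w \<in> space gauss_prod. \<bar>\<Sum>j<N. w (a, j, s) * w (b, j, t) - (if a = b \<and> s = t then 1 else 0)\<bar> < c * real N}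
      \<in> sets (gauss_prod :: gauss_coords measure)"
      by (rule borel_measurable_less) simp
  qed auto
  finally show ?thesis .
qed

lemma near_coisometry_prob:
  assumes c: "c > 0" and N: "N > 0"
  shows "measure gauss_prod (UNIV - near_coisometry K N c) \<le> 8 * (real K)\<^sup>2 / (c\<^sup>2 * real N)"
proof -
  interpret G: prob_space "gauss_prod :: gauss_coords measure"
    by (rule prob_space_gauss_prod)
  define B :: "nat \<times> nat \<times> bool \<times> bool \<Rightarrow> gauss_coords set"
    where "B = (\<lambda>(a, b, s, t). {w. c * real N \<le>
     \<bar>\<Sum>j<N. w (a, j, s) * w (b, j, t) - (if a = b \<and> s = t then 1 else 0)\<bar>})"
  define J where "J = {..<K} \<times> {..<K} \<times> (UNIV :: bool set) \<times> (UNIV :: bool set)"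
  have sub: "UNIV - near_coisometry K N c \<subseteq> (\<Union>i\<in>J. B i)"
  proof
    fix w assume "w \<in> UNIV - near_coisometry K N c"
    then obtain a b s t where ab: "a < K" "b < K"
      and far: "\<not> \<bar>\<Sum>j<N. w (a, j, s) * w (b, j, t) - (if a = b \<and> s = t then 1 else 0)\<bar> < c * real N"
      unfolding near_coisometry_def by blast
    have "w \<in> B (a, b, s, t)" using far unfolding B_def prod.case mem_Collect_eq not_less .
    moreover have "(a, b, s, t) \<in> J" using ab by (simp add: J_def)
    ultimately show "w \<in> (\<Union>i\<in>J. B i)" by blast
  qed
  have Bs: "B i \<in> sets gauss_prod" for i
  proof -
    obtain a b s t where i: "i = (a, b, s, t)" by (cases i)
    have "B i = {w \<in> space gauss_prod. c * real N \<le>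
     \<bar>\<Sum>j<N. w (a, j, s) * w (b, j, t) - (if a = b \<and> s = t then 1 else 0)\<bar>}"
      by (simp add: B_def i)
    also have "\<dots> \<in> sets gauss_prod"
      by (rule borel_measurable_le[OF borel_measurable_const measurable_cross_sum])
    finally show ?thesis .
  qed
  have "measure gauss_prod (UNIV - near_coisometry K N c) \<le> measure gauss_prod (\<Union>i\<in>J. B i)"
    by (rule G.finite_measure_mono[OF sub]) (use Bs in \<open>auto simp: J_def\<close>)
  moreover have "measure gauss_prod (\<Union>i\<in>J. B i) \<le> (\<Sum>i\<in>J. measure gauss_prod (B i))"
    by (rule G.finite_measure_subadditive_finite) (use Bs in \<open>auto simp: J_def\<close>)
  moreover have "(\<Sum>i\<in>J. measure gauss_prod (B i)) \<le> (\<Sum>i\<in>J. 2 / (c\<^sup>2 * real N))"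
  proof (rule sum_mono)
    fix i assume "i \<in> J"
    obtain a b s t where i: "i = (a, b, s, t)" by (cases i)
    have "measure gauss_prod (B i) \<le> real N * 2 / (c * real N)\<^sup>2"
      unfolding i B_def prod.case using c N by (intro gauss_prod_cross_tail) simp
    also have "\<dots> = 2 / (c\<^sup>2 * real N)" using N by (simp add: power2_eq_square)
    finally show "measure gauss_prod (B i) \<le> 2 / (c\<^sup>2 * real N)" .
  qed
  moreover have "(\<Sum>i\<in>J. 2 / (c\<^sup>2 * real N)) = 8 * (real K)\<^sup>2 / (c\<^sup>2 * real N)"
    by (simp add: J_def card_cartesian_product power2_eq_square)
  ultimately show ?thesis by linarith
qed

lemma near_coisometry_gram:
  assumes w: "w \<in> near_coisometry K N c" and N: "N > 0" and ab: "a < K" "b < K"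
  shows "cmod ((scaled_ginibre K N w * mat_adjoint (scaled_ginibre K N w)) $$ (a, b) - (if a = b then 1 else 0)) \<le> 2 * c"
proof -
  let ?S = "\<lambda>s t. \<Sum>j<N. w (a, j, s) * w (b, j, t) - (if a = b \<and> s = t then 1 else 0)"
  have S: "\<bar>?S s t\<bar> \<le> c * real N" for s t
  proof -
    have "\<bar>?S s t\<bar> < c * real N" using w ab unfolding near_coisometry_def mem_Collect_eq by blast
    then show ?thesis by (rule less_imp_le)
  qed
  have sq: "complex_of_real (sqrt (2 * real N)) * complex_of_real (sqrt (2 * real N)) = complex_of_real (2 * real N)"
    unfolding of_real_mult[symmetric] by simp
  have entry: "gauss_cplx w a j / complex_of_real (sqrt (2 * real N)) * cnj (gauss_cplx w b j / complex_of_real (sqrt (2 * real N)))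
    = Complex (w (a, j, False) * w (b, j, False) + w (a, j, True) * w (b, j, True))
        (w (a, j, True) * w (b, j, False) - w (a, j, False) * w (b, j, True)) / complex_of_real (2 * real N)" for j
  proof -
    have "gauss_cplx w a j / complex_of_real (sqrt (2 * real N)) * cnj (gauss_cplx w b j / complex_of_real (sqrt (2 * real N)))
      = gauss_cplx w a j * cnj (gauss_cplx w b j) / (complex_of_real (sqrt (2 * real N)) * complex_of_real (sqrt (2 * real N)))"
      by simp
    then show ?thesis unfolding sq by (simp add: gauss_cplx_def complex_eq_iff)
  qed
  have "(scaled_ginibre K N w * mat_adjoint (scaled_ginibre K N w)) $$ (a, b)
      = (\<Sum>j<N. scaled_ginibre K N w $$ (a, j) * cnj (scaled_ginibre K N w $$ (b, j)))"
    by (rule mat_mult_adjoint_index) (use ab in auto)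
  also have "\<dots> = (\<Sum>j<N. Complex (w (a, j, False) * w (b, j, False) + w (a, j, True) * w (b, j, True))
        (w (a, j, True) * w (b, j, False) - w (a, j, False) * w (b, j, True)) / complex_of_real (2 * real N))"
    by (rule sum.cong) (use ab entry in \<open>auto simp: scaled_ginibre_def\<close>)
  also have "\<dots> = Complex (\<Sum>j<N. w (a, j, False) * w (b, j, False) + w (a, j, True) * w (b, j, True))
        (\<Sum>j<N. w (a, j, True) * w (b, j, False) - w (a, j, False) * w (b, j, True)) / complex_of_real (2 * real N)"
    unfolding sum_divide_distrib[symmetric] by (simp add: complex_eq_iff)
  finally have eq: "(scaled_ginibre K N w * mat_adjoint (scaled_ginibre K N w)) $$ (a, b) - (if a = b then 1 else 0)
    = Complex (?S False False + ?S True True) (?S True False - ?S False True) / complex_of_real (2 * real N)"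
    using N by (auto simp: complex_eq_iff sum.distrib sum_subtractf field_simps)
  have "cmod (Complex (?S False False + ?S True True) (?S True False - ?S False True))
    \<le> \<bar>?S False False + ?S True True\<bar> + \<bar>?S True False - ?S False True\<bar>"
    using cmod_le[of "Complex (?S False False + ?S True True) (?S True False - ?S False True)"] by simp
  also have "\<dots> \<le> 4 * (c * real N)"
    using S[of False False] S[of True True] S[of True False] S[of False True] by linarith
  finally have "cmod (Complex (?S False False + ?S True True) (?S True False - ?S False True)) / (2 * real N) \<le> 4 * (c * real N) / (2 * real N)"
    by (rule divide_right_mono) simp
  also have "\<dots> = 2 * c" using N by simp
  finally show ?thesis unfolding eq norm_divide norm_of_real using N by simp
qed

section \<open>Comparison of the two laws\<close>

text \<open>
  The error bound does not depend on \<open>x\<close>. The proof adds \<open>B\<close> to \<open>h\<close>, so that nonnegative integrals and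
  Tonelli's theorem apply.
\<close>

lemma Haar_Ginibre_comparison:
  fixes h :: "(nat \<Rightarrow> real) \<Rightarrow> real"
  assumes cont: "continuous_on (Rn K) h"
    and B: "B \<ge> 0" "\<And>y. y \<in> Rn K \<Longrightarrow> \<bar>h y\<bar> \<le> B"
    and \<eta>: "\<And>H P. hermitian_mat K H \<Longrightarrow> P \<in> carrier_mat K K \<Longrightarrow>
      (\<And>i j. i < K \<Longrightarrow> j < K \<Longrightarrow> cmod (P $$ (i, j) - (if i = j then 1 else 0)) \<le> \<eta>) \<Longrightarrow>
      \<bar>h (eval_ord K (P * H * mat_adjoint P)) - h (eval_ord K H)\<bar> \<le> \<epsilon>"
    and \<epsilon>: "\<epsilon> \<ge> 0" and c: "4 * (real K)\<^sup>2 * c \<le> 1" "real K * ((real K)\<^sup>2 * (2 * c)) \<le> \<eta>"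
    and KN: "K \<le> N" "N > 0"
  shows "\<bar>(\<integral>w. h (wishart_eval K N x (scaled_ginibre K N w)) \<partial>gauss_prod)
      - (\<integral>U. h (corner_eval K N x U) \<partial>haar_unitary N)\<bar>
    \<le> \<epsilon> + 2 * B * measure gauss_prod (UNIV - near_coisometry K N c)"
proof -
  interpret G: prob_space "gauss_prod :: gauss_coords measure"
    by (rule prob_space_gauss_prod)
  interpret H: prob_space "haar_unitary N" by (rule haar_unitary_measure_space(1))
  interpret P: pair_sigma_finite "gauss_prod :: gauss_coords measure" "haar_unitary N" ..
  let ?G = "scaled_ginibre K N" and ?T = "trunc_mat K N"
  let ?bad = "UNIV - near_coisometry K N c"
  let ?f = "\<lambda>y. ennreal (h y + B)"
  have Rn: "eval_ord K A \<in> Rn K" for A using eval_ord_in_weyl[of K A] by (simp add: weyl_def)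
  have h0: "0 \<le> h (eval_ord K A) + B" "h (eval_ord K A) + B \<le> 2 * B" for A
    using B(2)[OF Rn, of A] by (auto simp: abs_le_iff)
  have hm: "h \<in> borel_measurable (weyl_borel K)" by (rule borel_measurable_weyl_of_continuous[OF cont])
  then have fm: "?f \<in> borel_measurable (weyl_borel K)" by measurable
  have bad_sets: "?bad \<in> sets gauss_prod" using near_coisometry_sets[of K N c] by (metis sets.compl_sets space_gauss_prod)
  have wm: "(\<lambda>w. wishart_eval K N x (?G w)) \<in> measurable gauss_prod (weyl_borel K)"
    by (intro measurable_wishart_eval measurable_scaled_ginibre) auto
  have cm: "corner_eval K N x \<in> measurable (haar_unitary N) (weyl_borel K)"
    unfolding measurable_haar_iff by (rule measurable_corner_eval_fixed[OF KN(1)])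
  define a where "a = (\<integral>\<^sup>+w. ?f (wishart_eval K N x (?G w)) \<partial>gauss_prod)"
  define b where "b = (\<integral>\<^sup>+U. ?f (corner_eval K N x U) \<partial>haar_unitary N)"
  have wU: "(\<lambda>(w, U). wishart_eval K N x (?G w * U)) \<in> measurable (gauss_prod \<Otimes>\<^sub>M haar_unitary N) (weyl_borel K)"
  proof -
    have s: "sets (gauss_prod \<Otimes>\<^sub>M haar_unitary N :: (gauss_coords \<times> complex mat) measure)
        = sets (gauss_prod \<Otimes>\<^sub>M unitary_borel N)"
      by (intro sets_pair_measure_cong refl haar_unitary_measure_space(2))
    have sU: "snd \<in> measurable (gauss_prod \<Otimes>\<^sub>M unitary_borel N) (mat_borel N)"
      by (rule measurable_unitary_borelD) simp
    have "(\<lambda>p. wishart_eval K N x (Matrix.mat K N (\<lambda>(i, j). \<Sum>l<N. ?G (fst p) $$ (i, l) * snd p $$ (l, j))))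
        \<in> measurable (gauss_prod \<Otimes>\<^sub>M unitary_borel N) (weyl_borel K)"
    proof (rule measurable_wishart_eval)
      fix i j assume ij: "i < K" "j < N"
      have "(\<lambda>p. \<Sum>l<N. ?G (fst p) $$ (i, l) * snd p $$ (l, j)) \<in> borel_measurable (gauss_prod \<Otimes>\<^sub>M unitary_borel N)"
        by (intro borel_measurable_sum borel_measurable_times measurable_mat_entry[OF sU]
            measurable_compose[OF measurable_fst measurable_scaled_ginibre]) (use ij in auto)
      then show "(\<lambda>p. Matrix.mat K N (\<lambda>(i, j). \<Sum>l<N. ?G (fst p) $$ (i, l) * snd p $$ (l, j)) $$ (i, j))
        \<in> borel_measurable (gauss_prod \<Otimes>\<^sub>M unitary_borel N)" using ij by simp
    qed simp
    also have "?this \<longleftrightarrow> (\<lambda>(w, U). wishart_eval K N x (?G w * U)) \<in> measurable (gauss_prod \<Otimes>\<^sub>M unitary_borel N) (weyl_borel K)"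
    proof (rule measurable_cong)
      fix p :: "gauss_coords \<times> complex mat"
      assume "p \<in> space (gauss_prod \<Otimes>\<^sub>M unitary_borel N)"
      then have "snd p \<in> unitary_group N" by (auto simp: space_pair_measure)
      note Ud = unitary_groupD[OF this]
      have "Matrix.mat K N (\<lambda>(i, j). \<Sum>l<N. ?G (fst p) $$ (i, l) * snd p $$ (l, j)) = ?G (fst p) * snd p"
        by (intro eq_matI) (use Ud in \<open>auto simp: mat_mult_index simp del: index_mult_mat(1)\<close>)
      then show "wishart_eval K N x (Matrix.mat K N (\<lambda>(i, j). \<Sum>l<N. ?G (fst p) $$ (i, l) * snd p $$ (l, j)))
        = (case p of (w, U) \<Rightarrow> wishart_eval K N x (?G w * U))" by (simp add: case_prod_unfold)
    qed
    finally show ?thesis using measurable_cong_sets[OF s refl] by blast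
  qed
  \<comment> \<open>the Gaussian matrix may be multiplied by an independent Haar unitary matrix\<close>
  have a_eq: "a = (\<integral>\<^sup>+w. \<integral>\<^sup>+U. ?f (wishart_eval K N x (?G w * U)) \<partial>haar_unitary N \<partial>gauss_prod)"
  proof -
    have "(\<integral>\<^sup>+U. \<integral>\<^sup>+w. ?f (wishart_eval K N x (?G w * U)) \<partial>gauss_prod \<partial>haar_unitary N) = (\<integral>\<^sup>+U. a \<partial>haar_unitary N)"
    proof (rule nn_integral_cong)
      fix U assume "U \<in> space (haar_unitary N)"
      then have U: "U \<in> unitary_group N" by (simp add: haar_unitary_measure_space(3))
      show "(\<integral>\<^sup>+w. ?f (wishart_eval K N x (?G w * U)) \<partial>gauss_prod) = a"
        unfolding a_def scaled_ginibre_unitary_act[OF unitary_groupD(1)[OF U], symmetric]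
        by (rule gauss_invariantD[OF gauss_invariant_unitary[OF U] measurable_compose[OF wm fm]])
    qed
    also have "\<dots> = a" by (simp add: H.emeasure_space_1)
    finally show ?thesis
      using P.Fubini'[of "\<lambda>w U. ?f (wishart_eval K N x (?G w * U))"] measurable_compose[OF wU fm]
      by (simp add: case_prod_unfold)
  qed
  define A where "A = (\<lambda>w. \<integral>\<^sup>+U. ?f (wishart_eval K N x (?G w * U)) \<partial>haar_unitary N)"
  \<comment> \<open>for a fixed good Gaussian matrix the average over the Haar measure is already close to \<open>b\<close>\<close>
  have AB: "A w \<le> b + ennreal \<epsilon> \<and> b \<le> A w + ennreal \<epsilon>" if w: "w \<in> near_coisometry K N c" for w
  proof -
    obtain Q W where Q: "Q \<in> carrier_mat K K" "W \<in> unitary_group N" "?G w = Q * ?T * W"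
      and Qnear: "\<And>i j. i < K \<Longrightarrow> j < K \<Longrightarrow> cmod (Q $$ (i, j) - (if i = j then 1 else 0)) \<le> real K * ((real K)\<^sup>2 * (2 * c))"
      using near_coisometry_polar[OF scaled_ginibre_dim(1) KN(1) near_coisometry_gram[OF w KN(2)]] c(1) by auto
    note Wd = unitary_groupD[OF Q(2)]
    have bW: "b = (\<integral>\<^sup>+U. ?f (corner_eval K N x (W * U)) \<partial>haar_unitary N)"
      unfolding b_def
      by (rule is_haar_unitaryD(4)[OF haar_unitary_is_haar Q(2), symmetric])
         (rule measurable_compose[OF measurable_corner_eval_fixed[OF KN(1)] fm])
    have close: "\<bar>h (wishart_eval K N x (?G w * U)) - h (corner_eval K N x (W * U))\<bar> \<le> \<epsilon>"
      if "U \<in> unitary_group N" for U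
    proof -
      note Ud = unitary_groupD[OF that]
      let ?X = "conj_diag N x (W * U)"
      have Xc: "?X \<in> carrier_mat N N" "hermitian_mat N ?X"
        by (rule conj_diag_carrier conj_diag_hermitian, rule mult_carrier_mat[OF Wd(1) Ud(1)])+
      have "conj_diag N x (?G w * U) = conj_diag N x (Q * ?T * (W * U))"
        unfolding Q(3) using Q(1) Wd Ud by (auto simp: mat_mult_assoc)
      also have "\<dots> = (Q * ?T) * ?X * mat_adjoint (Q * ?T)"
        by (rule conj_diag_mult) (use Q(1) Wd Ud in auto)
      also have "\<dots> = Q * corner K ?X * mat_adjoint Q"
        unfolding corner_eq_trunc[OF Xc(1) KN(1)] using Q(1) Xc(1) by (auto simp: mat_adjoint_mult mat_mult_assoc)
      finally have "wishart_eval K N x (?G w * U) = eval_ord K (Q * corner K ?X * mat_adjoint Q)"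
        by (simp add: wishart_eval_def)
      moreover have "\<bar>h (eval_ord K (Q * corner K ?X * mat_adjoint Q)) - h (eval_ord K (corner K ?X))\<bar> \<le> \<epsilon>"
        by (rule \<eta>[OF hermitian_corner[OF Xc(2) KN(1)] Q(1)]) (use Qnear c(2) in \<open>meson order_trans\<close>)
      ultimately show ?thesis by (simp add: corner_eval_def)
    qed
    have mono: "(\<integral>\<^sup>+U. ?f (F U) \<partial>haar_unitary N) \<le> (\<integral>\<^sup>+U. ?f (F' U) \<partial>haar_unitary N) + ennreal \<epsilon>"
      if F: "\<And>U. U \<in> unitary_group N \<Longrightarrow> \<bar>h (F U) - h (F' U)\<bar> \<le> \<epsilon> \<and> 0 \<le> h (F' U) + B"
        and F'm: "(\<lambda>U. ?f (F' U)) \<in> borel_measurable (haar_unitary N)" for F F'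
    proof -
      have "(\<integral>\<^sup>+U. ?f (F U) \<partial>haar_unitary N) \<le> (\<integral>\<^sup>+U. ?f (F' U) + ennreal \<epsilon> \<partial>haar_unitary N)"
      proof (rule nn_integral_mono)
        fix U assume "U \<in> space (haar_unitary N)"
        then have "\<bar>h (F U) - h (F' U)\<bar> \<le> \<epsilon>" "0 \<le> h (F' U) + B" using F haar_unitary_measure_space(3) by auto
        then show "?f (F U) \<le> ?f (F' U) + ennreal \<epsilon>"
        proof -
          have "?f (F' U) + ennreal \<epsilon> = ennreal (h (F' U) + B + \<epsilon>)"
            using \<open>0 \<le> h (F' U) + B\<close> \<epsilon> by (rule ennreal_plus[symmetric])
          then show ?thesis using \<open>\<bar>h (F U) - h (F' U)\<bar> \<le> \<epsilon>\<close> by (auto intro!: ennreal_leI)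
        qed
      qed
      also have "\<dots> = (\<integral>\<^sup>+U. ?f (F' U) \<partial>haar_unitary N) + ennreal \<epsilon>"
        using F'm by (subst nn_integral_add) (auto simp: H.emeasure_space_1)
      finally show ?thesis .
    qed
    have m1: "(\<lambda>U. ?f (corner_eval K N x (W * U))) \<in> borel_measurable (haar_unitary N)"
      unfolding measurable_haar_iff
      by (rule measurable_compose[OF measurable_unitary_mult measurable_compose[OF measurable_corner_eval_fixed[OF KN(1)] fm]])
         (use Q(2) in auto)
    have m2: "(\<lambda>U. ?f (wishart_eval K N x (?G w * U))) \<in> borel_measurable (haar_unitary N)"
      using measurable_compose[OF measurable_Pair2[OF wU, of w] fm] by simp
    have "A w \<le> b + ennreal \<epsilon>"
      unfolding A_def bW using close h0(1) by (intro mono m1) (auto simp: corner_eval_def)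
    moreover have "b \<le> A w + ennreal \<epsilon>"
      unfolding A_def bW using close h0(1)
      by (intro mono m2) (auto simp: wishart_eval_def abs_minus_commute)
    ultimately show ?thesis by blast
  qed
  have A2: "A w \<le> ennreal (2 * B)" for w
  proof -
    have "A w \<le> (\<integral>\<^sup>+U. ennreal (2 * B) \<partial>haar_unitary N)"
      unfolding A_def by (intro nn_integral_mono ennreal_leI) (simp add: wishart_eval_def h0(2))
    then show ?thesis by (simp add: H.emeasure_space_1)
  qed
  have b2: "b \<le> ennreal (2 * B)"
  proof -
    have "b \<le> (\<integral>\<^sup>+U. ennreal (2 * B) \<partial>haar_unitary N)"
      unfolding b_def by (intro nn_integral_mono ennreal_leI) (simp add: corner_eval_def h0(2))
    then show ?thesis by (simp add: H.emeasure_space_1)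
  qed
  have Am: "A \<in> borel_measurable gauss_prod"
    unfolding A_def
    using H.borel_measurable_nn_integral_fst[of "\<lambda>p. ?f ((\<lambda>(w, U). wishart_eval K N x (?G w * U)) p)" gauss_prod]
      measurable_compose[OF wU fm] by simp
  have bad_int: "(\<integral>\<^sup>+w. ennreal (2 * B) * indicator ?bad w \<partial>gauss_prod) = ennreal (2 * B * measure gauss_prod ?bad)"
    using bad_sets B(1) by (simp add: nn_integral_cmult_indicator G.emeasure_eq_measure ennreal_mult)
  let ?err = "\<epsilon> + 2 * B * measure gauss_prod ?bad"
  have em: "emeasure (gauss_prod :: gauss_coords measure) UNIV = 1"
    using G.emeasure_space_1 by simp
  have const: "(\<integral>\<^sup>+w. z \<partial>(gauss_prod :: gauss_coords measure)) = z" for z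
    using em by simp
  have err: "ennreal \<epsilon> + ennreal (2 * B * measure gauss_prod ?bad) = ennreal ?err"
    using \<epsilon> B(1) by (simp add: ennreal_plus)
  have le1: "a \<le> b + ennreal ?err"
  proof -
    have "a \<le> (\<integral>\<^sup>+w. (b + ennreal \<epsilon>) + ennreal (2 * B) * indicator ?bad w \<partial>gauss_prod)"
      unfolding a_eq A_def[symmetric]
    proof (rule nn_integral_mono)
      fix w
      show "A w \<le> (b + ennreal \<epsilon>) + ennreal (2 * B) * indicator ?bad w"
      proof (cases "w \<in> near_coisometry K N c")
        case True
        then show ?thesis using AB[OF True] by simp
      next
        case False
        then show ?thesis using A2[of w] by (simp add: add_increasing)
      qed
    qed
    also have "\<dots> = (b + ennreal \<epsilon>) + ennreal (2 * B * measure gauss_prod ?bad)"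
      using bad_sets by (subst nn_integral_add) (auto simp: bad_int em)
    also have "\<dots> = b + ennreal ?err" unfolding err[symmetric] by (simp add: add.assoc)
    finally show ?thesis .
  qed
  have le2: "b \<le> a + ennreal ?err"
  proof -
    have "b = (\<integral>\<^sup>+w. b \<partial>(gauss_prod :: gauss_coords measure))" by (simp only: const)
    also have "\<dots> \<le> (\<integral>\<^sup>+w. A w + (ennreal \<epsilon> + ennreal (2 * B) * indicator ?bad w) \<partial>gauss_prod)"
    proof (rule nn_integral_mono)
      fix w
      show "b \<le> A w + (ennreal \<epsilon> + ennreal (2 * B) * indicator ?bad w)"
      proof (cases "w \<in> near_coisometry K N c")
        case True
        then show ?thesis using AB[OF True] by simp
      next
        case False
        then show ?thesis using b2 by (simp add: add_increasing)
      qed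
    qed
    also have "\<dots> = a + (ennreal \<epsilon> + ennreal (2 * B * measure gauss_prod ?bad))"
      unfolding a_eq A_def[symmetric]
      using bad_sets Am by (subst nn_integral_add, simp, simp, subst nn_integral_add) (auto simp: bad_int em)
    finally show ?thesis unfolding err .
  qed
  have real_a: "(\<integral>w. h (wishart_eval K N x (?G w)) \<partial>gauss_prod) = enn2real a - B"
  proof -
    have int: "integrable gauss_prod (\<lambda>w. h (wishart_eval K N x (?G w)))"
      by (rule G.integrable_const_bound[where B=B])
         (use B(2) Rn measurable_compose[OF wm hm] in \<open>auto simp: wishart_eval_def\<close>)
    have "(\<integral>w. h (wishart_eval K N x (?G w)) + B \<partial>gauss_prod) = enn2real a"
      unfolding a_def by (rule integral_eq_nn_integral)
        (use measurable_compose[OF wm hm] h0 in \<open>auto simp: wishart_eval_def\<close>)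
    then show ?thesis using int G.prob_space by simp
  qed
  have real_b: "(\<integral>U. h (corner_eval K N x U) \<partial>haar_unitary N) = enn2real b - B"
  proof -
    have int: "integrable (haar_unitary N) (\<lambda>U. h (corner_eval K N x U))"
      by (rule H.integrable_const_bound[where B=B])
         (use B(2) Rn measurable_compose[OF cm hm] in \<open>auto simp: corner_eval_def\<close>)
    have "(\<integral>U. h (corner_eval K N x U) + B \<partial>haar_unitary N) = enn2real b"
      unfolding b_def by (rule integral_eq_nn_integral)
        (use measurable_compose[OF cm hm] h0 in \<open>auto simp: corner_eval_def\<close>)
    then show ?thesis using int H.prob_space by simp
  qed
  have err0: "0 \<le> ?err" using \<epsilon> B(1) by simp
  have fin: "b < Orderings.top" using b2 by (rule le_less_trans) simp
  have fin': "a < Orderings.top" using le1 by (rule le_less_trans) (simp add: fin)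
  have plus: "enn2real (z + ennreal ?err) = enn2real z + ?err" if "z < Orderings.top" for z
    using that err0 by (cases z) (simp_all add: ennreal_plus[symmetric] del: ennreal_plus)
  have "enn2real a \<le> enn2real b + ?err"
    using enn2real_mono[OF le1] fin unfolding plus[OF fin] by simp
  moreover have "enn2real b \<le> enn2real a + ?err"
    using enn2real_mono[OF le2] fin' unfolding plus[OF fin'] by simp
  ultimately show ?thesis unfolding real_a real_b by (simp add: abs_le_iff)
qed

lemma uniform_comparison_limit:
  assumes g: "g \<in> Cc_inf K" and e: "e > 0"
  shows "\<forall>\<^sub>F N in sequentially. \<forall>x\<in>weyl N.
    \<bar>sym_act K (Lambda_inf K (omega_of N x)) g - sym_act K (Lambda_fin K N x) g\<bar> \<le> e \<and>
    \<bar>sym_act K (Lambda_inf_pos K (omega_pos_of N x)) g - sym_act K (Lambda_fin K N x) g\<bar> \<le> e"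
proof -
  have cont: "continuous_on (Rn K) (sym_test K g)"
    by (intro continuous_on_sym_test Cc_inf_continuous g)
  obtain B where B: "B \<ge> 0" "\<And>y. y \<in> Rn K \<Longrightarrow> \<bar>sym_test K g y\<bar> \<le> B"
    using sym_test_bounded[OF g] by blast
  obtain R where R: "R \<ge> 0" "\<And>y i. y \<in> Rn K \<Longrightarrow> sym_test K g y \<noteq> 0 \<Longrightarrow> i < K \<Longrightarrow> \<bar>y i\<bar> \<le> R"
    using sym_test_support[OF g] by blast
  obtain \<eta> where \<eta>: "\<eta> > 0" "\<And>H P. hermitian_mat K H \<Longrightarrow> P \<in> carrier_mat K K \<Longrightarrow>
      (\<And>i j. i < K \<Longrightarrow> j < K \<Longrightarrow> cmod (P $$ (i, j) - (if i = j then 1 else 0)) \<le> \<eta>) \<Longrightarrow>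
      \<bar>sym_test K g (eval_ord K (P * H * mat_adjoint P)) - sym_test K g (eval_ord K H)\<bar> \<le> e / 2"
    using eval_ord_perturbation_uniform[of K "sym_test K g" R "e / 2"] cont R e
    by (metis half_gt_zero)
  \<comment> \<open>small enough for the polar decomposition to exist and for its factor \<open>P\<close> to be \<open>\<eta>\<close>-close to the identity\<close>
  define c where "c = min (1 / (4 * (real K)\<^sup>2 + 1)) (\<eta> / (2 * (real K)^3 + 1))"
  have pos: "4 * (real K)\<^sup>2 + 1 > 0" "2 * (real K)^3 + 1 > 0" by (auto intro: add_nonneg_pos)
  have c: "c > 0" unfolding c_def using \<eta>(1) pos by auto
  have c1: "4 * (real K)\<^sup>2 * c \<le> 1"
  proof -
    have "(4 * (real K)\<^sup>2 + 1) * c \<le> (4 * (real K)\<^sup>2 + 1) * (1 / (4 * (real K)\<^sup>2 + 1))"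
      using pos by (intro mult_left_mono) (auto simp: c_def)
    then have "(4 * (real K)\<^sup>2 + 1) * c \<le> 1" using pos by simp
    then show ?thesis using c by (simp add: distrib_right)
  qed
  have c2: "real K * ((real K)\<^sup>2 * (2 * c)) \<le> \<eta>"
  proof -
    have "(2 * (real K)^3 + 1) * c \<le> (2 * (real K)^3 + 1) * (\<eta> / (2 * (real K)^3 + 1))"
      using pos by (intro mult_left_mono) (auto simp: c_def)
    then have "(2 * (real K)^3 + 1) * c \<le> \<eta>" using pos by simp
    then have "2 * (real K)^3 * c \<le> \<eta>" using c by (simp add: distrib_right)
    then show ?thesis by (simp add: power3_eq_cube power2_eq_square mult_ac)
  qed
  let ?p = "\<lambda>N. 2 * B * (8 * (real K)\<^sup>2 / (c\<^sup>2 * real N))"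
  have "(\<lambda>N. 2 * B * (8 * (real K)\<^sup>2 / c\<^sup>2) * inverse (real N)) \<longlonglongrightarrow> 2 * B * (8 * (real K)\<^sup>2 / c\<^sup>2) * 0"
    by (intro tendsto_intros lim_inverse_n)
  then have "?p \<longlonglongrightarrow> 0" by (simp add: field_simps)
  then have "\<forall>\<^sub>F N in sequentially. ?p N < e / 2" using e by (intro order_tendstoD) auto
  then show ?thesis
    using eventually_gt_at_top[of 0] eventually_ge_at_top[of K]
  proof eventually_elim
    case (elim N)
    show ?case
    proof
      fix x assume x: "x \<in> weyl N"
      have "\<bar>(\<integral>w. sym_test K g (wishart_eval K N x (scaled_ginibre K N w)) \<partial>gauss_prod)
          - (\<integral>U. sym_test K g (corner_eval K N x U) \<partial>haar_unitary N)\<bar>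
        \<le> e / 2 + 2 * B * measure gauss_prod (UNIV - near_coisometry K N c)"
        using e by (intro Haar_Ginibre_comparison[OF cont B \<eta>(2) _ c1 c2 elim(3,2)]) auto
      also have "2 * B * measure gauss_prod (UNIV - near_coisometry K N c) \<le> ?p N"
        using B(1) near_coisometry_prob[OF c elim(2), of K] by (intro mult_left_mono) auto
      finally have "\<bar>(\<integral>w. sym_test K g (wishart_eval K N x (scaled_ginibre K N w)) \<partial>gauss_prod)
          - (\<integral>U. sym_test K g (corner_eval K N x U) \<partial>haar_unitary N)\<bar> \<le> e"
        using elim(1) by linarith
      then show "\<bar>sym_act K (Lambda_inf K (omega_of N x)) g - sym_act K (Lambda_fin K N x) g\<bar> \<le> e \<and>
        \<bar>sym_act K (Lambda_inf_pos K (omega_pos_of N x)) g - sym_act K (Lambda_fin K N x) g\<bar> \<le> e"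
        unfolding sym_act_Lambda_inf[OF elim(2) g] sym_act_Lambda_fin[OF elim(3) x g] by simp
    qed
  qed
qed

lemma tendsto_SUP_zeroI:
  fixes f :: "nat \<Rightarrow> 'a \<Rightarrow> real"
  assumes "\<And>e. e > 0 \<Longrightarrow> \<forall>\<^sub>F N in sequentially. \<forall>x\<in>S N. \<bar>f N x\<bar> \<le> e" and ne: "\<And>N. S N \<noteq> {}"
  shows "((\<lambda>N. SUP x\<in>S N. ereal \<bar>f N x\<bar>) \<longlongrightarrow> 0) sequentially"
proof (rule order_tendstoI)
  fix a :: ereal assume a: "a < 0"
  have "a < (SUP x\<in>S N. ereal \<bar>f N x\<bar>)" for N
  proof -
    obtain x where "x \<in> S N" using ne by blast
    then have "ereal \<bar>f N x\<bar> \<le> (SUP x\<in>S N. ereal \<bar>f N x\<bar>)" by (rule SUP_upper)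
    moreover have "a < ereal \<bar>f N x\<bar>" using a by (rule less_le_trans) simp
    ultimately show ?thesis by (rule less_le_trans[rotated])
  qed
  then show "\<forall>\<^sub>F N in sequentially. a < (SUP x\<in>S N. ereal \<bar>f N x\<bar>)" by simp
next
  fix a :: ereal assume "0 < a"
  then obtain e where e: "0 < ereal e" "ereal e < a" using ereal_dense2 by blast
  then have "e > 0" by simp
  from assms(1)[OF this]
  show "\<forall>\<^sub>F N in sequentially. (SUP x\<in>S N. ereal \<bar>f N x\<bar>) < a"
  proof eventually_elim
    case (elim N)
    then have "(SUP x\<in>S N. ereal \<bar>f N x\<bar>) \<le> ereal e" by (intro SUP_least) auto
    then show ?case using e(2) by (rule le_less_trans)
  qed
qed

lemma weyl_nonempty: "weyl N \<noteq> {}" "weyl_pos N \<noteq> {}"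
proof -
  have "(\<lambda>i\<in>{..<N}. 0) \<in> weyl_pos N" by (auto simp: weyl_pos_def weyl_def Rn_def)
  then show "weyl_pos N \<noteq> {}" "weyl N \<noteq> {}" by (auto simp: weyl_pos_def)
qed

theorem theorem2p23:
  fixes K :: nat and g :: "(nat \<Rightarrow> real) \<Rightarrow> real"
  assumes "K \<ge> 1" and "g \<in> Cc_inf K"
  shows "((\<lambda>N. SUP x\<in>weyl N.
            ereal \<bar>sym_act K (Lambda_inf K (omega_of N x)) g - sym_act K (Lambda_fin K N x) g\<bar>)
          \<longlongrightarrow> 0) sequentially
     \<and> ((\<lambda>N. SUP x\<in>weyl_pos N.
            ereal \<bar>sym_act K (Lambda_inf_pos K (omega_pos_of N x)) g - sym_act K (Lambda_fin K N x) g\<bar>)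
          \<longlongrightarrow> 0) sequentially"
proof (intro conjI tendsto_SUP_zeroI weyl_nonempty)
  fix e :: real assume e: "e > 0"
  show "\<forall>\<^sub>F N in sequentially. \<forall>x\<in>weyl N.
    \<bar>sym_act K (Lambda_inf K (omega_of N x)) g - sym_act K (Lambda_fin K N x) g\<bar> \<le> e"
    using uniform_comparison_limit[OF assms(2) e] by eventually_elim blast
  show "\<forall>\<^sub>F N in sequentially. \<forall>x\<in>weyl_pos N.
    \<bar>sym_act K (Lambda_inf_pos K (omega_pos_of N x)) g - sym_act K (Lambda_fin K N x) g\<bar> \<le> e"
    using uniform_comparison_limit[OF assms(2) e] by eventually_elim (auto simp: weyl_pos_def)
qed

end
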